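(* Let $c\in\mathbb{C}\setminus\{0\}$ and $n\geq 1$, and let $g=[g_{0}:\cdots:g_{n}]$ be a holomorphic curve of $\mathbb{C}$ into $\mathbb{P}^n(\mathbb{C})$ with $\varsigma:=\varsigma(g)<1$, where $g_{0},\ldots,g_{n}$ are linearly independent over $\mathcal{P}_{c}^{1}$. Let $$\mathbf{a}_j(z)=(a_{j0}(z),\ldots,a_{jn}(z)),\qquad j\in\{0,\ldots,q\},$$ where $a_{jk}(z)$ are $c$-periodic entire functions satisfying $T(r,a_{jk})=o(T_{g}(r))$ for all $j\in\{0,\ldots,q\}$ and $k\in\{0,\ldots,n\}$. If the moving hyperplanes $$H_j(z)=\left\{[x_0:\cdots:x_n]: L_{H_j}(x,\mathbf{a}_j(z))=0\right\},\qquad j\in\{0,\ldots,q\},$$ are located in general position over $\mathcal{P}_c^1$, then $$(q-n)T_g(r)\leq\sum_{j=0}^q\tilde{N}_g^{[n,c]}(r,L_{H_j})+o(T_{g}(r))$$ for all $r$ outside of a set $E$ with finite logarithmic measure.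
   Context: A holomorphic curve $g=[g_0:\cdots:g_n]:\mathbb{C}\to\mathbb{P}^n$ is given by a reduced representation, i.e. $g_0,\ldots,g_n$ are entire functions with no common zeros in $\mathbb{C}$. Its Cartan characteristic function is $$T_g(r)=\int_0^{2\pi}u(re^{i\theta})\frac{d\theta}{2\pi}-u(0),\qquad u(z)=\max_{0\le k\le n}\log|g_k(z)|,$$ and its hyper-order is $\varsigma(g)=\limsup_{r\to\infty}\frac{\log\log T_g(r)}{\log r}$. $\mathcal{P}_c^1$ is the field of meromorphic functions in $\mathbb{C}$ of period $c$ whose hyper-order (the same limsup with the Nevanlinna characteristic $T(r,f)$) is strictly less than one. For $x=[x_0:\cdots:x_n]$ write $L_{H_j}(x,\mathbf{a}_j(z))=a_{j0}(z)x_0+\cdots+a_{jn}(z)x_n$; thus $L_{H_j}(g,\mathbf{a}_j)=a_{j0}g_0+\cdots+a_{jn}g_n$ is an entire function. The hyperplanes $H_0,\ldots,H_q$ are in general position over $\mathcal{P}_c^1$ if $q\ge n$ and any $n+1$ of the vectors $\mathbf{a}_0(z),\ldots,\mathbf{a}_q(z)$ are linearly independent over $\mathcal{P}_c^1$. A zero $z_0$ of an entire function $h$ is called $n$-successive and $c$-separated if each of the $n$ functions $h(z+\nu c)$ $(\nu=1,\ldots,n)$ vanishes at $z=z_0$ with multiplicity not less than that of $h(z)$ there. All other zeros of $h$ are called $n$-aperiodic of pace $c$. $\tilde N_g^{[n,c]}(r,L_{H_j})$ denotes the (integrated) counting function of the $n$-aperiodic zeros of pace $c$ of the function $L_{H_j}(g,\mathbf{a}_j)$,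 counted with multiplicity. A set $E\subset(0,\infty)$ has finite logarithmic measure if $\int_{E\cap[1,\infty)}dt/t<\infty$. *)

theory Defs
  imports "HOL-Complex_Analysis.Complex_Analysis" "HOL-Library.Landau_Symbols"
begin

definition circle_mean :: "(complex \<Rightarrow> real) \<Rightarrow> real \<Rightarrow> real" where
  "circle_mean u r = integral {0..2 * pi} (\<lambda>\<theta>. u (of_real r * cis \<theta>)) / (2 * pi)"

definition integrated_counting :: "(real \<Rightarrow> nat) \<Rightarrow> real \<Rightarrow> real" where
  "integrated_counting \<nu> r =
     integral {0..r} (\<lambda>t. (real (\<nu> t) - real (\<nu> 0)) / t) + real (\<nu> 0) * ln r"

definition pole_count :: "(complex \<Rightarrow> complex) \<Rightarrow> real \<Rightarrow> nat" where
  "pole_count f t = (\<Sum>z\<in>{z\<in>cball 0 t. is_pole f z}. nat (- zorder f z))"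

text \<open>The positive part of the logarithm at zeros of f is 0, because ln 0 = 0 in the library.\<close>
definition nevanlinna_char :: "(complex \<Rightarrow> complex) \<Rightarrow> real \<Rightarrow> real" where
  "nevanlinna_char f r =
     circle_mean (\<lambda>z. max 0 (ln (norm (f z)))) r + integrated_counting (pole_count f) r"

text \<open>The maximum is taken before the logarithm: the library has ln 0 = 0, whereas a vanishing
  coordinate must count as log 0 = -\<infinity>. Since the coordinates have no common zero, the
  maximum is positive.\<close>
definition cartan_char :: "nat \<Rightarrow> (nat \<Rightarrow> complex \<Rightarrow> complex) \<Rightarrow> real \<Rightarrow> real" where
  "cartan_char n g r =
     (let u = (\<lambda>z. ln (Max ((\<lambda>k. norm (g k z)) ` {0..n}))) in circle_mean u r - u 0)"

text \<open>A characteristic of a nonconstant function or curve is unbounded and nondecreasing, so the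
  values of ln at nonpositive arguments are irrelevant in the limit; a constant characteristic
  gets hyper-order 0.\<close>
definition hyper_order :: "(real \<Rightarrow> real) \<Rightarrow> ereal" where
  "hyper_order T = Limsup at_top (\<lambda>r. ereal (ln (ln (T r)) / ln r))"

text \<open>Meromorphic functions are represented by their canonical representatives: removable
  singularities are removed, and the value at a pole is 0.\<close>
definition periodic_field :: "complex \<Rightarrow> (complex \<Rightarrow> complex) set" where
  "periodic_field c = {f. f nicely_meromorphic_on UNIV \<and> (\<forall>z. f (z + c) = f z) \<and>
                          hyper_order (nevanlinna_char f) < 1}"

text \<open>Linear independence, over a field K of meromorphic functions, of the family indexed by I of
  the vectors with entries v i k for k in J. A sum of canonical representatives need not be
  canonical at the poles, so equality to the zero function is tested off a discrete closed set.\<close>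
definition lin_indep_vectors ::
  "(complex \<Rightarrow> complex) set \<Rightarrow> nat set \<Rightarrow> nat set \<Rightarrow> (nat \<Rightarrow> nat \<Rightarrow> complex \<Rightarrow> complex) \<Rightarrow> bool" where
  "lin_indep_vectors K I J v \<longleftrightarrow>
     (\<forall>\<phi>. (\<forall>i\<in>I. \<phi> i \<in> K) \<and> (\<forall>k\<in>J. \<forall>\<^sub>\<approx>z\<in>UNIV. (\<Sum>i\<in>I. \<phi> i z * v i k z) = 0)
        \<longrightarrow> (\<forall>i\<in>I. \<forall>z. \<phi> i z = 0))"

definition lin_indep_functions ::
  "(complex \<Rightarrow> complex) set \<Rightarrow> nat set \<Rightarrow> (nat \<Rightarrow> complex \<Rightarrow> complex) \<Rightarrow> bool" where
  "lin_indep_functions K I g \<longleftrightarrow>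
     (\<forall>\<phi>. (\<forall>i\<in>I. \<phi> i \<in> K) \<and> (\<forall>\<^sub>\<approx>z\<in>UNIV. (\<Sum>i\<in>I. \<phi> i z * g i z) = 0)
        \<longrightarrow> (\<forall>i\<in>I. \<forall>z. \<phi> i z = 0))"

definition reduced_representation :: "nat \<Rightarrow> (nat \<Rightarrow> complex \<Rightarrow> complex) \<Rightarrow> bool" where
  "reduced_representation n g \<longleftrightarrow>
     (\<forall>k\<in>{0..n}. g k holomorphic_on UNIV) \<and> (\<forall>z. \<exists>k\<in>{0..n}. g k z \<noteq> 0)"

definition hyperplane_form ::
  "nat \<Rightarrow> (nat \<Rightarrow> complex \<Rightarrow> complex) \<Rightarrow> (nat \<Rightarrow> complex \<Rightarrow> complex) \<Rightarrow> complex \<Rightarrow> complex" where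
  "hyperplane_form n g b z = (\<Sum>k\<in>{0..n}. b k z * g k z)"

definition general_position ::
  "(complex \<Rightarrow> complex) set \<Rightarrow> nat \<Rightarrow> nat \<Rightarrow> (nat \<Rightarrow> nat \<Rightarrow> complex \<Rightarrow> complex) \<Rightarrow> bool" where
  "general_position K n q a \<longleftrightarrow>
     q \<ge> n \<and> (\<forall>I. I \<subseteq> {0..q} \<and> card I = n + 1 \<longrightarrow> lin_indep_vectors K I {0..n} a)"

text \<open>For entire h not identically 0, the multiplicity of a zero is zorder, and zorder is 0 at
  points where the function does not vanish.\<close>
definition successive_separated :: "nat \<Rightarrow> complex \<Rightarrow> (complex \<Rightarrow> complex) \<Rightarrow> complex \<Rightarrow> bool" where
  "successive_separated n c h z\<^sub>0 \<longleftrightarrow>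
     (\<forall>\<nu>\<in>{1..n}. zorder (\<lambda>z. h (z + of_nat \<nu> * c)) z\<^sub>0 \<ge> zorder h z\<^sub>0)"

definition aperiodic_zeros :: "nat \<Rightarrow> complex \<Rightarrow> (complex \<Rightarrow> complex) \<Rightarrow> complex set" where
  "aperiodic_zeros n c h = {z. h z = 0 \<and> \<not> successive_separated n c h z}"

definition aperiodic_counting ::
  "nat \<Rightarrow> complex \<Rightarrow> (complex \<Rightarrow> complex) \<Rightarrow> real \<Rightarrow> real" where
  "aperiodic_counting n c h =
     integrated_counting (\<lambda>t. \<Sum>z\<in>aperiodic_zeros n c h \<inter> cball 0 t. nat (zorder h z))"

definition finite_log_measure :: "real set \<Rightarrow> bool" where
  "finite_log_measure E \<longleftrightarrow> E \<subseteq> {0<..} \<and> E \<in> sets lebesgue \<and>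
     (\<integral>\<^sup>+t\<in>E \<inter> {1..}. ennreal (1 / t) \<partial>lebesgue) < \<infinity>"

end

theory Submission
  imports Defs "Jordan_Normal_Form.Determinant" "HOL-Real_Asymp.Real_Asymp"
begin

text \<open>
  Let \<open>u = log max |g\<^sub>k|\<close> and let \<open>W\<close> be the Casoratian \<open>det (g\<^sub>k (z + j c))\<close>, which does not vanish
  identically because \<open>g\<^sub>0, \<dots>, g\<^sub>n\<close> are independent over the periodic field. General position
  expresses \<open>\<psi> g\<^sub>k\<close>, with a small periodic \<open>\<psi>\<close>, by any \<open>n + 1\<close> of the forms \<open>L\<^sub>j\<close>. Choosing at each
  point the \<open>n + 1\<close> smallest forms, \<open>(q - n) u\<close> is bounded by \<open>\<Sum> log |L\<^sub>j| - log |W|\<close>, up to small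
  terms and the logarithms of \<open>|L\<^sub>i (z + j c) / L\<^sub>i z|\<close>. By Jensen's formula the circle means of the
  first terms count zeros, and the successive zeros are absorbed by those of \<open>W\<close>.

  The shift quotients are estimated without the lemma on the logarithmic derivative. On a disc of
  radius \<open>R\<close> one divides the curve by \<open>exp P\<close>, where \<open>P\<close> is a polynomial whose real part
  exceeds \<open>u\<close> on the boundary circle by less than a constant (Stone-Weierstrass). The forms become
  bounded by 1; after removing a Blaschke product, which is at most 1 in modulus and whose mean logarithm
  is a difference of counting functions at \<open>R\<close> and \<open>r\<close>, Harnack's inequality compares the values
  at \<open>z\<close> and \<open>z + j c\<close>, with an error that is small relative to \<open>T(R)\<close> if \<open>R - r\<close> is large. Since the
  hyper-order is less than one, \<open>T\<close> and the counting functions hardly grow between \<open>r\<close> and \<open>r + K\<close>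
  outside a set of finite logarithmic measure.
\<close>

section \<open>Circle means\<close>

text \<open>Harnack's inequality needs functions of modulus below 1, whereas the forms
  \<open>L i\<close> may be as large as the curve; this is why \<open>exp P\<close> is divided out.
  The price is \<open>Re (P (z + j c)) - Re (P z)\<close>, whose circle mean is
  \<open>Re (P (j c)) - Re (P 0)\<close> by the mean value property; Harnack on a fixed disc makes
  it small relative to \<open>Re (P 0)\<close>. Polynomials replace the Poisson integral because the
  real part of an entire function can be exponentiated to an entire factor and has the mean value
  property on every circle, also after a shift. The gap \<open>R - r = K\<close> is fixed once a
  precision is prescribed: the error has the form \<open>const / K * T\<close>, so one exceptional
  set must serve all integers \<open>K\<close>. Since the coefficients are periodic, the inverse
  coefficients \<open>\<phi>\<close> and \<open>\<psi>\<close> taken at \<open>z\<close> also serve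
  at \<open>z + j c\<close>; this links the Casoratian of the curve to that of the forms by a
  product of determinants. The inverse is computed without division in a ring of entire functions,
  so poles have to be handled only for the quotients of cofactors that show the Casoratian to be
  nonzero.\<close>

definition has_circle_mean :: "(complex \<Rightarrow> real) \<Rightarrow> real \<Rightarrow> real \<Rightarrow> bool" where
  "has_circle_mean f r m \<longleftrightarrow>
     ((\<lambda>\<theta>. f (of_real r * cis \<theta>)) has_integral (2 * pi * m)) {0..2 * pi}"

lemma has_circle_mean_imp_eq: "has_circle_mean f r m \<Longrightarrow> circle_mean f r = m"
  unfolding has_circle_mean_def circle_mean_def by (simp add: integral_unique)

lemma has_circle_mean_const: "has_circle_mean (\<lambda>_. k) r k"
  unfolding has_circle_mean_def using has_integral_const_real[of k 0 "2*pi"] by simp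

lemma has_circle_mean_add:
  assumes "has_circle_mean f r m" "has_circle_mean g r m'"
  shows "has_circle_mean (\<lambda>z. f z + g z) r (m + m')"
  using has_integral_add[OF assms[unfolded has_circle_mean_def]]
  unfolding has_circle_mean_def by (simp add: distrib_left)

lemma has_circle_mean_cmult:
  assumes "has_circle_mean f r m"
  shows "has_circle_mean (\<lambda>z. k * f z) r (k * m)"
  using has_integral_mult_right[OF assms[unfolded has_circle_mean_def], of k]
  unfolding has_circle_mean_def by (simp add: mult.left_commute)

lemma has_circle_mean_uminus:
  assumes "has_circle_mean f r m"
  shows "has_circle_mean (\<lambda>z. - f z) r (- m)"
  using has_circle_mean_cmult[OF assms, of "-1"] by simp

lemma has_circle_mean_diff:
  assumes "has_circle_mean f r m" "has_circle_mean g r m'"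
  shows "has_circle_mean (\<lambda>z. f z - g z) r (m - m')"
  using has_circle_mean_add[OF assms(1) has_circle_mean_uminus[OF assms(2)]] by simp

lemma has_circle_mean_sum:
  assumes "finite I" "\<And>i. i \<in> I \<Longrightarrow> has_circle_mean (f i) r (m i)"
  shows "has_circle_mean (\<lambda>z. \<Sum>i\<in>I. f i z) r (\<Sum>i\<in>I. m i)"
  using assms
proof (induction I rule: finite_induct)
  case empty
  then show ?case using has_circle_mean_const[of 0] by simp
next
  case (insert x F)
  then show ?case using has_circle_mean_add[of "f x" r "m x"] by simp
qed

lemma has_circle_mean_mono:
  assumes "has_circle_mean f r m" "has_circle_mean g r m'" "r \<ge> 0"
    and "\<And>z. norm z = r \<Longrightarrow> f z \<le> g z"
  shows "m \<le> m'"
proof -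
  have "2 * pi * m \<le> 2 * pi * m'"
    using has_integral_le[OF assms(1,2)[unfolded has_circle_mean_def]] assms(3,4)
    by (simp add: norm_mult)
  then show ?thesis by simp
qed

lemma continuous_on_circle:
  assumes "continuous_on (sphere 0 r) f" "r \<ge> 0"
  shows "continuous_on S (\<lambda>\<theta>. f (of_real r * cis \<theta>))"
  by (rule continuous_on_compose2[OF assms(1)])
     (use assms(2) in \<open>auto intro!: continuous_intros simp: norm_mult\<close>)

lemma continuous_has_circle_mean:
  assumes "continuous_on (sphere 0 r) (f :: complex \<Rightarrow> real)" "r \<ge> 0"
  shows "has_circle_mean f r (circle_mean f r)"
proof -
  have "(\<lambda>\<theta>. f (of_real r * cis \<theta>)) integrable_on {0..2*pi}"
    using continuous_on_circle[OF assms] integrable_continuous_interval by blast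
  then show ?thesis
    unfolding has_circle_mean_def circle_mean_def using integrable_integral by fastforce
qed

lemma finite_circle_vimage:
  assumes "finite E" "r > 0"
  shows "finite {\<theta> \<in> {0..2*pi}. of_real r * cis \<theta> \<in> E}"
proof -
  have inj: "inj_on (\<lambda>\<theta>. complex_of_real r * cis \<theta>) {0..<2*pi}"
  proof (rule inj_onI)
    fix x y assume xy: "x \<in> {0..<2*pi}" "y \<in> {0..<2*pi}" "of_real r * cis x = of_real r * cis y"
    then have "cis x = cis y" using assms(2) by (simp only: mult_cancel_left) simp
    moreover have "Arg2pi (cis x) = x" "Arg2pi (cis y) = y"
      using xy by (auto intro!: Arg2pi_unique[of 1] simp: cis_conv_exp)
    ultimately show "x = y" by metis
  qed
  have "{\<theta> \<in> {0..2*pi}. of_real r * cis \<theta> \<in> E} \<subseteq>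
      insert (2*pi) ((\<lambda>\<theta>. of_real r * cis \<theta>) -` E \<inter> {0..<2*pi})"
    by auto
  then show ?thesis
    by (rule finite_subset) (use finite_vimage_IntI[OF assms(1) inj] in simp)
qed

text \<open>Zeros on the circle are finite in number, but there the default \<open>ln 0 = 0\<close>
  breaks identities such as the logarithm of a product being a sum. They can be ignored because they
  correspond to finitely many angles.\<close>

lemma has_circle_mean_cong_finite:
  assumes "has_circle_mean f r m" "finite E" "r > 0"
    and "\<And>z. norm z = r \<Longrightarrow> z \<notin> E \<Longrightarrow> g z = f z"
  shows "has_circle_mean g r m"
  unfolding has_circle_mean_def
  by (rule has_integral_spike_finite[OF finite_circle_vimage[OF assms(2,3)] _ assms(1)[unfolded has_circle_mean_def]])
     (use assms(3) in \<open>auto intro!: assms(4) simp: norm_mult\<close>)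

lemma has_circle_mean_mono_finite:
  assumes "has_circle_mean f r m" "has_circle_mean g r m'" "r > 0" "finite E"
    and "\<And>z. norm z = r \<Longrightarrow> z \<notin> E \<Longrightarrow> f z \<le> g z"
  shows "m \<le> m'"
proof -
  have "has_circle_mean (\<lambda>z. if z \<in> E then g z else f z) r m"
    by (rule has_circle_mean_cong_finite[OF assms(1,4,3)]) auto
  from has_circle_mean_mono[OF this assms(2)] assms(3,5) show ?thesis by auto
qed

text \<open>This is Cauchy's formula for \<open>f u / u\<close>; the factor \<open>-\<i>\<close>
  cancels the \<open>\<i>\<close> of the line element.\<close>

lemma has_circle_mean_complex:
  fixes f :: "complex \<Rightarrow> complex"
  assumes "f holomorphic_on ball 0 s" "0 < r" "r < s"
  shows "((\<lambda>\<theta>. f (of_real r * cis \<theta>)) has_integral (2 * pi * f 0)) {0..2 * pi}"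
proof -
  have 1: "((\<lambda>u. f u / (u - 0)) has_contour_integral 2 * of_real pi * \<i> * f 0) (circlepath 0 r)"
    by (rule Cauchy_integral_circlepath)
       (use assms in \<open>auto intro!: holomorphic_on_imp_continuous_on elim: holomorphic_on_subset\<close>)
  have 2: "((\<lambda>t. f (0 + of_real r * cis t) / (0 + of_real r * cis t - 0) * of_real r * \<i> * cis t)
      has_integral 2 * pi * \<i> * f 0) {0..2*pi}"
    using 1 unfolding circlepath_def by (subst (asm) has_contour_integral_part_circlepath_iff) auto
  have "((\<lambda>t. -\<i> * (f (0 + of_real r * cis t) / (0 + of_real r * cis t - 0) * of_real r * \<i> * cis t))
      has_integral -\<i> * (2 * pi * \<i> * f 0)) {0..2*pi}"
    by (rule has_integral_mult_right[OF 2])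
  moreover have "-\<i> * (f (0 + of_real r * cis t) / (0 + of_real r * cis t - 0) * of_real r * \<i> * cis t)
      = f (of_real r * cis t)" for t
    using assms(2) by (simp add: field_simps)
  moreover have "-\<i> * (2 * pi * \<i> * f 0) = 2 * pi * f 0" by (simp add: algebra_simps)
  ultimately show ?thesis by (simp only:)
qed

lemma has_circle_mean_Re:
  assumes "f holomorphic_on ball 0 s" "0 < r" "r < s"
  shows "has_circle_mean (\<lambda>z. Re (f z)) r (Re (f 0))"
  using has_integral_Re[OF has_circle_mean_complex[OF assms]]
  unfolding has_circle_mean_def by simp

lemma has_circle_mean_ln_nonvanishing:
  assumes "f holomorphic_on ball 0 s" "0 < r" "r < s" "\<And>z. z \<in> ball 0 s \<Longrightarrow> f z \<noteq> 0"
  shows "has_circle_mean (\<lambda>z. ln (norm (f z))) r (ln (norm (f 0)))"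
proof -
  obtain h where h: "h holomorphic_on ball 0 s" "\<And>x. x \<in> ball 0 s \<Longrightarrow> exp (h x) = f x"
    by (rule holomorphic_logarithm_exists[of "ball 0 s" f 0]) (use assms in auto)
  have eq: "ln (norm (f z)) = Re (h z)" if "z \<in> ball 0 s" for z
    using h(2)[OF that] by (metis ln_exp norm_exp_eq_Re)
  have "has_circle_mean (\<lambda>z. Re (h z)) r (Re (h 0))"
    by (rule has_circle_mean_Re[OF h(1) assms(2,3)])
  then have "has_circle_mean (\<lambda>z. ln (norm (f z))) r (Re (h 0))"
    by (rule has_circle_mean_cong_finite[where E = "{}"]) (use assms eq in auto)
  then show ?thesis using eq[of 0] assms by simp
qed

section \<open>The mean of the logarithmic distance to a point outside, inside or on the
  circle\<close>

lemma has_circle_mean_ln_dist_gt: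
  assumes "0 < r" "r < norm a"
  shows "has_circle_mean (\<lambda>z. ln (norm (z - a))) r (ln (norm a))"
proof -
  have "has_circle_mean (\<lambda>z. ln (norm (z - a))) r (ln (norm (0 - a)))"
    by (rule has_circle_mean_ln_nonvanishing[where s = "norm a"])
       (use assms in \<open>auto intro!: holomorphic_intros\<close>)
  then show ?thesis by simp
qed

text \<open>Reflection in the circle: on \<open>norm z = r\<close> the function
  \<open>r - cnj a * z / r\<close> has the modulus of \<open>z - a\<close>, but its only possible
  zero lies outside, so the mean is its value at 0. The radius \<open>s\<close> is taken just beyond
  \<open>r\<close>, short of that zero.\<close>

lemma has_circle_mean_ln_dist_lt:
  assumes "0 < r" "norm a < r"
  shows "has_circle_mean (\<lambda>z. ln (norm (z - a))) r (ln r)"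
proof -
  have "\<exists>s>r. norm a * s < r^2"
  proof (cases "a = 0")
    case True then show ?thesis using assms by (intro exI[of _ "r+1"]) auto
  next
    case False
    have "r < r^2 / norm a" using assms False by (simp add: field_simps power2_eq_square)
    then obtain s where "r < s" "s < r^2 / norm a" using dense by blast
    then show ?thesis using False by (intro exI[of _ s]) (auto simp: field_simps)
  qed
  then obtain s where s: "s > r" "norm a * s < r^2" by auto
  define f where "f = (\<lambda>z. complex_of_real r - cnj a * z / r)"
  have nz: "f z \<noteq> 0" if "z \<in> ball 0 s" for z
  proof
    assume "f z = 0"
    then have "cnj a * z = of_real (r^2)" using assms(1)
      by (simp add: f_def field_simps power2_eq_square)
    then have "norm (cnj a * z) = r^2" by (metis abs_power2 norm_of_real)
    moreover have "norm (cnj a * z) \<le> norm a * s"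
      using that by (auto simp: norm_mult intro!: mult_left_mono)
    ultimately show False using s by linarith
  qed
  have 1: "has_circle_mean (\<lambda>z. ln (norm (f z))) r (ln (norm (f 0)))"
    by (rule has_circle_mean_ln_nonvanishing[OF _ assms(1) s(1) nz])
       (use assms in \<open>auto simp: f_def intro!: holomorphic_intros\<close>)
  have eq: "norm (z - a) = norm (f z)" if "norm z = r" for z
  proof -
    have "z * cnj z = of_real (r^2)" using complex_norm_square[of z] that by simp
    then have "f z = z * cnj (z - a) / r" using assms
      by (simp add: f_def field_simps power2_eq_square)
    then show ?thesis using that assms
      by (simp add: norm_mult norm_divide del: complex_cnj_diff)
  qed
  have "has_circle_mean (\<lambda>z. ln (norm (z - a))) r (ln (norm (f 0)))"
    by (rule has_circle_mean_cong_finite[OF 1 finite.emptyI assms(1)]) (simp add: eq)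
  then show ?thesis using assms by (simp add: f_def)
qed

text \<open>The singular point is approached radially from outside by \<open>b k\<close>. By the
  identity \<open>sq\<close> the distances from a point of the circle to \<open>b k\<close> decrease
  with \<open>k\<close>, both correction terms being monotone in \<open>e\<close>, so monotone
  convergence gives integrability and the value together.\<close>

lemma has_circle_mean_ln_dist_eq:
  assumes "0 < r" "norm a = r"
  shows "has_circle_mean (\<lambda>z. ln (norm (z - a))) r (ln r)"
proof -
  define b where "b k = (1 + 1 / real (Suc k)) *\<^sub>R a" for k
  \<comment> \<open>At \<open>z = a\<close> the logarithms tend to minus infinity while the limit
    function has the default value \<open>ln 0 = 0\<close>; setting the value to 0 there restores
    pointwise convergence.\<close>
  define f where "f k z = (if z = a then 0 else ln (norm (z - b k)))" for k z
  have nb: "norm (b k) = (1 + 1 / real (Suc k)) * r" for k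
    unfolding b_def norm_scaleR using assms by simp
  have nbr: "norm (b k) > r" for k unfolding nb using assms by (simp add: field_simps)
  have fm: "has_circle_mean (f k) r (ln (norm (b k)))" for k
    by (rule has_circle_mean_cong_finite[OF has_circle_mean_ln_dist_gt[OF assms(1) nbr], of "{a}"])
       (use assms in \<open>auto simp: f_def\<close>)
  have aa: "a \<bullet> a = r^2" using assms(2) by (simp add: dot_square_norm)
  have sq: "(norm (z - (1 + e) *\<^sub>R a))^2 = (norm (z - a))^2 + 2 * e * (r^2 - z \<bullet> a) + e^2 * r^2"
    for z e
    unfolding power2_norm_eq_inner
    by (simp add: algebra_simps inner_add_left inner_add_right inner_diff_left inner_diff_right
          inner_commute[of a z] aa power2_eq_square)
  have mono: "norm (z - (1 + e) *\<^sub>R a) \<le> norm (z - (1 + e') *\<^sub>R a)"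
    if "norm z = r" "0 \<le> e" "e \<le> e'" for z e e'
  proof -
    have "z \<bullet> a \<le> r^2"
      using norm_cauchy_schwarz[of z a] that assms by (simp add: power2_eq_square)
    then have "e * (r^2 - z \<bullet> a) \<le> e' * (r^2 - z \<bullet> a)" using that by (intro mult_right_mono) auto
    moreover have "e^2 * r^2 \<le> e'^2 * r^2" using that by (intro mult_right_mono power_mono) auto
    ultimately have "(norm (z - (1 + e) *\<^sub>R a))^2 \<le> (norm (z - (1 + e') *\<^sub>R a))^2"
      unfolding sq by linarith
    then show ?thesis by (rule power2_le_imp_le) auto
  qed
  have dec: "f (Suc k) z \<le> f k z" if "norm z = r" for k z
  proof (cases "z = a")
    case False
    have "z \<noteq> b (Suc k)" using nbr[of "Suc k"] that by auto
    moreover have "norm (z - b (Suc k)) \<le> norm (z - b k)"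
      unfolding b_def by (rule mono[OF that]) (auto simp: field_simps)
    ultimately have "ln (norm (z - b (Suc k))) \<le> ln (norm (z - b k))"
      by (intro ln_mono) auto
    then show ?thesis using False by (simp add: f_def)
  qed (simp add: f_def)
  have bl: "b \<longlonglongrightarrow> a"
  proof -
    have "(\<lambda>k. (1 + 1 / real (Suc k)) *\<^sub>R a) \<longlonglongrightarrow> (1 + 0) *\<^sub>R a"
      by (intro tendsto_intros LIMSEQ_Suc lim_1_over_n)
    then show ?thesis unfolding b_def by simp
  qed
  have lim: "(\<lambda>k. f k z) \<longlonglongrightarrow> ln (norm (z - a))" for z
  proof (cases "z = a")
    case False
    then have "(\<lambda>k. ln (norm (z - b k))) \<longlonglongrightarrow> ln (norm (z - a))"
      by (intro tendsto_intros bl) auto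
    then show ?thesis using False by (simp add: f_def)
  qed (simp add: f_def)
  have int: "integral {0..2*pi} (\<lambda>\<theta>. f k (of_real r * cis \<theta>)) = 2 * pi * ln (norm (b k))" for k
    using fm[of k] unfolding has_circle_mean_def by (rule integral_unique)
  have lim2: "(\<lambda>k. 2 * pi * ln (norm (b k))) \<longlonglongrightarrow> 2 * pi * ln (norm a)"
    by (intro tendsto_intros bl) (use assms in auto)
  have "(\<lambda>\<theta>. ln (norm (of_real r * cis \<theta> - a))) integrable_on {0..2*pi} \<and>
     (\<lambda>k. integral {0..2*pi} (\<lambda>\<theta>. f k (of_real r * cis \<theta>)))
       \<longlonglongrightarrow> integral {0..2*pi} (\<lambda>\<theta>. ln (norm (of_real r * cis \<theta> - a)))"
  proof (rule monotone_convergence_decreasing)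
    show "(\<lambda>\<theta>. f k (of_real r * cis \<theta>)) integrable_on {0..2*pi}" for k
      using fm[of k] unfolding has_circle_mean_def by blast
    show "f (Suc k) (of_real r * cis x) \<le> f k (of_real r * cis x)" for k x
      by (rule dec) (use assms in \<open>auto simp: norm_mult\<close>)
    show "(\<lambda>k. f k (of_real r * cis x)) \<longlonglongrightarrow> ln (norm (of_real r * cis x - a))" for x
      by (rule lim)
    show "bounded (range (\<lambda>k. integral {0..2*pi} (\<lambda>\<theta>. f k (of_real r * cis \<theta>))))"
      unfolding int by (rule convergent_imp_bounded[OF lim2])
  qed
  moreover from this have "integral {0..2*pi} (\<lambda>\<theta>. ln (norm (of_real r * cis \<theta> - a))) = 2 * pi * ln (norm a)"
    unfolding int using lim2 LIMSEQ_unique by blast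
  ultimately show ?thesis
    unfolding has_circle_mean_def using assms integrable_integral by metis
qed

lemma has_circle_mean_ln_dist:
  assumes "0 < r"
  shows "has_circle_mean (\<lambda>z. ln (norm (z - a))) r (ln (max r (norm a)))"
  using has_circle_mean_ln_dist_gt[OF assms, of a] has_circle_mean_ln_dist_lt[OF assms, of a]
    has_circle_mean_ln_dist_eq[OF assms, of a]
  by (cases "norm a" r rule: linorder_cases) (auto simp: max_def)

section \<open>Jensen's formula\<close>

text \<open>The contribution of a single zero to the integrated counting function: the integral of
  \<open>1 / t\<close> from \<open>norm a\<close> to \<open>r\<close>, with the conventional
  \<open>ln r\<close> for a zero at the origin. The latter is negative for \<open>r < 1\<close>,
  hence the many assumptions \<open>1 \<le> r\<close>.\<close>

definition zero_weight :: "real \<Rightarrow> complex \<Rightarrow> real" where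
  "zero_weight r a = (if a = 0 then ln r else ln (r / norm a))"

definition zero_count :: "(complex \<Rightarrow> complex) \<Rightarrow> real \<Rightarrow> real" where
  "zero_count F r = (\<Sum>a\<in>{a\<in>cball 0 r. F a = 0}. real (nat (zorder F a)) * zero_weight r a)"

text \<open>\<open>zor_poly F 0 0\<close> is the first nonzero Taylor coefficient of
  \<open>F\<close> at 0, so this is the constant term of Jensen's formula also when \<open>F\<close>
  vanishes at the origin.\<close>

definition log_lead :: "(complex \<Rightarrow> complex) \<Rightarrow> real" where
  "log_lead F = ln (norm (zor_poly F 0 0))"

lemma zero_weight_nonneg: "1 \<le> r \<Longrightarrow> norm a \<le> r \<Longrightarrow> 0 \<le> zero_weight r a"
  by (auto simp: zero_weight_def field_simps)

lemma zero_weight_mono: "0 < r \<Longrightarrow> r \<le> s \<Longrightarrow> zero_weight r a \<le> zero_weight s a"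
  by (auto simp: zero_weight_def divide_simps)

lemma finite_zeros_cball:
  assumes "F holomorphic_on UNIV" "F z0 \<noteq> 0"
  shows "finite {a\<in>cball 0 r. F a = 0}"
proof (cases "F constant_on UNIV")
  case True
  then have "{a\<in>cball 0 r. F a = 0} = {}" using assms(2) by (auto simp: constant_on_def)
  then show ?thesis by (metis finite.emptyI)
next
  case False
  then show ?thesis
    using holomorphic_compact_finite_zeros[OF assms(1) _ _ _ _ False, of "cball 0 r"]
    by (simp add: convex_connected)
qed

lemma countable_zeros:
  assumes "F holomorphic_on UNIV" "F z0 \<noteq> 0"
  shows "countable {a. F a = 0}"
proof -
  have "{a. F a = 0} = (\<Union>n::nat. {a\<in>cball 0 (real n). F a = 0})"
    using real_arch_simple by auto
  moreover have "countable (\<Union>n::nat. {a\<in>cball 0 (real n). F a = 0})"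
    by (rule countable_UN[OF countableI_type countable_finite[OF finite_zeros_cball[OF assms]]])
  ultimately show ?thesis by (simp only:)
qed

lemma eventually_nonzero_at:
  assumes "F holomorphic_on UNIV" "F z0 \<noteq> 0"
  shows "eventually (\<lambda>z. F z \<noteq> 0) (at w)"
  using non_zero_neighbour_alt[of F UNIV w z0] assms by auto

lemma zorder_prod_linear:
  assumes "finite Z"
  shows "zorder (\<lambda>z. \<Prod>a\<in>Z. (z - a) ^ m a) w = (if w \<in> Z then int (m w) else 0)"
proof (rule zorder_eqI[where S = "UNIV - (Z - {w})" and g = "\<lambda>z. \<Prod>a\<in>Z-{w}. (z - a) ^ m a"])
  show "open (UNIV - (Z - {w}))" using assms by (intro open_Diff finite_imp_closed) auto
  show "(\<lambda>z. \<Prod>a\<in>Z - {w}. (z - a) ^ m a) holomorphic_on UNIV - (Z - {w})"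
    by (intro holomorphic_intros)
  show "(\<Prod>a\<in>Z - {w}. (w - a) ^ m a) \<noteq> 0" using assms by (auto simp: prod_zero_iff)
  fix z
  show "(\<Prod>a\<in>Z. (z - a) ^ m a) =
      (\<Prod>a\<in>Z - {w}. (z - a) ^ m a) * (z - w) powi (if w \<in> Z then int (m w) else 0)"
  proof (cases "w \<in> Z")
    case True
    then show ?thesis using prod.remove[OF assms True, of "\<lambda>a. (z - a) ^ m a"] by simp
  qed auto
qed auto

lemma zorder_zero_pos:
  assumes "F holomorphic_on UNIV" "F z0 \<noteq> 0" "F w = 0"
  shows "0 < zorder F w"
  using zorder_exist_zero[of F UNIV w] assms by auto

lemma zorder_nonzero:
  assumes "F holomorphic_on UNIV" "F w \<noteq> 0"
  shows "zorder F w = 0"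
  using zorder_exist_zero[of F UNIV w] assms by auto

lemma zero_factorization:
  assumes "F holomorphic_on UNIV" "F z0 \<noteq> 0"
  obtains h where "h holomorphic_on ball 0 R" "\<And>z. z \<in> ball 0 R \<Longrightarrow> h z \<noteq> 0"
    "\<And>z. z \<in> ball 0 R \<Longrightarrow> F z = h z * (\<Prod>a\<in>{a\<in>ball 0 R. F a = 0}. (z - a) ^ nat (zorder F a))"
proof -
  define Z where "Z = {a\<in>ball 0 R. F a = 0}"
  have fin: "finite Z" by (rule finite_subset[OF _ finite_zeros_cball[OF assms, of R]]) (auto simp: Z_def)
  define p where "p z = (\<Prod>a\<in>Z. (z - a) ^ nat (zorder F a))" for z
  have pos: "0 < zorder F a" if "a \<in> Z" for a
    using zorder_zero_pos[OF assms] that by (auto simp: Z_def)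
  obtain h where "h holomorphic_on ball 0 R" "\<And>z. z \<in> ball 0 R \<Longrightarrow> h z \<noteq> 0"
    "\<And>z. z \<in> ball 0 R \<Longrightarrow> F z = h z * p z"
  proof (rule holomorphic_zorder_factorization[of F "ball 0 R" p])
    show "F holomorphic_on ball 0 R" using assms(1) by (rule holomorphic_on_subset) auto
    show "p holomorphic_on ball 0 R" unfolding p_def by (intro holomorphic_intros)
    show "p z = 0 \<longleftrightarrow> F z = 0" if "z \<in> ball 0 R" for z
      using fin pos that by (fastforce simp: p_def prod_zero_iff Z_def)
    show "zorder p z = zorder F z" if "z \<in> ball 0 R" for z
      unfolding p_def zorder_prod_linear[OF fin]
      using pos[of z] zorder_nonzero[OF assms(1), of z] that by (auto simp: Z_def)
  qed auto
  then show ?thesis using that unfolding p_def Z_def by blast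
qed

lemma log_lead_factorization:
  assumes "F holomorphic_on UNIV" "F z0 \<noteq> 0" "0 < R"
    and h: "h holomorphic_on ball 0 R" "\<And>z. z \<in> ball 0 R \<Longrightarrow> h z \<noteq> 0"
    "\<And>z. z \<in> ball 0 R \<Longrightarrow> F z = h z * (\<Prod>a\<in>{a\<in>ball 0 R. F a = 0}. (z - a) ^ nat (zorder F a))"
  shows "log_lead F = ln (norm (h 0)) +
     (\<Sum>a\<in>{a\<in>ball 0 R. F a = 0}-{0}. real (nat (zorder F a)) * ln (norm a))"
proof -
  define Z where "Z = {a\<in>ball 0 R. F a = 0}"
  have fin: "finite Z" by (rule finite_subset[OF _ finite_zeros_cball[OF assms(1,2), of R]]) (auto simp: Z_def)
  define k where "k z = h z * (\<Prod>a\<in>Z-{0}. (z - a) ^ nat (zorder F a))" for z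
  define m where "m = nat (zorder F 0)"
  have "\<exists>w\<in>UNIV. F w \<noteq> 0" using assms(2) by blast
  from conjunct2[OF zorder_exist_zero[OF assms(1) open_UNIV convex_connected[OF convex_UNIV] UNIV_I this, of 0]]
  obtain s where s0: "0 < s \<and> cball 0 s \<subseteq> (UNIV :: complex set) \<and> zor_poly F 0 holomorphic_on cball 0 s \<and>
      (\<forall>w\<in>cball 0 s. F w = zor_poly F 0 w * (w - 0) ^ nat (zorder F 0) \<and> zor_poly F 0 w \<noteq> 0)"
    by (elim exE) (rule that, assumption)
  have s: "s > 0" "zor_poly F 0 holomorphic_on cball 0 s"
     "\<And>w. w \<in> cball 0 s \<Longrightarrow> F w = zor_poly F 0 w * w ^ m"
    using s0 by (auto simp: m_def)
  have kF: "F w = k w * w ^ m" if "w \<in> ball 0 R" for w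
  proof (cases "0 \<in> Z")
    case True
    show ?thesis unfolding h(3)[OF that] k_def m_def Z_def[symmetric]
      using prod.remove[OF fin True, of "\<lambda>a. (w - a) ^ nat (zorder F a)"] by simp
  next
    case False
    then have "m = 0" using zorder_nonzero[OF assms(1), of 0] assms(3) by (auto simp: m_def Z_def)
    then show ?thesis using False unfolding h(3)[OF that] k_def Z_def[symmetric] by simp
  qed
  define t where "t = min s R"
  have t: "t > 0" "ball 0 t \<subseteq> cball 0 s" "ball 0 t \<subseteq> ball 0 R"
    using s(1) assms(3) by (auto simp: t_def)
  \<comment> \<open>Off the origin the factor \<open>w ^ m\<close> cancels, so the two continuous
    functions agree near 0 and therefore at 0.\<close>
  have "k 0 = zor_poly F 0 0"
  proof (rule LIM_unique)
    have "continuous_on (ball 0 t) k" unfolding k_def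
      by (intro holomorphic_on_imp_continuous_on holomorphic_intros holomorphic_on_subset[OF h(1) t(3)])
    then show "k \<midarrow>0\<rightarrow> k 0" using t(1) by (simp add: continuous_on_eq_continuous_at isContD)
    have "continuous_on (ball 0 t) (zor_poly F 0)"
      by (intro holomorphic_on_imp_continuous_on holomorphic_on_subset[OF s(2) t(2)])
    then have c: "zor_poly F 0 \<midarrow>0\<rightarrow> zor_poly F 0 0"
      using t(1) by (simp add: continuous_on_eq_continuous_at isContD)
    have "eventually (\<lambda>w. w \<in> ball 0 t - {0}) (at (0::complex))"
      using t(1) by (intro eventually_at_in_open) auto
    then have "eventually (\<lambda>w. zor_poly F 0 w = k w) (at 0)"
    proof eventually_elim
      case (elim w)
      have "w \<in> ball 0 R" "w \<in> cball 0 s" using t(2,3) elim by blast+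
      then have "k w * w ^ m = zor_poly F 0 w * w ^ m" using kF s(3) by metis
      then show ?case using elim by auto
    qed
    then show "k \<midarrow>0\<rightarrow> zor_poly F 0 0" using c by (rule Lim_transform_eventually[rotated])
  qed
  moreover have "ln (norm (k 0)) = ln (norm (h 0)) + (\<Sum>a\<in>Z-{0}. real (nat (zorder F a)) * ln (norm a))"
  proof -
    have "norm (k 0) = norm (h 0) * (\<Prod>a\<in>Z-{0}. norm a ^ nat (zorder F a))"
      unfolding k_def by (simp add: norm_mult prod_norm[symmetric] norm_power)
    moreover have "ln (\<Prod>a\<in>Z-{0}. norm a ^ nat (zorder F a)) = (\<Sum>a\<in>Z-{0}. ln (norm a ^ nat (zorder F a)))"
      using fin by (intro ln_prod) auto
    moreover have "(\<Prod>a\<in>Z-{0}. norm a ^ nat (zorder F a)) \<noteq> 0"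
      using fin by (auto simp: prod_zero_iff)
    ultimately show ?thesis using h(2)[of 0] assms(3)
      by (simp add: ln_mult ln_realpow)
  qed
  ultimately show ?thesis unfolding log_lead_def Z_def by simp
qed

theorem jensen:
  assumes "F holomorphic_on UNIV" "F z0 \<noteq> 0" "0 < r"
  shows "has_circle_mean (\<lambda>z. ln (norm (F z))) r (log_lead F + zero_count F r)"
proof -
  define R where "R = r + 1"
  obtain h where h: "h holomorphic_on ball 0 R" "\<And>z. z \<in> ball 0 R \<Longrightarrow> h z \<noteq> 0"
    "\<And>z. z \<in> ball 0 R \<Longrightarrow> F z = h z * (\<Prod>a\<in>{a\<in>ball 0 R. F a = 0}. (z - a) ^ nat (zorder F a))"
    using zero_factorization[OF assms(1,2)] by blast
  define Z where "Z = {a\<in>ball 0 R. F a = 0}"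
  have fin: "finite Z" by (rule finite_subset[OF _ finite_zeros_cball[OF assms(1,2), of R]]) (auto simp: Z_def)
  define m where "m a = real (nat (zorder F a))" for a
  have "has_circle_mean (\<lambda>z. ln (norm (h z)) + (\<Sum>a\<in>Z. m a * ln (norm (z - a)))) r
     (ln (norm (h 0)) + (\<Sum>a\<in>Z. m a * ln (max r (norm a))))"
    by (intro has_circle_mean_add has_circle_mean_sum[OF fin] has_circle_mean_cmult
        has_circle_mean_ln_dist[OF assms(3)] has_circle_mean_ln_nonvanishing[OF h(1) assms(3) _ h(2)])
       (auto simp: R_def)
  then have 1: "has_circle_mean (\<lambda>z. ln (norm (F z))) r
     (ln (norm (h 0)) + (\<Sum>a\<in>Z. m a * ln (max r (norm a))))"
  proof (rule has_circle_mean_cong_finite[OF _ fin assms(3)])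
    fix z assume z: "norm z = r" "z \<notin> Z"
    have zR: "z \<in> ball 0 R" using z by (simp add: R_def)
    have "ln (\<Prod>a\<in>Z. norm (z - a) ^ nat (zorder F a)) = (\<Sum>a\<in>Z. ln (norm (z - a) ^ nat (zorder F a)))"
      using fin z by (intro ln_prod) auto
    moreover have "(\<Prod>a\<in>Z. norm (z - a) ^ nat (zorder F a)) \<noteq> 0"
      using fin z by (auto simp: prod_zero_iff)
    ultimately show "ln (norm (F z)) = ln (norm (h z)) + (\<Sum>a\<in>Z. m a * ln (norm (z - a)))"
      using h(2)[OF zR] unfolding h(3)[OF zR] Z_def[symmetric]
      by (simp add: norm_mult prod_norm[symmetric] norm_power ln_mult ln_realpow m_def)
  qed
  define Y where "Y = {a\<in>cball 0 r. F a = 0}"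
  have YZ: "Y \<subseteq> Z" by (auto simp: Y_def Z_def R_def)
  \<comment> \<open>A zero \<open>a \<noteq> 0\<close> in the closed disc contributes
    \<open>ln r\<close>, split into \<open>ln (norm a)\<close> plus its weight; a zero beyond
    contributes only \<open>ln (norm a)\<close>. The first parts add up to
    \<open>log_lead F\<close>, the weights to \<open>zero_count F r\<close>.\<close>
  have wt: "m a * ln (max r (norm a)) = (if a = 0 then 0 else m a * ln (norm a)) +
       (if a \<in> Y then m a * zero_weight r a else 0)" if "a \<in> Z" for a
    using that assms(3) by (auto simp: zero_weight_def Y_def Z_def max_def ln_div algebra_simps)
  have "(\<Sum>a\<in>Z. m a * ln (max r (norm a))) =
     (\<Sum>a\<in>Z. if a = 0 then 0 else m a * ln (norm a)) + (\<Sum>a\<in>Z. if a \<in> Y then m a * zero_weight r a else 0)"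
    unfolding sum.distrib[symmetric] using wt by (intro sum.cong) auto
  also have "(\<Sum>a\<in>Z. if a = 0 then 0 else m a * ln (norm a)) = (\<Sum>a\<in>Z-{0}. m a * ln (norm a))"
    using fin by (intro sum.mono_neutral_cong_right) auto
  also have "(\<Sum>a\<in>Z. if a \<in> Y then m a * zero_weight r a else 0) = (\<Sum>a\<in>Y. m a * zero_weight r a)"
    using fin YZ by (intro sum.mono_neutral_cong_right) auto
  finally have 2: "(\<Sum>a\<in>Z. m a * ln (max r (norm a))) = (\<Sum>a\<in>Z-{0}. m a * ln (norm a)) + zero_count F r"
    unfolding zero_count_def Y_def m_def .
  have "log_lead F = ln (norm (h 0)) + (\<Sum>a\<in>Z-{0}. m a * ln (norm a))"
    unfolding Z_def m_def by (rule log_lead_factorization[OF assms(1,2) _ h]) (use assms in \<open>auto simp: R_def\<close>)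
  with 1 2 show ?thesis by (simp add: algebra_simps)
qed

lemma zero_count_nonneg:
  assumes "1 \<le> r"
  shows "0 \<le> zero_count F r"
  unfolding zero_count_def
  by (intro sum_nonneg mult_nonneg_nonneg zero_weight_nonneg) (use assms in auto)

lemma zero_count_mono:
  assumes "F holomorphic_on UNIV" "F z0 \<noteq> 0" "1 \<le> r" "r \<le> s"
  shows "zero_count F r \<le> zero_count F s"
proof -
  have "zero_count F r \<le> (\<Sum>a\<in>{a\<in>cball 0 r. F a = 0}. real (nat (zorder F a)) * zero_weight s a)"
    unfolding zero_count_def using assms
    by (intro sum_mono mult_left_mono zero_weight_mono) auto
  also have "\<dots> \<le> zero_count F s"
    unfolding zero_count_def
    by (rule sum_mono2[OF finite_zeros_cball[OF assms(1,2)]])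
       (use assms in \<open>auto intro!: mult_nonneg_nonneg zero_weight_nonneg\<close>)
  finally show ?thesis .
qed

text \<open>Sum and integral are interchanged: a point \<open>a \<noteq> 0\<close> enters the
  counting function at \<open>t = norm a\<close> and yields the integral of \<open>1 / t\<close>
  from there on. Subtracting \<open>\<nu> 0\<close> removes the origin from the integrand, and the
  term \<open>\<nu> 0 * ln r\<close> brings it back.\<close>

lemma integrated_counting_eq:
  fixes m :: "complex \<Rightarrow> nat"
  assumes "finite (A \<inter> cball 0 r)" "0 < r"
  shows "integrated_counting (\<lambda>t. \<Sum>z\<in>A \<inter> cball 0 t. m z) r = (\<Sum>a\<in>A \<inter> cball 0 r. real (m a) * zero_weight r a)"
proof -
  define B where "B = A \<inter> cball 0 r - {0}"
  have finB: "finite B" using assms by (simp add: B_def)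
  define \<nu> where "\<nu> t = (\<Sum>z\<in>A \<inter> cball 0 t. m z)" for t
  have \<nu>0: "real (\<nu> 0) = (if 0 \<in> A then real (m 0) else 0)"
  proof -
    have "A \<inter> cball 0 0 = (if 0 \<in> A then {0} else {})" by auto
    then show ?thesis by (simp add: \<nu>_def)
  qed
  have diff: "real (\<nu> t) - real (\<nu> 0) = (\<Sum>a\<in>B. if norm a \<le> t then real (m a) else 0)" if "t \<in> {0..r}" for t
  proof -
    have fin: "finite (A \<inter> cball 0 t)" by (rule finite_subset[OF _ assms(1)]) (use that in auto)
    have eq: "A \<inter> cball 0 t - {0} = {a\<in>B. norm a \<le> t}" using that by (auto simp: B_def)
    have "real (\<nu> t) = real (\<nu> 0) + (\<Sum>a\<in>A \<inter> cball 0 t - {0}. real (m a))"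
    proof (cases "0 \<in> A")
      case True
      then have "0 \<in> A \<inter> cball 0 t" using that by auto
      from sum.remove[OF fin this, of m] show ?thesis using True \<nu>0 unfolding \<nu>_def by simp
    next
      case False
      then show ?thesis using \<nu>0 unfolding \<nu>_def by simp
    qed
    also have "(\<Sum>a\<in>A \<inter> cball 0 t - {0}. real (m a)) = (\<Sum>a\<in>B. if norm a \<le> t then real (m a) else 0)"
      unfolding eq using finB by (simp add: sum.inter_filter)
    finally show ?thesis by simp
  qed
  have one: "((\<lambda>t. (if norm a \<le> t then real (m a) else 0) / t) has_integral real (m a) * ln (r / norm a)) {0..r}"
    if "a \<in> B" for a
  proof -
    have a: "0 < norm a" "norm a \<le> r" using that by (auto simp: B_def)
    have "((\<lambda>t. real (m a) * (1 / t)) has_integral real (m a) * (ln r - ln (norm a))) {norm a..r}"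
      by (intro has_integral_mult_right fundamental_theorem_of_calculus[OF a(2)])
         (use a(1) less_le_trans[OF a(1)] in
           \<open>auto intro!: derivative_eq_intros simp: has_real_derivative_iff_has_vector_derivative[symmetric]\<close>)
    then have "((\<lambda>t. if t \<in> {norm a..r} then real (m a) * (1 / t) else 0) has_integral real (m a) * (ln r - ln (norm a))) {0..r}"
      by (subst has_integral_restrict) auto
    then have "((\<lambda>t. (if norm a \<le> t then real (m a) else 0) / t) has_integral real (m a) * (ln r - ln (norm a))) {0..r}"
      by (rule has_integral_eq[rotated]) auto
    then show ?thesis using a assms by (simp add: ln_div)
  qed
  have "((\<lambda>t. \<Sum>a\<in>B. (if norm a \<le> t then real (m a) else 0) / t) has_integral (\<Sum>a\<in>B. real (m a) * ln (r / norm a))) {0..r}"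
    by (intro has_integral_sum finB one)
  then have "((\<lambda>t. (real (\<nu> t) - real (\<nu> 0)) / t) has_integral (\<Sum>a\<in>B. real (m a) * ln (r / norm a))) {0..r}"
    by (rule has_integral_eq[rotated]) (simp add: diff sum_divide_distrib)
  then have I: "integral {0..r} (\<lambda>t. (real (\<nu> t) - real (\<nu> 0)) / t) = (\<Sum>a\<in>B. real (m a) * zero_weight r a)"
    by (subst integral_unique) (auto simp: zero_weight_def B_def intro!: sum.cong)
  have "(\<Sum>a\<in>A \<inter> cball 0 r. real (m a) * zero_weight r a) = real (\<nu> 0) * ln r + (\<Sum>a\<in>B. real (m a) * zero_weight r a)"
  proof (cases "0 \<in> A")
    case True
    then have "0 \<in> A \<inter> cball 0 r" using assms by auto
    from sum.remove[OF assms(1) this, of "\<lambda>a. real (m a) * zero_weight r a"] True \<nu>0 show ?thesis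
      unfolding B_def by (simp add: zero_weight_def)
  next
    case False
    then show ?thesis using \<nu>0 unfolding B_def by simp
  qed
  then show ?thesis unfolding integrated_counting_def \<nu>_def[symmetric] I by simp
qed

section \<open>Harmonic majorants and Harnack's inequality\<close>

text \<open>On a circle about 0 the real parts of polynomials form an algebra, because \<open>cnj z = r\<^sup>2 / z\<close> there.\<close>

lemma Re_poly_mult_on_circle:
  fixes p q :: "complex poly"
  shows "\<exists>s. \<forall>z. norm z = r \<longrightarrow> Re (poly p z) * Re (poly q z) = Re (poly s z)"
proof -
  have mono: "\<exists>s. \<forall>z. norm z = r \<longrightarrow> Re (a * z ^ i) * Re (b * z ^ j) = Re (poly s z)"
    if "i \<le> j" for a b :: complex and i j
  proof -
    \<comment> \<open>From \<open>2 * Re u * Re v = Re (u * v + cnj u * v)\<close>: for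
      \<open>i \<le> j\<close> the conjugate power cancels against part of \<open>z ^ j\<close>,
      leaving \<open>r ^ (2 * i) * z ^ (j - i)\<close>, which is again a monomial in
      \<open>z\<close>.\<close>
    define s where "s = monom (a * b / 2) (i + j) + monom (cnj a * b / 2 * of_real (r ^ (2 * i))) (j - i)"
    have "Re (a * z ^ i) * Re (b * z ^ j) = Re (poly s z)" if z: "norm z = r" for z
    proof -
      have Re2: "Re u * Re v = Re ((u * v + cnj u * v) / 2)" for u v :: complex
        by (simp add: algebra_simps)
      have "cnj (z ^ i) * z ^ j = of_real (r ^ (2 * i)) * z ^ (j - i)"
      proof -
        have "z ^ j = z ^ i * z ^ (j - i)" using \<open>i \<le> j\<close> by (simp flip: power_add)
        moreover have "cnj (z ^ i) * z ^ i = of_real (r ^ (2 * i))"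
          using complex_norm_square[of "z ^ i"] z
          by (simp add: norm_power power_mult[symmetric] mult.commute)
        ultimately show ?thesis by (metis mult.assoc)
      qed
      then have "cnj (a * z ^ i) * (b * z ^ j) = cnj a * b * of_real (r ^ (2 * i)) * z ^ (j - i)"
        by (metis (no_types, opaque_lifting) complex_cnj_mult mult.assoc mult.left_commute)
      moreover have "(a * z ^ i) * (b * z ^ j) = a * b * z ^ (i + j)"
        by (simp add: power_add)
      ultimately have "((a * z ^ i) * (b * z ^ j) + cnj (a * z ^ i) * (b * z ^ j)) / 2 = poly s z"
        unfolding s_def by (simp only: poly_add poly_monom) (simp add: add_divide_distrib)
      then show ?thesis unfolding Re2[of "a * z ^ i"] by (simp only:)
    qed
    then show ?thesis by blast
  qed
  have mono': "\<exists>s. \<forall>z. norm z = r \<longrightarrow> Re (a * z ^ i) * Re (b * z ^ j) = Re (poly s z)"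
    for a b :: complex and i j
    using mono[of i j a b] mono[of j i b a] by (cases "i \<le> j") (auto simp: mult.commute)
  have sum: "\<exists>s. \<forall>z. norm z = r \<longrightarrow> (\<Sum>i\<in>I. f i z) = Re (poly s z)"
    if "finite I" "\<And>i. i \<in> I \<Longrightarrow> \<exists>s. \<forall>z. norm z = r \<longrightarrow> f i z = Re (poly s z)"
    for I :: "nat set" and f :: "nat \<Rightarrow> complex \<Rightarrow> real"
    using that
  proof (induction I rule: finite_induct)
    case empty
    show ?case by (rule exI[of _ 0]) simp
  next
    case (insert x I)
    then obtain s t where "\<forall>z. norm z = r \<longrightarrow> (\<Sum>i\<in>I. f i z) = Re (poly s z)"
      "\<forall>z. norm z = r \<longrightarrow> f x z = Re (poly t z)" by (metis insertCI)
    then show ?case using insert.hyps by (intro exI[of _ "t + s"]) simp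
  qed
  have "Re (poly p z) * Re (poly q z) =
      (\<Sum>i\<le>degree p. \<Sum>j\<le>degree q. Re (coeff p i * z ^ i) * Re (coeff q j * z ^ j))" for z
    unfolding poly_altdef[of p] poly_altdef[of q] Re_sum sum_product ..
  then show ?thesis by (simp only:) (intro sum mono' finite_atMost)
qed

text \<open>Takes the place of solving the Dirichlet problem. Approximating
  \<open>f + \<epsilon> / 2\<close> with error below \<open>\<epsilon> / 2\<close> makes the
  approximation one-sided, as a majorant requires; points are separated by the real parts of
  \<open>z\<close> and \<open>- \<i> * z\<close>.\<close>

lemma circle_majorant:
  assumes "continuous_on (sphere 0 r) (f :: complex \<Rightarrow> real)" "0 < \<epsilon>"
  obtains p :: "complex poly" where
    "\<And>z. norm z = r \<Longrightarrow> f z < Re (poly p z)" "\<And>z. norm z = r \<Longrightarrow> Re (poly p z) < f z + \<epsilon>"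
proof -
  define R where "R = {g. \<exists>p :: complex poly. \<forall>z. norm z = r \<longrightarrow> g z = Re (poly p z)}"
  interpret function_ring_on R "sphere (0::complex) r"
  proof
    show "compact (sphere (0::complex) r)" by simp
    show "continuous_on (sphere 0 r) g" if g: "g \<in> R" for g
    proof -
      obtain p :: "complex poly" where p: "\<forall>z. norm z = r \<longrightarrow> g z = Re (poly p z)"
        using g by (auto simp: R_def)
      have "continuous_on (sphere 0 r) (\<lambda>z. Re (poly p z))" by (intro continuous_intros)
      then show ?thesis by (rule continuous_on_eq) (use p in auto)
    qed
    show "(\<lambda>x. g x + h x) \<in> R" if gh: "g \<in> R" "h \<in> R" for g h
    proof -
      obtain p q :: "complex poly" where "\<forall>z. norm z = r \<longrightarrow> g z = Re (poly p z)"
        "\<forall>z. norm z = r \<longrightarrow> h z = Re (poly q z)" using gh by (auto simp: R_def)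
      then show ?thesis unfolding R_def by (auto intro!: exI[of _ "p + q"])
    qed
    show "(\<lambda>x. g x * h x) \<in> R" if gh: "g \<in> R" "h \<in> R" for g h
    proof -
      obtain p q :: "complex poly" where "\<forall>z. norm z = r \<longrightarrow> g z = Re (poly p z)"
        "\<forall>z. norm z = r \<longrightarrow> h z = Re (poly q z)" using gh by (auto simp: R_def)
      then show ?thesis using Re_poly_mult_on_circle[of r p q] unfolding R_def by auto
    qed
    show "(\<lambda>_. c) \<in> R" for c unfolding R_def by (auto intro!: exI[of _ "[:of_real c:]"])
    show "\<exists>f\<in>R. f x \<noteq> f y" if "x \<noteq> y" for x y
    proof (cases "Re x = Re y")
      case True
      then have "Im x \<noteq> Im y" using that complex_eqI by blast
      moreover have "(\<lambda>z. Re (poly [:0, -\<i>:] z)) \<in> R" unfolding R_def by blast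
      ultimately show ?thesis by (intro bexI[rotated]) auto
    next
      case False
      moreover have "(\<lambda>z. Re (poly [:0, 1:] z)) \<in> R" unfolding R_def by blast
      ultimately show ?thesis by (intro bexI[rotated]) auto
    qed
  qed
  have "continuous_on (sphere 0 r) (\<lambda>z. f z + \<epsilon> / 2)" by (intro continuous_intros assms)
  from Stone_Weierstrass_basic[OF this, of "\<epsilon> / 2"] assms(2)
  obtain g where g: "g \<in> R" "\<And>z. norm z = r \<Longrightarrow> \<bar>f z + \<epsilon> / 2 - g z\<bar> < \<epsilon> / 2" by auto
  then obtain p :: "complex poly" where p: "\<forall>z. norm z = r \<longrightarrow> g z = Re (poly p z)"
    by (auto simp: R_def)
  have "f z < Re (poly p z) \<and> Re (poly p z) < f z + \<epsilon>" if "norm z = r" for z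
  proof -
    have "g z = Re (poly p z)" using p that by blast
    then show ?thesis using g(2)[OF that] by linarith
  qed
  then show ?thesis using that by blast
qed

lemma holomorphic_shift:
  fixes f :: "complex \<Rightarrow> complex"
  assumes "f holomorphic_on UNIV"
  shows "(\<lambda>z. f (z + w)) holomorphic_on A"
  by (rule holomorphic_on_compose_gen[OF _ assms, unfolded o_def]) (auto intro!: holomorphic_intros)

lemma has_circle_mean_Re_entire:
  assumes "f holomorphic_on UNIV" "0 < r"
  shows "has_circle_mean (\<lambda>z. Re (f (z + w))) r (Re (f w))"
  using has_circle_mean_Re[OF holomorphic_shift[OF assms(1), of w], of r "r + 1"] assms(2)
  by simp

text \<open>The maximum modulus principle for \<open>F * exp (- P)\<close>. It replaces the theory
  of subharmonic functions throughout.\<close>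

lemma max_principle_exp:
  assumes "F holomorphic_on UNIV" "P holomorphic_on UNIV" "0 < R"
    and "\<And>z. norm z = R \<Longrightarrow> norm (F z) \<le> exp (Re (P z))" "norm z \<le> R"
  shows "norm (F z) \<le> exp (Re (P z))"
proof -
  have "norm (F z * exp (- P z)) \<le> 1"
  proof (rule maximum_modulus_frontier[where f = "\<lambda>z. F z * exp (- P z)" and S = "cball 0 R"])
    have hol: "(\<lambda>z. F z * exp (- P z)) holomorphic_on UNIV"
      by (intro holomorphic_intros assms(1,2))
    show "(\<lambda>z. F z * exp (- P z)) holomorphic_on interior (cball 0 R)"
      by (rule holomorphic_on_subset[OF hol]) auto
    show "continuous_on (closure (cball 0 R)) (\<lambda>z. F z * exp (- P z))"
      by (rule holomorphic_on_imp_continuous_on[OF holomorphic_on_subset[OF hol]]) auto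
    show "norm (F z * exp (- P z)) \<le> 1" if "z \<in> frontier (cball 0 R)" for z
      using assms(3) assms(4)[of z] that by (auto simp: norm_mult norm_divide exp_minus field_simps)
  qed (use assms in auto)
  then show ?thesis by (simp add: norm_mult norm_divide exp_minus field_simps)
qed

lemma harnack:
  assumes "f holomorphic_on ball z0 s" "\<And>z. z \<in> ball z0 s \<Longrightarrow> 0 < Re (f z)" "norm w < s"
  shows "(s - norm w) / (s + norm w) * Re (f z0) \<le> Re (f (z0 + w))"
    and "Re (f (z0 + w)) \<le> (s + norm w) / (s - norm w) * Re (f z0)"
proof -
  have s: "s > 0" using assms(3) norm_ge_zero[of w] by linarith
  define a where "a = f z0"
  have a: "Re a > 0" unfolding a_def using assms(2)[of z0] s by simp
  \<comment> \<open>The Cayley transform carries the right half-plane to the unit disc and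
    \<open>f z0\<close> to 0, so the Schwarz lemma applies after rescaling the disc.\<close>
  define \<phi> where "\<phi> \<zeta> = (f (z0 + s * \<zeta>) - a) / (f (z0 + s * \<zeta>) + cnj a)" for \<zeta> :: complex
  have inb: "z0 + s * \<zeta> \<in> ball z0 s" if "norm \<zeta> < 1" for \<zeta> :: complex
    using that s by (simp add: dist_norm norm_mult)
  have pos: "0 < Re (f (z0 + s * \<zeta>))" if "norm \<zeta> < 1" for \<zeta> :: complex
    using assms(2)[OF inb[OF that]] .
  have nz: "f (z0 + s * \<zeta>) + cnj a \<noteq> 0" if "norm \<zeta> < 1" for \<zeta> :: complex
  proof -
    have "0 < Re (f (z0 + s * \<zeta>) + cnj a)" using pos[OF that] a by simp
    then show ?thesis by (metis less_irrefl zero_complex.sel(1))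
  qed
  have lt: "norm (u - a) < norm (u + cnj a)" if "0 < Re u" for u
  proof -
    have "(Re u - Re a)^2 < (Re u + Re a)^2"
      using mult_pos_pos[OF that a] by (simp add: power2_eq_square algebra_simps)
    then have "(norm (u - a))^2 < (norm (u + cnj a))^2"
      unfolding cmod_power2 by simp
    then show ?thesis by (rule power2_less_imp_less) simp
  qed
  have holf: "(\<lambda>\<zeta>::complex. f (z0 + s * \<zeta>)) holomorphic_on ball 0 1"
    by (rule holomorphic_on_compose_gen[OF _ assms(1), unfolded o_def])
       (use inb in \<open>auto intro!: holomorphic_intros\<close>)
  have sch: "norm (\<phi> \<zeta>) \<le> norm \<zeta>" if "norm \<zeta> < 1" for \<zeta>
  proof (rule Schwarz_Lemma(1)[OF _ _ _ that])
    show "\<phi> holomorphic_on ball 0 1"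
      unfolding \<phi>_def by (intro holomorphic_intros holf) (use nz in auto)
    show "\<phi> 0 = 0" by (simp add: \<phi>_def a_def)
    show "norm (\<phi> z) < 1" if "norm z < 1" for z
      using lt[OF pos[OF that]] nz[OF that] unfolding \<phi>_def by (simp add: norm_divide)
  qed
  define t where "t = norm w / s"
  have t: "0 \<le> t" "t < 1" using assms(3) s by (auto simp: t_def)
  define u where "u = f (z0 + w)"
  have u: "0 < Re u" unfolding u_def using assms(2)[of "z0 + w"] assms(3) by (simp add: dist_norm)
  have "norm (\<phi> (w / s)) \<le> t"
    using sch[of "w / s"] assms(3) s by (simp add: t_def norm_divide)
  moreover have "\<phi> (w / s) = (u - a) / (u + cnj a)" using s by (simp add: \<phi>_def u_def)
  moreover have "u + cnj a \<noteq> 0" using lt[OF u] by auto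
  ultimately have "norm (u - a) \<le> t * norm (u + cnj a)"
    by (simp add: norm_divide pos_divide_le_eq)
  then have "(norm (u - a))^2 \<le> t^2 * (norm (u + cnj a))^2"
    using power_mono[of "norm (u - a)" "t * norm (u + cnj a)" 2] by (simp add: power_mult_distrib)
  then have "(Re u - Re a)^2 + (Im u - Im a)^2 \<le> t^2 * ((Re u + Re a)^2 + (Im u - Im a)^2)"
    unfolding cmod_power2 by simp
  \<comment> \<open>Because \<open>t < 1\<close>, the imaginary parts on the right are dominated by
    those on the left and may be dropped.\<close>
  moreover have "t^2 * (Im u - Im a)^2 \<le> (Im u - Im a)^2"
    using t by (intro mult_left_le_one_le) (auto simp: power_le_one)
  ultimately have "(Re u - Re a)^2 \<le> t^2 * (Re u + Re a)^2"
    unfolding distrib_left[of "t^2"] by linarith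
  then have "(Re u - Re a)^2 \<le> (t * (Re u + Re a))^2" by (simp only: power_mult_distrib)
  then have "\<bar>Re u - Re a\<bar> \<le> t * (Re u + Re a)"
    using abs_le_square_iff[of "Re u - Re a" "t * (Re u + Re a)"] t u a by simp
  then have "(1 - t) * Re a \<le> (1 + t) * Re u" "(1 - t) * Re u \<le> (1 + t) * Re a"
    by (auto simp: abs_le_iff algebra_simps)
  then have 1: "((1 - t) * Re a) / (1 + t) \<le> Re u" "Re u \<le> ((1 + t) * Re a) / (1 - t)"
    using t by (auto simp: pos_divide_le_eq pos_le_divide_eq mult.commute)
  have eqs: "s - norm w = s * (1 - t)" "s + norm w = s * (1 + t)"
    using s by (auto simp: t_def field_simps)
  show "(s - norm w) / (s + norm w) * Re (f z0) \<le> Re (f (z0 + w))"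
    using 1(1) s unfolding eqs u_def[symmetric] a_def[symmetric] by simp
  show "Re (f (z0 + w)) \<le> (s + norm w) / (s - norm w) * Re (f z0)"
    using 1(2) s unfolding eqs u_def[symmetric] a_def[symmetric] by simp
qed

text \<open>For zero-free \<open>f\<close> of modulus below 1, \<open>- ln (norm (f z))\<close> is
  the positive real part of a holomorphic function. Harnack's lower bound for it turns into an upper
  bound for \<open>ln (norm f)\<close>.\<close>

lemma harnack_nonvanishing:
  assumes "f holomorphic_on ball z0 s" "\<And>z. z \<in> ball z0 s \<Longrightarrow> f z \<noteq> 0"
    "\<And>z. z \<in> ball z0 s \<Longrightarrow> norm (f z) < 1" "norm w < s"
  shows "ln (norm (f (z0 + w))) \<le> (s - norm w) / (s + norm w) * ln (norm (f z0))"
proof -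
  have s: "s > 0" using assms(4) norm_ge_zero[of w] by linarith
  obtain h where h: "h holomorphic_on ball z0 s" "\<And>x. x \<in> ball z0 s \<Longrightarrow> exp (h x) = f x"
    by (rule holomorphic_logarithm_exists[of "ball z0 s" f z0]) (use assms s in auto)
  have eq: "ln (norm (f z)) = - Re (- h z)" if "z \<in> ball z0 s" for z
    using h(2)[OF that] by (metis ln_exp norm_exp_eq_Re minus_complex.sel(1) minus_minus uminus_complex.sel(1))
  have "(s - norm w) / (s + norm w) * Re (- h z0) \<le> Re (- h (z0 + w))"
  proof (rule harnack(1))
    show "(\<lambda>z. - h z) holomorphic_on ball z0 s" by (intro holomorphic_intros h)
    show "0 < Re (- h z)" if "z \<in> ball z0 s" for z
    proof -
      have "norm (exp (h z)) < 1" using assms(3)[OF that] h(2)[OF that] by simp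
      then show ?thesis by simp
    qed
  qed fact
  moreover have "z0 + w \<in> ball z0 s" "z0 \<in> ball z0 s" using assms(4) s by (auto simp: dist_norm)
  ultimately show ?thesis using eq by simp
qed

section \<open>Logarithms of shifts in the mean\<close>

lemma continuous_on_ln_norm_entire:
  assumes "f holomorphic_on UNIV" "\<And>z. z \<in> S \<Longrightarrow> f z \<noteq> 0"
  shows "continuous_on S (\<lambda>z. ln (norm (f z)))"
  using assms holomorphic_on_imp_continuous_on[OF holomorphic_on_subset[OF assms(1), of S]]
  by (auto intro!: continuous_intros)

lemma continuous_on_Max_norm:
  assumes "finite J" "J \<noteq> {}" "\<And>j. j \<in> J \<Longrightarrow> continuous_on S (f j)"
  shows "continuous_on S (\<lambda>z. Max ((\<lambda>j. norm (f j z :: complex)) ` J))"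
  using assms
proof (induction J rule: finite_ne_induct)
  case (singleton x)
  then show ?case by (auto intro!: continuous_intros)
next
  case (insert x F)
  then have "continuous_on S (\<lambda>z. max (norm (f x z)) (Max ((\<lambda>j. norm (f j z)) ` F)))"
    by (auto intro!: continuous_intros)
  then show ?case using insert.hyps by simp
qed

text \<open>The first two claims are read off the identity \<open>eq\<close>, whose right-hand side
  is nonnegative in the disc and zero on its boundary: the Blaschke factor of \<open>a\<close> has
  modulus at most 1 inside and exactly 1 on the circle.\<close>

lemma norm_blaschke_factor_le:
  assumes "norm a < R" "norm z \<le> R"
  shows "R * norm (z - a) \<le> norm (of_real (R^2) - cnj a * z)"
    and "norm z = R \<Longrightarrow> R * norm (z - a) = norm (of_real (R^2) - cnj a * z)"
    and "of_real (R^2) - cnj a * z \<noteq> 0"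
proof -
  have R: "R > 0" using assms(1) norm_ge_zero[of a] by linarith
  have eq: "(norm (of_real (R^2) - cnj a * z))^2 - (R * norm (z - a))^2 = (R^2 - (norm a)^2) * (R^2 - (norm z)^2)"
    unfolding power_mult_distrib cmod_power2 by (simp add: power2_eq_square algebra_simps)
  have "0 \<le> (R^2 - (norm a)^2) * (R^2 - (norm z)^2)"
    using assms R by (intro mult_nonneg_nonneg) (auto intro!: power_mono)
  then have "(R * norm (z - a))^2 \<le> (norm (of_real (R^2) - cnj a * z))^2" using eq by linarith
  then show "R * norm (z - a) \<le> norm (of_real (R^2) - cnj a * z)" by (rule power2_le_imp_le) simp
  show "R * norm (z - a) = norm (of_real (R^2) - cnj a * z)" if "norm z = R"
  proof -
    have "(norm (of_real (R^2) - cnj a * z))^2 = (R * norm (z - a))^2" using eq that by simp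
    then show ?thesis using R by (simp add: power2_eq_iff_nonneg)
  qed
  show "of_real (R^2) - cnj a * z \<noteq> 0"
  proof
    assume "of_real (R^2) - cnj a * z = 0"
    then have "cnj a * z = of_real (R^2)" by simp
    then have "norm (cnj a * z) = norm (complex_of_real (R^2))" by simp
    then have "norm a * norm z = R^2" by (simp add: norm_mult norm_power)
    moreover have "norm a * norm z < R^2"
    proof -
      have "norm a * norm z \<le> norm a * R" using assms by (intro mult_left_mono) auto
      also have "\<dots> < R * R" using assms R by simp
      finally show ?thesis by (simp add: power2_eq_square)
    qed
    ultimately show False by simp
  qed
qed

text \<open>\<open>G\<close> is \<open>F\<close> divided by the Blaschke product of its zeros in the
  open disc. The modulus on the boundary circle is unchanged, so the bound on \<open>F\<close>
  passes to \<open>G\<close> by the maximum principle. The constant \<open>exp (-1)\<close> secures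
  the strict \<open>norm (G z) < 1\<close> that Harnack's inequality needs.\<close>

lemma blaschke_division:
  assumes F: "F holomorphic_on UNIV" "F z0 \<noteq> 0" and R: "0 < R"
    and bd: "\<And>z. norm z \<le> R \<Longrightarrow> norm (F z) \<le> exp (-1)"
  obtains G where "G holomorphic_on ball 0 R" "\<And>z. norm z < R \<Longrightarrow> G z \<noteq> 0"
    "\<And>z. norm z < R \<Longrightarrow> norm (G z) < 1" "\<And>z. norm z < R \<Longrightarrow> norm (F z) \<le> norm (G z)"
    "ln (norm (G 0)) = log_lead F + zero_count F R"
proof -
  define S where "S = R + 1"
  obtain h where h: "h holomorphic_on ball 0 S" "\<And>z. z \<in> ball 0 S \<Longrightarrow> h z \<noteq> 0"
    "\<And>z. z \<in> ball 0 S \<Longrightarrow> F z = h z * (\<Prod>a\<in>{a\<in>ball 0 S. F a = 0}. (z - a) ^ nat (zorder F a))"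
    using zero_factorization[OF F] by blast
  define Z where "Z = {a\<in>ball 0 S. F a = 0}"
  define Y where "Y = {a\<in>ball 0 R. F a = 0}"
  have fin: "finite Z" by (rule finite_subset[OF _ finite_zeros_cball[OF F, of S]]) (auto simp: Z_def)
  have YZ: "Y \<subseteq> Z" by (auto simp: Y_def Z_def S_def)
  have finY: "finite Y" by (rule finite_subset[OF YZ fin])
  define m where "m a = nat (zorder F a)" for a
  \<comment> \<open>The zeros in \<open>Z - Y\<close>, on the circle or slightly beyond it, are
    kept; each factor of a zero in \<open>Y\<close> is exchanged for the denominator of its Blaschke
    factor.\<close>
  define G where "G z = h z * (\<Prod>a\<in>Z-Y. (z - a) ^ m a) * (\<Prod>a\<in>Y. ((of_real (R^2) - cnj a * z) / R) ^ m a)" for z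
  have Fz: "F z = h z * (\<Prod>a\<in>Z-Y. (z - a) ^ m a) * (\<Prod>a\<in>Y. (z - a) ^ m a)" if "norm z \<le> R" for z
    using h(3)[of z] that prod.subset_diff[OF YZ fin, of "\<lambda>a. (z - a) ^ m a"]
    unfolding Z_def[symmetric] m_def[symmetric] by (simp add: S_def mult.assoc)
  have holh: "h holomorphic_on cball 0 R" by (rule holomorphic_on_subset[OF h(1)]) (auto simp: S_def)
  have holG: "G holomorphic_on cball 0 R"
    unfolding G_def using R by (intro holomorphic_intros holh) auto
  have fac: "norm (z - a) \<le> norm ((of_real (R^2) - cnj a * z) / R)" if "a \<in> Y" "norm z \<le> R" for a z
    using norm_blaschke_factor_le(1)[of a R z] that R by (simp add: Y_def norm_divide field_simps)
  have fac_eq: "norm (z - a) = norm ((of_real (R^2) - cnj a * z) / R)" if "a \<in> Y" "norm z = R" for a z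
    using norm_blaschke_factor_le(2)[of a R z] that R by (simp add: Y_def norm_divide field_simps)
  have FG: "norm (F z) \<le> norm (G z)" if "norm z \<le> R" for z
  proof -
    have "(\<Prod>a\<in>Y. norm (z - a) ^ m a) \<le> (\<Prod>a\<in>Y. norm ((of_real (R^2) - cnj a * z) / R) ^ m a)"
    proof (rule prod_mono)
      fix a assume "a \<in> Y"
      show "0 \<le> norm (z - a) ^ m a \<and> norm (z - a) ^ m a \<le> norm ((of_real (R^2) - cnj a * z) / R) ^ m a"
        using power_mono[OF fac[OF \<open>a \<in> Y\<close> that] norm_ge_zero] by simp
    qed
    then show ?thesis
      unfolding Fz[OF that] G_def norm_mult prod_norm[symmetric] norm_power
      by (rule mult_left_mono) (simp add: prod_nonneg)
  qed
  have FG_eq: "norm (F z) = norm (G z)" if "norm z = R" for z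
    unfolding Fz[OF eq_refl[OF that]] G_def norm_mult prod_norm[symmetric] norm_power
    using fac_eq[OF _ that] by (intro arg_cong2[where f = "(*)"] refl prod.cong) auto
  have Gle: "norm (G z) \<le> exp (-1)" if "norm z \<le> R" for z
  proof (rule maximum_modulus_frontier[where f = G and S = "cball 0 R"])
    show "G holomorphic_on interior (cball 0 R)" by (rule holomorphic_on_subset[OF holG]) auto
    show "continuous_on (closure (cball 0 R)) G" using holomorphic_on_imp_continuous_on[OF holG] by simp
    show "norm (G w) \<le> exp (-1)" if "w \<in> frontier (cball 0 R)" for w
      using FG_eq[of w] bd[of w] that R by simp
  qed (use that in auto)
  have nz: "G z \<noteq> 0" if "norm z < R" for z
  proof -
    have "(\<Prod>a\<in>Z-Y. (z - a) ^ m a) \<noteq> 0" using that fin by (auto simp: prod_zero_iff Y_def Z_def)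
    moreover have "(\<Prod>a\<in>Y. ((of_real (R^2) - cnj a * z) / R) ^ m a) \<noteq> 0"
    proof -
      have "of_real (R^2) - cnj a * z \<noteq> 0" if "a \<in> Y" for a
        using norm_blaschke_factor_le(3)[of a R z] that \<open>norm z < R\<close> by (auto simp: Y_def)
      then show ?thesis using finY R by (auto simp: prod_zero_iff)
    qed
    ultimately show ?thesis using h(2)[of z] that unfolding G_def by (simp add: S_def)
  qed
  have ln0: "ln (norm (G 0)) = log_lead F + zero_count F R"
  proof -
    define Y' where "Y' = {a\<in>cball 0 R. F a = 0}"
    have Y': "Y' \<subseteq> Z" "Y \<subseteq> Y'" by (auto simp: Y_def Y'_def Z_def S_def)
    have ll: "log_lead F = ln (norm (h 0)) + (\<Sum>a\<in>Z-{0}. real (m a) * ln (norm a))"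
      unfolding Z_def m_def by (rule log_lead_factorization[OF F _ h]) (use R in \<open>auto simp: S_def\<close>)
    \<comment> \<open>Zeros on the boundary circle have weight \<open>ln 1 = 0\<close>, so closed
      and open disc give the same count.\<close>
    have "zero_count F R = (\<Sum>a\<in>Y. real (m a) * zero_weight R a)"
      unfolding zero_count_def Y'_def[symmetric] m_def
      using Y' finite_subset[OF Y'(1) fin] R
      by (intro sum.mono_neutral_right) (auto simp: Y'_def Y_def zero_weight_def)
    also have "\<dots> = (\<Sum>a\<in>Y. real (m a) * ln R - (if a = 0 then 0 else real (m a) * ln (norm a)))"
      using R by (intro sum.cong) (auto simp: zero_weight_def ln_div algebra_simps)
    also have "\<dots> = (\<Sum>a\<in>Y. real (m a) * ln R) - (\<Sum>a\<in>Y. if a = 0 then 0 else real (m a) * ln (norm a))"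
      by (rule sum_subtractf)
    finally have zc: "zero_count F R = (\<Sum>a\<in>Y. real (m a) * ln R) - (\<Sum>a\<in>Y. if a = 0 then 0 else real (m a) * ln (norm a))" .
    have "(\<Sum>a\<in>Z-{0}. real (m a) * ln (norm a)) = (\<Sum>a\<in>Z. if a = 0 then 0 else real (m a) * ln (norm a))"
      using fin by (intro sum.mono_neutral_cong_left) auto
    also have "\<dots> = (\<Sum>a\<in>Z-Y. if a = 0 then 0 else real (m a) * ln (norm a)) + (\<Sum>a\<in>Y. if a = 0 then 0 else real (m a) * ln (norm a))"
      by (rule sum.subset_diff[OF YZ fin])
    also have "(\<Sum>a\<in>Z-Y. if a = 0 then 0 else real (m a) * ln (norm a)) = (\<Sum>a\<in>Z-Y. real (m a) * ln (norm a))"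
      using R by (intro sum.cong) (auto simp: Y_def Z_def)
    finally have s1: "(\<Sum>a\<in>Z-{0}. real (m a) * ln (norm a)) =
      (\<Sum>a\<in>Z-Y. real (m a) * ln (norm a)) + (\<Sum>a\<in>Y. if a = 0 then 0 else real (m a) * ln (norm a))" .
    have n0: "norm a \<noteq> 0" if "a \<in> Z - Y" for a using that R by (auto simp: Y_def Z_def)
    have "norm (G 0) = norm (h 0) * (\<Prod>a\<in>Z-Y. norm a ^ m a) * (\<Prod>a\<in>Y. R ^ m a)"
      unfolding G_def norm_mult prod_norm[symmetric] norm_power using R
      by (simp add: norm_divide norm_power power2_eq_square)
    also have "ln \<dots> = ln (norm (h 0)) + ln (\<Prod>a\<in>Z-Y. norm a ^ m a) + ln (\<Prod>a\<in>Y. R ^ m a)"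
    proof -
      have "(\<Prod>a\<in>Z-Y. norm a ^ m a) \<noteq> 0" using fin n0 by (auto simp: prod_zero_iff)
      moreover have "(\<Prod>a\<in>Y. R ^ m a) \<noteq> 0" using finY R by (auto simp: prod_zero_iff)
      moreover have "norm (h 0) \<noteq> 0" using h(2)[of 0] R by (simp add: S_def)
      ultimately show ?thesis by (simp add: ln_mult)
    qed
    also have "ln (\<Prod>a\<in>Z-Y. norm a ^ m a) = (\<Sum>a\<in>Z-Y. real (m a) * ln (norm a))"
      using fin n0 by (subst ln_prod) (auto simp: ln_realpow intro!: sum.cong)
    also have "ln (\<Prod>a\<in>Y. R ^ m a) = (\<Sum>a\<in>Y. real (m a) * ln R)"
      using finY R by (subst ln_prod) (auto simp: ln_realpow)
    finally show ?thesis using ll zc s1 by linarith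
  qed
  show ?thesis
  proof (rule that[of G])
    show "G holomorphic_on ball 0 R" by (rule holomorphic_on_subset[OF holG]) auto
    show "norm (G z) < 1" if "norm z < R" for z
      by (rule le_less_trans[OF Gle]) (use that in auto)
    show "norm (F z) \<le> norm (G z)" if "norm z < R" for z using FG[of z] that by simp
    show "G z \<noteq> 0" if "norm z < R" for z using that by (rule nz)
    show "ln (norm (G 0)) = log_lead F + zero_count F R" by (rule ln0)
  qed
qed

text \<open>The substitute for the lemma on the logarithmic derivative.\<close>

lemma shift_mean_bound:
  assumes F: "F holomorphic_on UNIV" "F z0 \<noteq> 0" and r: "0 < r" "r < R" "1 \<le> R"
    and bd: "\<And>z. norm z \<le> R \<Longrightarrow> norm (F z) \<le> exp (-1)"
    and J: "finite J" "J \<noteq> {}" and w: "\<And>j. j \<in> J \<Longrightarrow> norm (w j) \<le> \<kappa>" and \<kappa>: "\<kappa> < R - r"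
    and nz: "\<And>z. norm z = r \<Longrightarrow> F z \<noteq> 0"
    and X: "has_circle_mean (\<lambda>z. ln (Max ((\<lambda>j. norm (F (z + w j))) ` J)) - ln (norm (F z))) r X"
    and j0: "j0 \<in> J" "w j0 = 0"
  shows "X \<le> 2 * \<kappa> / (R - r) * (- log_lead F) + (zero_count F R - zero_count F r)"
proof -
  obtain G where G: "G holomorphic_on ball 0 R" "\<And>z. norm z < R \<Longrightarrow> G z \<noteq> 0"
    "\<And>z. norm z < R \<Longrightarrow> norm (G z) < 1" "\<And>z. norm z < R \<Longrightarrow> norm (F z) \<le> norm (G z)"
    "ln (norm (G 0)) = log_lead F + zero_count F R"
    by (rule blaschke_division[OF F less_trans[OF r(1,2)]]) (assumption | rule bd that)+
  define s where "s = R - r"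
  have \<kappa>0: "0 \<le> \<kappa>" using w[OF j0(1)] j0(2) by simp
  have s: "0 < s" "\<kappa> < s" using r \<kappa> by (auto simp: s_def)
  \<comment> \<open>The Harnack factor for a shift of length \<open>\<kappa>\<close> in a disc of
    radius \<open>s\<close>, the distance from the circle \<open>norm z = r\<close> to the boundary
    of the large disc.\<close>
  define q where "q = (s - \<kappa>) / (s + \<kappa>)"
  have q: "1 - q \<le> 2 * \<kappa> / s" "q \<le> 1"
    using s \<kappa>0 by (auto simp: q_def field_simps)
  \<comment> \<open>For the maximizing shift, \<open>F\<close> is first replaced by the larger
    zero-free \<open>G\<close>, and Harnack then returns from \<open>z + w j\<close> to
    \<open>z\<close>. The zero shift \<open>j0\<close> keeps the maximum positive, so that the
    logarithm is monotone there.\<close>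
  have pt: "ln (Max ((\<lambda>j. norm (F (z + w j))) ` J)) - ln (norm (F z)) \<le> q * ln (norm (G z)) - ln (norm (F z))"
    if z: "norm z = r" for z
  proof -
    have "Max ((\<lambda>j. norm (F (z + w j))) ` J) \<in> (\<lambda>j. norm (F (z + w j))) ` J"
      using J by (intro Max_in) auto
    then obtain j where j: "j \<in> J" "Max ((\<lambda>j. norm (F (z + w j))) ` J) = norm (F (z + w j))" by auto
    have "norm (F (z + w j0)) \<le> norm (F (z + w j))"
      unfolding j(2)[symmetric] using J j0 by (intro Max_ge finite_imageI imageI)
    then have pos: "0 < norm (F (z + w j))" using nz[OF z] j0 by auto
    have wj: "norm (w j) < s" using w[OF j(1)] s by simp
    have sub: "norm u < R" if "u \<in> ball z s" for u
      using that z norm_triangle_sub[of u z] by (auto simp: s_def dist_norm norm_minus_commute)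
    have inb: "norm (z + w j) < R" using sub[of "z + w j"] wj by (simp add: dist_norm)
    have "ln (norm (F (z + w j))) \<le> ln (norm (G (z + w j)))"
      using G(4)[OF inb] pos by (intro ln_mono) auto
    also have "\<dots> \<le> (s - norm (w j)) / (s + norm (w j)) * ln (norm (G z))"
    proof (rule harnack_nonvanishing[OF _ _ _ wj])
      show "G holomorphic_on ball z s" by (rule holomorphic_on_subset[OF G(1)]) (use sub in auto)
    qed (use sub G in auto)
    also have "\<dots> \<le> q * ln (norm (G z))"
    proof (rule mult_right_mono_neg)
      show "q \<le> (s - norm (w j)) / (s + norm (w j))"
        unfolding q_def using w[OF j(1)] s \<kappa>0
        by (intro frac_le) (auto intro: add_pos_nonneg)
      show "ln (norm (G z)) \<le> 0" using G(2,3)[of z] z r by simp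
    qed
    finally show ?thesis using j(2) by simp
  qed
  have mG: "has_circle_mean (\<lambda>z. ln (norm (G z))) r (ln (norm (G 0)))"
    by (rule has_circle_mean_ln_nonvanishing[OF G(1) r(1,2)]) (use G(2) in auto)
  \<comment> \<open>In the mean, \<open>ln (norm G)\<close> gives its value at 0 and
    \<open>ln (norm F)\<close> is given by Jensen. As \<open>ln (norm (G 0))\<close> contains
    \<open>zero_count F R\<close>, replacing \<open>F\<close> by \<open>G\<close> costs exactly the
    difference of the counts at \<open>R\<close> and \<open>r\<close>.\<close>
  have "X \<le> q * ln (norm (G 0)) - (log_lead F + zero_count F r)"
    by (rule has_circle_mean_mono[OF X has_circle_mean_diff[OF has_circle_mean_cmult[OF mG] jensen[OF F r(1)]]])
       (use r pt in auto)
  also have "\<dots> = (1 - q) * (- ln (norm (G 0))) + (ln (norm (G 0)) - log_lead F - zero_count F r)"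
    by (simp add: algebra_simps)
  also have "\<dots> \<le> 2 * \<kappa> / s * (- ln (norm (G 0))) + (ln (norm (G 0)) - log_lead F - zero_count F r)"
    using q(1) G(2,3)[of 0] r by (intro add_right_mono mult_right_mono) auto
  finally have 1: "X \<le> 2 * \<kappa> / s * (- ln (norm (G 0))) + (zero_count F R - zero_count F r)"
    unfolding G(5) by simp
  have "2 * \<kappa> / s * (- ln (norm (G 0))) \<le> 2 * \<kappa> / s * (- log_lead F)"
    unfolding G(5) using s \<kappa>0 zero_count_nonneg[OF r(3)] by (intro mult_left_mono) auto
  then show ?thesis using 1 unfolding s_def by linarith
qed

section \<open>Growth outside an exceptional set\<close>

text \<open>Summation by parts: the term equals the increment of \<open>s m / m\<close> plus
  \<open>s (Suc m) / (m * Suc m)\<close>. The increments telescope because \<open>s m / m\<close>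
  tends to 0, and the rest is dominated by a constant times a power with exponent
  \<open>\<sigma> - 2 < -1\<close>.\<close>

lemma summable_divide_difference:
  fixes s :: "nat \<Rightarrow> real"
  assumes "\<And>m. m \<ge> M \<Longrightarrow> s m \<le> s (Suc m)" "\<And>m. m \<ge> M \<Longrightarrow> 0 \<le> s m"
    and "\<And>m. m \<ge> M \<Longrightarrow> s m \<le> C * real m powr \<sigma>" and "\<sigma> < 1"
  shows "summable (\<lambda>m. (s (Suc m) - s m) / real m)"
proof -
  define N where "N = M + 1"
  define c where "c m = s m / real m" for m
  have id: "(s (Suc m) - s m) / real m = (c (Suc m) - c m) + s (Suc m) / (real m * real (Suc m))" if "m \<ge> N" for m
  proof -
    have e: "1 / real m = 1 / real (Suc m) + 1 / (real m * real (Suc m))"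
    proof -
      have "1 / x = 1 / (x + 1) + 1 / (x * (x + 1))" if "0 < x" for x :: real
        using that by (simp add: divide_simps)
      from this[of "real m"] show ?thesis using that by (simp add: N_def add.commute)
    qed
    have "(s (Suc m) - s m) / real m = s (Suc m) * (1 / real m) - s m / real m"
      by (simp add: diff_divide_distrib)
    also have "\<dots> = (c (Suc m) - c m) + s (Suc m) / (real m * real (Suc m))"
      unfolding e c_def by (simp add: distrib_left)
    finally show ?thesis .
  qed
  have "0 \<le> C * real (M + 1) powr \<sigma>" using assms(2,3)[of "M + 1"] by (rule order_trans) auto
  then have C: "0 \<le> C" by (simp add: zero_le_mult_iff)
  have clim: "c \<longlonglongrightarrow> 0"
  proof (rule tendsto_sandwich[OF _ _ tendsto_const])
    show "eventually (\<lambda>m. 0 \<le> c m) sequentially"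
      using eventually_ge_at_top[of N] by eventually_elim (use assms(2) in \<open>auto simp: c_def N_def\<close>)
    show "eventually (\<lambda>m. c m \<le> C * real m powr (\<sigma> - 1)) sequentially"
      using eventually_ge_at_top[of N]
    proof eventually_elim
      case (elim m)
      then have "c m \<le> C * real m powr \<sigma> / real m"
        unfolding c_def N_def by (intro divide_right_mono assms(3)) auto
      then show ?case using elim by (simp add: powr_diff N_def)
    qed
    have "(\<lambda>m. real m powr (\<sigma> - 1)) \<longlonglongrightarrow> 0"
      using assms(4) by (intro tendsto_neg_powr filterlim_real_sequentially) auto
    from tendsto_mult_left[OF this, of C] show "(\<lambda>m. C * real m powr (\<sigma> - 1)) \<longlonglongrightarrow> 0" by simp
  qed
  have 1: "summable (\<lambda>m. c (Suc m) - c m)"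
    using telescope_summable[OF clim] .
  have 2: "summable (\<lambda>m. s (Suc m) / (real m * real (Suc m)))"
  proof (rule summable_comparison_test_ev)
    show "summable (\<lambda>m. 2 * C * real (Suc m) powr (\<sigma> - 2))"
      using assms(4) by (subst summable_Suc_iff, intro summable_mult) (simp add: summable_real_powr_iff)
    show "eventually (\<lambda>m. norm (s (Suc m) / (real m * real (Suc m))) \<le> 2 * C * real (Suc m) powr (\<sigma> - 2)) sequentially"
      using eventually_ge_at_top[of N]
    proof eventually_elim
      case (elim m)
      then have m: "1 \<le> m" "M \<le> Suc m" by (auto simp: N_def)
      have "norm (s (Suc m) / (real m * real (Suc m))) = s (Suc m) / (real m * real (Suc m))"
        using assms(2)[OF m(2)] by simp
      also have "\<dots> \<le> (C * real (Suc m) powr \<sigma>) / (real (Suc m) / 2 * real (Suc m))"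
        using assms(2)[OF m(2)] assms(3)[OF m(2)] m(1) by (intro frac_le mult_right_mono) auto
      also have "\<dots> = 2 * C * (real (Suc m) powr \<sigma> / real (Suc m) powr 2)"
        by (simp add: power2_eq_square powr_numeral)
      also have "\<dots> = 2 * C * real (Suc m) powr (\<sigma> - 2)" by (simp only: powr_diff)
      finally show ?case .
    qed
  qed
  have "summable (\<lambda>m. (c (Suc m) - c m) + s (Suc m) / (real m * real (Suc m)))"
    by (rule summable_add[OF 1 2])
  then show ?thesis
    by (rule summable_cong[THEN iffD1, rotated])
       (use id in \<open>auto intro!: eventually_mono[OF eventually_ge_at_top[of N]]\<close>)
qed

text \<open>Turning the integral of \<open>1 / t\<close> over \<open>E\<close> into a measure makes
  countable subadditivity available.\<close>

definition log_measure :: "real measure" where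
  "log_measure = density lebesgue (\<lambda>t. ennreal (1 / t) * indicator {1..} t)"

lemma sets_log_measure [simp]: "sets log_measure = sets lebesgue"
  by (simp add: log_measure_def)

lemma emeasure_log_measure:
  assumes "A \<in> sets lebesgue"
  shows "emeasure log_measure A = (\<integral>\<^sup>+t\<in>A \<inter> {1..}. ennreal (1 / t) \<partial>lebesgue)"
proof -
  have "(\<lambda>t::real. ennreal (1 / t) * indicator {1..} t) \<in> borel_measurable lebesgue"
    by (intro measurable_completion) measurable
  from emeasure_density[OF this assms] show ?thesis
    unfolding log_measure_def by (simp add: indicator_inter_arith mult_ac)
qed

lemma finite_log_measure_iff:
  "finite_log_measure E \<longleftrightarrow> E \<subseteq> {0<..} \<and> E \<in> sets lebesgue \<and> emeasure log_measure E < \<infinity>"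
  unfolding finite_log_measure_def using emeasure_log_measure by auto

lemma emeasure_log_measure_interval:
  assumes "1 \<le> a" "0 < d"
  shows "emeasure log_measure {a..<a + d} \<le> ennreal (d / a)"
proof -
  have "emeasure log_measure {a..<a + d} \<le> (\<integral>\<^sup>+t. ennreal (1 / a) * indicator {a..<a + d} t \<partial>lebesgue)"
    unfolding emeasure_log_measure[of "{a..<a + d}", simplified]
    using assms by (intro nn_integral_mono) (auto simp: indicator_def frac_le intro!: ennreal_leI)
  also have "\<dots> = ennreal (1 / a) * ennreal d"
    using assms by (subst nn_integral_cmult_indicator) auto
  also have "\<dots> = ennreal (d / a)" using assms by (simp flip: ennreal_mult)
  finally show ?thesis .
qed

text \<open>A nondecreasing function of hyper-order below one can grow by the factor \<open>1 + 1/K\<close>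
  over a distance \<open>K\<close> only on a set of finite logarithmic measure; the sets for the individual
  \<open>K\<close> are cut off so that their union still has finite logarithmic measure.\<close>

lemma growth_outside_exceptional_set:
  fixes \<Phi> :: "real \<Rightarrow> real"
  assumes mono: "\<And>r s. r0 \<le> r \<Longrightarrow> r \<le> s \<Longrightarrow> \<Phi> r \<le> \<Phi> s"
    and ge1: "\<And>r. r0 \<le> r \<Longrightarrow> 1 \<le> \<Phi> r"
    and ub: "\<And>r. r0 \<le> r \<Longrightarrow> ln (\<Phi> r) \<le> r powr \<sigma>" and \<sigma>: "0 < \<sigma>" "\<sigma> < 1"
  obtains E where "finite_log_measure E"
    "\<And>K::nat. 1 \<le> K \<Longrightarrow> eventually (\<lambda>r. r \<notin> E \<longrightarrow> \<Phi> (r + real K) \<le> (1 + 1 / real K) * \<Phi> r) at_top"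
proof -
  define M where "M = Suc (nat \<lceil>r0\<rceil>)"
  have M: "1 \<le> M" "r0 \<le> real M" by (auto simp: M_def) linarith
  \<comment> \<open>Bad blocks of length \<open>K\<close>. Growth is tested over two blocks because
    \<open>r\<close> in the block from \<open>m * K\<close> has \<open>r + K\<close> in the next
    one, hence below \<open>(m + 2) * K\<close>.\<close>
  define B where "B K = {m. M \<le> m \<and> (1 + 1 / real K) * \<Phi> (real m * real K) < \<Phi> (real (m + 2) * real K)}" for K :: nat
  have ge: "r0 \<le> real m * real K" if "M \<le> m" "1 \<le> K" for m K
  proof -
    have "real M * 1 \<le> real m * real K" using that by (intro mult_mono) auto
    then show ?thesis using M by simp
  qed
  have summ: "summable (\<lambda>m. if m \<in> B K then 1 / real m else 0)" if K: "1 \<le> K" for K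
  proof -
    define a where "a m = ln (\<Phi> (real m * real K))" for m
    \<comment> \<open>Chosen so that \<open>s (Suc m) - s m\<close> equals
      \<open>a (m + 2) - a m\<close>, the logarithmic growth over two blocks. On a bad block it is
      at least \<open>\<delta>\<close>, which bounds \<open>1 / m\<close>, and thereby the
      logarithmic measure of the block, by a summable sequence.\<close>
    define s where "s m = a m + a (Suc m)" for m
    have amono: "a m \<le> a (Suc m)" if "M \<le> m" for m
    proof -
      have "\<Phi> (real m * real K) \<le> \<Phi> (real (Suc m) * real K)"
        by (rule mono[OF ge[OF that K]]) (simp add: distrib_right)
      then show ?thesis unfolding a_def using ge1[OF ge[OF that K]] by (intro ln_mono) auto
    qed
    have apos: "0 \<le> a m" if "M \<le> m" for m
      unfolding a_def using ge1[OF ge[OF that K]] by simp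
    have aub: "a m \<le> real K powr \<sigma> * real m powr \<sigma>" if "M \<le> m" for m
      using ub[OF ge[OF that K]] unfolding a_def by (simp add: powr_mult mult.commute)
    have sub: "s m \<le> 3 * real K powr \<sigma> * real m powr \<sigma>" if "M \<le> m" for m
    proof -
      have "real (Suc m) powr \<sigma> \<le> (2 * real m) powr \<sigma>" using that M \<sigma> by (intro powr_mono2) auto
      also have "\<dots> = 2 powr \<sigma> * real m powr \<sigma>" by (simp add: powr_mult)
      also have "\<dots> \<le> 2 * real m powr \<sigma>" using \<sigma> powr_mono[of \<sigma> 1 2] by (intro mult_right_mono) auto
      finally have "real K powr \<sigma> * real (Suc m) powr \<sigma> \<le> real K powr \<sigma> * (2 * real m powr \<sigma>)"
        by (intro mult_left_mono) auto
      then show ?thesis using aub[OF that] aub[of "Suc m"] that unfolding s_def by simp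
    qed
    define \<delta> where "\<delta> = ln (1 + 1 / real K)"
    have \<delta>: "0 < \<delta>" unfolding \<delta>_def using K by (intro ln_gt_zero) auto
    have "summable (\<lambda>m. (s (Suc m) - s m) / real m)"
    proof (rule summable_divide_difference)
      show "s m \<le> s (Suc m)" if "M \<le> m" for m
        using amono[OF that] amono[of "Suc m"] that unfolding s_def by simp
      show "0 \<le> s m" if "M \<le> m" for m
        using apos[OF that] apos[of "Suc m"] that unfolding s_def by simp
      show "s m \<le> 3 * real K powr \<sigma> * real m powr \<sigma>" if "M \<le> m" for m
        by (rule sub[OF that])
    qed (rule \<sigma>)
    then have "summable (\<lambda>m. 1 / \<delta> * ((s (Suc m) - s m) / real m))" by (rule summable_mult)
    then show ?thesis
    proof (rule summable_comparison_test_ev[rotated], intro eventually_mono[OF eventually_ge_at_top[of M]])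
      fix m assume m: "M \<le> m"
      have nn: "0 \<le> s (Suc m) - s m" using amono[OF m] amono[of "Suc m"] m unfolding s_def by simp
      show "norm (if m \<in> B K then 1 / real m else 0) \<le> 1 / \<delta> * ((s (Suc m) - s m) / real m)"
      proof (cases "m \<in> B K")
        case True
        then have lt: "(1 + 1 / real K) * \<Phi> (real m * real K) < \<Phi> (real (m + 2) * real K)"
          by (simp add: B_def)
        have p: "0 < \<Phi> (real m * real K)" using ge1[OF ge[OF m K]] by simp
        have k1: "0 < 1 + 1 / real K" by (simp add: add_pos_nonneg)
        have "\<delta> + a m = ln ((1 + 1 / real K) * \<Phi> (real m * real K))"
          unfolding \<delta>_def a_def using p k1 by (simp add: ln_mult_pos)
        also have "\<dots> \<le> ln (\<Phi> (real (m + 2) * real K))"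
          using lt p k1 by (intro ln_mono) auto
        finally have "\<delta> \<le> s (Suc m) - s m" by (simp add: s_def a_def)
        then have "1 \<le> 1 / \<delta> * (s (Suc m) - s m)" using \<delta> by (simp add: field_simps)
        then have "1 / real m \<le> (1 / \<delta> * (s (Suc m) - s m)) / real m" by (rule divide_right_mono) simp
        then show ?thesis using True by simp
      next
        case False
        then show ?thesis using nn \<delta> by simp
      qed
    qed
  qed
  \<comment> \<open>Discarding the blocks below index \<open>N K\<close> leaves a set of measure at
    most \<open>(1/2) ^ K\<close>, so the union over all \<open>K\<close> stays finite. Each
    \<open>K\<close> loses only a bounded range of radii, which an eventual statement
    tolerates.\<close>
  have "\<exists>N. 1 \<le> K \<longrightarrow> (\<Sum>i. if i + N \<in> B K then 1 / real (i + N) else 0) < (1/2) ^ K" for K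
    using suminf_exist_split[OF _ summ, of "(1/2) ^ K" K] by (fastforce simp: abs_less_iff)
  then obtain N where N: "\<And>K. 1 \<le> K \<Longrightarrow> (\<Sum>i. if i + N K \<in> B K then 1 / real (i + N K) else 0) < (1/2) ^ K"
    by metis
  define I where "I K m = (if m \<in> B K then {real m * real K..<real m * real K + real K} else {})" for K m
  define A where "A K = (if 1 \<le> K then \<Union>i. I K (i + N K) else {})" for K
  define E where "E = (\<Union>K. A K)"
  have Im: "I K m \<in> sets lebesgue" for K m by (auto simp: I_def)
  have Am: "A K \<in> sets lebesgue" for K unfolding A_def using Im by auto
  have Em: "E \<in> sets lebesgue" unfolding E_def using Am by auto
  have AI: "emeasure log_measure (A K) \<le> ennreal ((1/2) ^ K)" for K
  proof (cases "1 \<le> K")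
    case True
    have "emeasure log_measure (A K) \<le> (\<Sum>i. emeasure log_measure (I K (i + N K)))"
      unfolding A_def using True Im by (simp add: image_subset_iff emeasure_subadditive_countably)
    also have "\<dots> \<le> (\<Sum>i. ennreal (if i + N K \<in> B K then 1 / real (i + N K) else 0))"
    proof (intro suminf_le summableI allI)
      fix i
      have "emeasure log_measure (I K m) \<le> ennreal (if m \<in> B K then 1 / real m else 0)" for m
      proof (cases "m \<in> B K")
        case True
        then have "1 \<le> m" using M(1) by (simp add: B_def)
        then have "1 * 1 \<le> real m * real K" using \<open>1 \<le> K\<close> by (intro mult_mono) auto
        then show ?thesis
          using emeasure_log_measure_interval[of "real m * real K" "real K"] True \<open>1 \<le> K\<close>
          by (simp add: I_def)
      qed (simp add: I_def)
      then show "emeasure log_measure (I K (i + N K)) \<le> ennreal (if i + N K \<in> B K then 1 / real (i + N K) else 0)" .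
    qed
    also have "\<dots> = ennreal (\<Sum>i. if i + N K \<in> B K then 1 / real (i + N K) else 0)"
    proof (rule suminf_ennreal2)
      show "summable (\<lambda>i. if i + N K \<in> B K then 1 / real (i + N K) else 0)"
        using summ[OF True] summable_iff_shift[of "\<lambda>m. if m \<in> B K then 1 / real m else 0" "N K"] by simp
    qed auto
    also have "\<dots> \<le> ennreal ((1/2) ^ K)" using N[OF True] by (intro ennreal_leI) simp
    finally show ?thesis .
  qed (simp add: A_def)
  have "emeasure log_measure E \<le> (\<Sum>K. emeasure log_measure (A K))"
    unfolding E_def using Am by (intro emeasure_subadditive_countably) auto
  also have "\<dots> \<le> (\<Sum>K. ennreal ((1/2) ^ K))" by (intro suminf_le summableI AI)
  also have "\<dots> = ennreal (\<Sum>K. (1/2) ^ K)" by (rule suminf_ennreal2) auto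
  also have "\<dots> < \<infinity>" by simp
  finally have fin: "emeasure log_measure E < \<infinity>" .
  have "0 < x" if x: "x \<in> I K m" "1 \<le> K" for x K m
  proof -
    have "m \<in> B K" "real m * real K \<le> x" using x by (auto simp: I_def split: if_splits)
    then have "1 \<le> m" using M(1) by (simp add: B_def)
    then have "0 < real m * real K" using x by simp
    then show ?thesis using \<open>real m * real K \<le> x\<close> by linarith
  qed
  then have "E \<subseteq> {0<..}" by (auto simp: E_def A_def split: if_splits)
  then have 1: "finite_log_measure E" using Em fin by (simp add: finite_log_measure_iff)
  have 2: "eventually (\<lambda>r. r \<notin> E \<longrightarrow> \<Phi> (r + real K) \<le> (1 + 1 / real K) * \<Phi> r) at_top" if K: "1 \<le> K" for K :: nat
    using eventually_ge_at_top[of "real (N K + M) * real K"]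
  proof eventually_elim
    case (elim r)
    show ?case
    proof
      assume r: "r \<notin> E"
      define m where "m = nat \<lfloor>r / real K\<rfloor>"
      have rK: "real (N K + M) \<le> r / real K" using elim K by (simp add: field_simps)
      then have m1: "N K + M \<le> m" unfolding m_def by (metis le_floor_iff le_nat_iff of_int_of_nat_eq of_nat_le_iff nat_int nat_mono)
      have "real m \<le> r / real K" "r / real K < real m + 1"
        unfolding m_def using rK by linarith+
      then have m2: "real m * real K \<le> r" "r < real m * real K + real K"
        using K by (auto simp: field_simps)
      have "m \<notin> B K"
      proof
        assume "m \<in> B K"
        then have "r \<in> I K m" using m2 by (simp add: I_def)
        moreover have "m = (m - N K) + N K" using m1 by simp
        ultimately have "\<exists>i. r \<in> I K (i + N K)" by metis
        then have "r \<in> A K" unfolding A_def using K by auto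
        then show False using r by (auto simp: E_def)
      qed
      then have good: "\<Phi> (real (m + 2) * real K) \<le> (1 + 1 / real K) * \<Phi> (real m * real K)"
        using m1 by (auto simp: B_def)
      have rm: "r0 \<le> real m * real K" using m1 by (intro ge K) auto
      have "\<Phi> (r + real K) \<le> \<Phi> (real (m + 2) * real K)"
        using m2 rm by (intro mono) (auto simp: algebra_simps)
      also note good
      also have "(1 + 1 / real K) * \<Phi> (real m * real K) \<le> (1 + 1 / real K) * \<Phi> r"
        using m2 rm by (intro mult_left_mono mono) auto
      finally show "\<Phi> (r + real K) \<le> (1 + 1 / real K) * \<Phi> r" .
    qed
  qed
  show ?thesis by (rule that[OF 1 2])
qed

text \<open>Countable sets are Lebesgue null. This will remove the radii of circles that carry a
  zero of a form, of the Casoratian or of \<open>\<psi>\<close>.\<close>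

lemma finite_log_measure_Un_countable:
  assumes "finite_log_measure E" "countable C"
  shows "finite_log_measure (E \<union> (C \<inter> {0<..}))"
proof -
  define D where "D = C \<inter> {0<..}"
  have cD: "countable D" using assms(2) by (auto simp: D_def)
  have nD: "D \<in> null_sets lebesgue"     by (intro null_sets_completionI countable_imp_null_set_lborel cD)
  have E: "E \<in> sets lebesgue" using assms(1) by (simp add: finite_log_measure_def)
  have mD: "emeasure log_measure D = 0"
    unfolding emeasure_log_measure[OF null_setsD2[OF nD]]
    by (rule nn_integral_null_set[OF null_set_Int2[OF nD, of "{1..}"]]) auto
  have "emeasure log_measure (E \<union> D) \<le> emeasure log_measure E + emeasure log_measure D"
    using E nD by (intro emeasure_subadditive) auto
  also have "\<dots> < \<infinity>" using assms(1) mD by (simp add: finite_log_measure_iff)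
  finally show ?thesis using assms(1) E nD
    unfolding finite_log_measure_iff D_def[symmetric] by (auto simp: D_def)
qed

section \<open>The characteristic of a holomorphic curve\<close>

lemma zero_count_ge_zero_weight:
  assumes "F holomorphic_on UNIV" "F z0 \<noteq> 0" "F a = 0" "1 \<le> r" "norm a \<le> r"
  shows "zero_weight r a \<le> zero_count F r"
proof -
  have "1 \<le> real (nat (zorder F a))" using zorder_zero_pos[OF assms(1-3)] by simp
  then have "1 * zero_weight r a \<le> real (nat (zorder F a)) * zero_weight r a"
    by (rule mult_right_mono) (rule zero_weight_nonneg[OF assms(4,5)])
  also have "\<dots> \<le> zero_count F r"
    unfolding zero_count_def
    by (rule member_le_sum[where f = "\<lambda>a. real (nat (zorder F a)) * zero_weight r a"])
       (use assms finite_zeros_cball[OF assms(1,2), of r] in \<open>auto intro!: mult_nonneg_nonneg zero_weight_nonneg\<close>)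
  finally show ?thesis by simp
qed

text \<open>A single zero contributes at least \<open>ln (r / norm a)\<close>, or
  \<open>ln r\<close> at the origin, which is unbounded in \<open>r\<close>; the radius below makes
  this at least \<open>\<bar>C\<bar> + 1\<close>.\<close>

lemma zero_count_bounded_imp_no_zeros:
  assumes "F holomorphic_on UNIV" "F z0 \<noteq> 0" "\<And>r. 1 \<le> r \<Longrightarrow> zero_count F r \<le> C"
  shows "F a \<noteq> 0"
proof
  assume a: "F a = 0"
  define r where "r = (1 + norm a) * exp (\<bar>C\<bar> + 1)"
  have e: "1 \<le> exp (\<bar>C\<bar> + 1)" by simp
  have r1: "(1 + norm a) * 1 \<le> r" unfolding r_def using e by (intro mult_left_mono) auto
  have "1 + norm a \<le> r" using r1 by simp
  then have rr: "1 \<le> r" "norm a \<le> r" using norm_ge_zero[of a] by linarith+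
  have r2: "1 * exp (\<bar>C\<bar> + 1) \<le> r" unfolding r_def by (intro mult_right_mono) auto
  have r3: "norm a * exp (\<bar>C\<bar> + 1) \<le> r" unfolding r_def by (intro mult_right_mono) auto
  have "\<bar>C\<bar> + 1 \<le> zero_weight r a"
  proof (cases "a = 0")
    case True
    have "ln (exp (\<bar>C\<bar> + 1)) \<le> ln r" using r2 by (intro ln_mono) auto
    then show ?thesis using True by (simp add: zero_weight_def)
  next
    case False
    have "exp (\<bar>C\<bar> + 1) \<le> r / norm a" using r3 False by (simp add: field_simps)
    then have "ln (exp (\<bar>C\<bar> + 1)) \<le> ln (r / norm a)" by (intro ln_mono) auto
    then show ?thesis using False by (simp add: zero_weight_def)
  qed
  also have "\<dots> \<le> zero_count F r"
    by (rule zero_count_ge_zero_weight[OF assms(1,2) a rr])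
  also have "\<dots> \<le> C" by (rule assms(3)[OF rr(1)])
  finally show False by linarith
qed

text \<open>Divergence of \<open>T\<close> puts \<open>ln (T r)\<close> above 1 eventually, so
  exponentiating the iterated logarithm really returns \<open>ln (T r)\<close>. The maximum with
  \<open>1/2\<close> only keeps the exponent positive.\<close>

lemma hyper_order_less_one_imp:
  assumes "hyper_order T < 1" "filterlim T at_top at_top"
  obtains \<sigma> where "0 < \<sigma>" "\<sigma> < 1" "eventually (\<lambda>r. ln (T r) \<le> r powr \<sigma>) at_top"
proof -
  obtain y where y: "hyper_order T < ereal y" "ereal y < 1"
    using ereal_dense2[OF assms(1)] by auto
  define \<sigma> where "\<sigma> = max y (1/2)"
  have \<sigma>: "0 < \<sigma>" "\<sigma> < 1" using y(2) by (auto simp: \<sigma>_def one_ereal_def)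
  have "eventually (\<lambda>r. ereal (ln (ln (T r)) / ln r) < ereal y) at_top"
    using Limsup_lessD[OF y(1)[unfolded hyper_order_def]] .
  then have "eventually (\<lambda>r. ln (T r) \<le> r powr \<sigma>) at_top"
    using eventually_gt_at_top[of 1] filterlim_at_top_dense[THEN iffD1, OF assms(2), rule_format, of "exp 1"]
  proof eventually_elim
    case (elim r)
    have "ln (exp 1) < ln (T r)" using elim(3) by (subst ln_less_cancel_iff) (auto intro: less_trans[of _ "exp 1"])
    then have l: "1 < ln (T r)" by simp
    have "ln (ln (T r)) / ln r < \<sigma>" using elim(1) by (simp add: \<sigma>_def)
    then have "ln (ln (T r)) \<le> \<sigma> * ln r" using elim(2) by (simp add: divide_less_eq)
    then have "exp (ln (ln (T r))) \<le> exp (\<sigma> * ln r)" by simp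
    then show ?case using l elim(2) by (simp add: powr_def)
  qed
  with \<sigma> show ?thesis by (rule that)
qed

text \<open>The lower bound \<open>1 \<le> T r\<close> excludes negative values of
  \<open>ln (T r)\<close>, at which the outer logarithm could be large by convention; at
  \<open>T r = 1\<close> the default \<open>ln 0 = 0\<close> is harmless.\<close>

lemma hyper_order_less_oneI:
  assumes "\<sigma> < 1" "eventually (\<lambda>r. 1 \<le> T r \<and> ln (T r) \<le> r powr \<sigma>) at_top" "0 < \<sigma>"
  shows "hyper_order T < 1"
proof -
  have "hyper_order T \<le> ereal \<sigma>"
    unfolding hyper_order_def
  proof (rule Limsup_bounded)
    show "eventually (\<lambda>r. ereal (ln (ln (T r)) / ln r) \<le> ereal \<sigma>) at_top"
      using assms(2) eventually_gt_at_top[of 1]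
    proof eventually_elim
      case (elim r)
      have "ln (ln (T r)) \<le> \<sigma> * ln r"
      proof (cases "ln (T r) = 0")
        case True
        then show ?thesis using elim(2) assms(3) by simp
      next
        case False
        then have "0 < ln (T r)" using elim(1) ln_ge_zero[of "T r"] by linarith
        then have "ln (ln (T r)) \<le> ln (r powr \<sigma>)" using elim(1) by (intro ln_mono) auto
        then show ?thesis using elim(2) by (simp add: ln_powr)
      qed
      then show ?case using elim(2) by (simp add: divide_le_eq)
    qed
  qed
  also have "\<dots> < 1" using assms(1) by simp
  finally show ?thesis .
qed

lemma pole_count_entire:
  assumes "f holomorphic_on UNIV"
  shows "pole_count f t = 0"
proof -
  have "\<not> is_pole f z" for z
    using assms by (metis UNIV_I not_is_pole_holomorphic open_UNIV)
  then show ?thesis by (simp add: pole_count_def)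
qed

lemma nevanlinna_char_entire:
  assumes "f holomorphic_on UNIV"
  shows "nevanlinna_char f r = circle_mean (\<lambda>z. max 0 (ln (norm (f z)))) r"
  unfolding nevanlinna_char_def integrated_counting_def pole_count_entire[OF assms] by simp

lemma const_in_periodic_field: "(\<lambda>_. k) \<in> periodic_field c"
proof -
  have "nevanlinna_char (\<lambda>_. k) r = max 0 (ln (norm k))" for r
    by (subst nevanlinna_char_entire) (auto intro!: has_circle_mean_imp_eq has_circle_mean_const)
  then have eq: "hyper_order (nevanlinna_char (\<lambda>_. k)) =
      Limsup at_top (\<lambda>r. ereal (ln (ln (max 0 (ln (norm k)))) / ln r))"
    unfolding hyper_order_def by simp
  have "((\<lambda>r. ln (ln (max 0 (ln (norm k)))) / ln r) \<longlongrightarrow> 0) at_top"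
    by real_asymp
  then have "Limsup at_top (\<lambda>r. ereal (ln (ln (max 0 (ln (norm k)))) / ln r)) = ereal 0"
    by (intro lim_imp_Limsup tendsto_ereal) auto
  then have "hyper_order (nevanlinna_char (\<lambda>_. k)) < 1" unfolding eq by simp
  then show ?thesis
    unfolding periodic_field_def
    by (auto intro!: analytic_on_imp_nicely_meromorphic_on analytic_intros)
qed

section \<open>Curves and their harmonic majorants\<close>

locale holomorphic_curve =
  fixes n :: nat and g :: "nat \<Rightarrow> complex \<Rightarrow> complex"
  assumes reduced: "reduced_representation n g"
begin

definition logmax :: "complex \<Rightarrow> real" where
  "logmax z = ln (Max ((\<lambda>k. norm (g k z)) ` {0..n}))"

abbreviation T :: "real \<Rightarrow> real" where "T \<equiv> cartan_char n g"

lemma hol: "k \<le> n \<Longrightarrow> g k holomorphic_on UNIV"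
  using reduced by (auto simp: reduced_representation_def)

lemma Max_pos: "0 < Max ((\<lambda>k. norm (g k z)) ` {0..n})"
proof -
  obtain k where k: "k \<in> {0..n}" "g k z \<noteq> 0"
    using reduced unfolding reduced_representation_def by blast
  have "norm (g k z) \<le> Max ((\<lambda>k. norm (g k z)) ` {0..n})" using k by (intro Max_ge) auto
  then show ?thesis using k by (meson less_le_trans zero_less_norm_iff)
qed

lemma exp_logmax: "exp (logmax z) = Max ((\<lambda>k. norm (g k z)) ` {0..n})"
  unfolding logmax_def using Max_pos by simp

lemma norm_le_logmax: "k \<le> n \<Longrightarrow> norm (g k z) \<le> exp (logmax z)"
  unfolding exp_logmax by (intro Max_ge) auto

lemma logmax_attained:
  obtains k where "k \<le> n" "norm (g k z) = exp (logmax z)"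
proof -
  have "Max ((\<lambda>k. norm (g k z)) ` {0..n}) \<in> (\<lambda>k. norm (g k z)) ` {0..n}" by (intro Max_in) auto
  then show ?thesis using that unfolding exp_logmax[symmetric] by auto
qed

lemma continuous_logmax: "continuous_on S logmax"
proof -
  have "continuous_on S (\<lambda>z. Max ((\<lambda>k. norm (g k z)) ` {0..n}))"
    by (rule continuous_on_Max_norm)
       (auto intro!: holomorphic_on_imp_continuous_on holomorphic_on_subset[OF hol])
  then show ?thesis unfolding logmax_def
    using Max_pos by (intro continuous_on_ln) (auto simp: less_imp_neq[symmetric])
qed

lemma cartan_char_eq: "T r = circle_mean logmax r - logmax 0"
  unfolding cartan_char_def Let_def logmax_def[abs_def] ..

lemma has_circle_mean_logmax: "0 \<le> r \<Longrightarrow> has_circle_mean logmax r (T r + logmax 0)"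
  using continuous_has_circle_mean[OF continuous_logmax] unfolding cartan_char_eq by simp

lemma logmax_le_iff: "logmax z \<le> x \<longleftrightarrow> (\<forall>k\<le>n. norm (g k z) \<le> exp x)"
proof
  assume "logmax z \<le> x"
  then show "\<forall>k\<le>n. norm (g k z) \<le> exp x" using norm_le_logmax by (meson exp_le_cancel_iff order_trans)
next
  assume *: "\<forall>k\<le>n. norm (g k z) \<le> exp x"
  obtain k where "k \<le> n" "norm (g k z) = exp (logmax z)" by (rule logmax_attained)
  then show "logmax z \<le> x" using * by (metis exp_le_cancel_iff)
qed

text \<open>The maximum principle is applied to each coordinate separately, so subharmonicity of
  \<open>logmax\<close> itself is never invoked.\<close>

lemma logmax_le_Re:
  assumes "P holomorphic_on UNIV" "0 < R" "\<And>z. norm z = R \<Longrightarrow> logmax z \<le> Re (P z)" "norm z \<le> R"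
  shows "logmax z \<le> Re (P z)"
  unfolding logmax_le_iff
proof (intro allI impI)
  fix k assume k: "k \<le> n"
  show "norm (g k z) \<le> exp (Re (P z))"
    by (rule max_principle_exp[OF hol[OF k] assms(1,2) _ assms(4)])
       (use assms(3) k in \<open>auto simp: logmax_le_iff\<close>)
qed

text \<open>\<open>Re (P 0)\<close> is the mean of \<open>Re P\<close> over the circle, hence within
  \<open>\<epsilon>\<close> of the mean of what it majorizes. The summand \<open>\<alpha>\<close>
  leaves room for the size of the hyperplane coefficients.\<close>

lemma harmonic_majorant:
  assumes "0 < R" "0 < \<epsilon>" "continuous_on (sphere 0 R) \<alpha>"
  obtains P where "P holomorphic_on UNIV" "\<And>z. norm z = R \<Longrightarrow> logmax z + \<alpha> z \<le> Re (P z)"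
    "Re (P 0) \<le> T R + logmax 0 + circle_mean \<alpha> R + \<epsilon>"
proof -
  have "continuous_on (sphere 0 R) (\<lambda>z. logmax z + \<alpha> z)"
    by (intro continuous_intros continuous_logmax assms(3))
  then obtain p :: "complex poly" where p: "\<And>z. norm z = R \<Longrightarrow> logmax z + \<alpha> z < Re (poly p z)"
    "\<And>z. norm z = R \<Longrightarrow> Re (poly p z) < logmax z + \<alpha> z + \<epsilon>"
    using circle_majorant[OF _ assms(2)] by blast
  have hp: "poly p holomorphic_on UNIV" by (intro holomorphic_intros)
  have "has_circle_mean (\<lambda>z. Re (poly p z)) R (Re (poly p 0))"
    using has_circle_mean_Re_entire[OF hp assms(1), of 0] by simp
  moreover have "has_circle_mean (\<lambda>z. (logmax z + \<alpha> z) + \<epsilon>) R ((T R + logmax 0 + circle_mean \<alpha> R) + \<epsilon>)"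
    by (intro has_circle_mean_add has_circle_mean_logmax continuous_has_circle_mean assms(3) has_circle_mean_const)
       (use assms(1) in auto)
  ultimately have "Re (poly p 0) \<le> (T R + logmax 0 + circle_mean \<alpha> R) + \<epsilon>"
    by (rule has_circle_mean_mono) (use assms(1) p(2) in \<open>auto intro: less_imp_le\<close>)
  then show ?thesis using that[OF hp] p(1) by (meson less_imp_le)
qed

text \<open>A majorant on the larger circle also majorizes on the smaller one, and its mean over
  both circles is the same number \<open>Re (P 0)\<close>.\<close>

lemma T_mono:
  assumes "0 < r" "r \<le> s"
  shows "T r \<le> T s"
proof (rule field_le_epsilon)
  fix \<epsilon> :: real assume \<epsilon>: "0 < \<epsilon>"
  obtain P where P: "P holomorphic_on UNIV" "\<And>z. norm z = s \<Longrightarrow> logmax z + 0 \<le> Re (P z)"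
    "Re (P 0) \<le> T s + logmax 0 + circle_mean (\<lambda>_. 0) s + \<epsilon>"
    by (rule harmonic_majorant[of s \<epsilon> "\<lambda>_. 0"]) (use assms \<epsilon> in auto)
  have c0: "circle_mean (\<lambda>_. 0) s = 0" using has_circle_mean_imp_eq[OF has_circle_mean_const] .
  have "T r + logmax 0 \<le> Re (P 0)"
  proof (rule has_circle_mean_mono[OF has_circle_mean_logmax has_circle_mean_Re_entire[OF P(1), of _ 0]])
    show "logmax z \<le> Re (P (z + 0))" if "norm z = r" for z
      using logmax_le_Re[OF P(1), of s z] P(2) assms that by simp
  qed (use assms in auto)
  then show "T r \<le> T s + \<epsilon>" using P(3) c0 by linarith
qed

lemma T_nonneg:
  assumes "0 < s"
  shows "0 \<le> T s"
proof (rule field_le_epsilon)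
  fix \<epsilon> :: real assume \<epsilon>: "0 < \<epsilon>"
  obtain P where P: "P holomorphic_on UNIV" "\<And>z. norm z = s \<Longrightarrow> logmax z + 0 \<le> Re (P z)"
    "Re (P 0) \<le> T s + logmax 0 + circle_mean (\<lambda>_. 0) s + \<epsilon>"
    by (rule harmonic_majorant[of s \<epsilon> "\<lambda>_. 0"]) (use assms \<epsilon> in auto)
  have c0: "circle_mean (\<lambda>_. 0) s = 0" using has_circle_mean_imp_eq[OF has_circle_mean_const] .
  have "logmax 0 \<le> Re (P 0)" using logmax_le_Re[OF P(1), of s 0] P(2) assms by simp
  then show "0 \<le> T s + \<epsilon>" using P(3) c0 by linarith
qed

text \<open>Comparison with a fixed disc: by Harnack's inequality there, a harmonic majorant of
  the curve on a large disc is almost constant near the origin, relative to its size.\<close>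

lemma majorant_shift:
  assumes "0 < \<epsilon>"
  obtains C R1 where "0 < R1" "\<And>R P. R1 \<le> R \<Longrightarrow> P holomorphic_on UNIV \<Longrightarrow>
     (\<And>z. norm z = R \<Longrightarrow> logmax z \<le> Re (P z)) \<Longrightarrow> Re (P w) - Re (P 0) \<le> \<epsilon> * Re (P 0) + C"
proof -
  \<comment> \<open>Large enough that the Harnack factor
    \<open>(R1 + norm w) / (R1 - norm w)\<close> is at most \<open>1 + \<epsilon>\<close>.\<close>
  define R1 where "R1 = norm w * (1 + 2 / \<epsilon>) + 1"
  have R1: "norm w < R1" "2 * norm w \<le> \<epsilon> * (R1 - norm w)" "0 < R1"
  proof -
    have "0 \<le> norm w * (2 / \<epsilon>)" using assms by simp
    then show "norm w < R1" unfolding R1_def by (simp add: distrib_left)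
    then show "0 < R1" using norm_ge_zero[of w] by linarith
    show "2 * norm w \<le> \<epsilon> * (R1 - norm w)" unfolding R1_def using assms by (simp add: field_simps)
  qed
  have one: "(0 :: real) < 1" by simp
  \<comment> \<open>\<open>Re P\<close> may be negative near the origin. A polynomial
    \<open>p\<close> whose real part exceeds \<open>- logmax\<close> on the fixed circle makes
    \<open>P + p + 1\<close> have positive real part there and inside; \<open>p\<close>, and so
    \<open>C\<close>, depends neither on \<open>R\<close> nor on \<open>P\<close>.\<close>
  have "continuous_on (sphere 0 R1) (\<lambda>z. - logmax z)" by (intro continuous_intros continuous_logmax)
  then obtain p :: "complex poly" where p: "\<And>z. norm z = R1 \<Longrightarrow> - logmax z < Re (poly p z)"
    using circle_majorant[OF _ one] by blast
  have hp: "poly p holomorphic_on UNIV" by (intro holomorphic_intros)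
  define C where "C = - Re (poly p w) - 1 + (1 + \<epsilon>) * (1 + Re (poly p 0))"
  have "Re (P w) - Re (P 0) \<le> \<epsilon> * Re (P 0) + C"
    if R: "R1 \<le> R" and P: "P holomorphic_on UNIV" "\<And>z. norm z = R \<Longrightarrow> logmax z \<le> Re (P z)" for R P
  proof -
    define f where "f z = P z + poly p z + 1" for z
    have hf: "f holomorphic_on UNIV" unfolding f_def by (intro holomorphic_intros P hp)
    have pos: "0 < Re (f z)" if "norm z \<le> R1" for z
    proof -
      have "norm (exp (- poly p z)) \<le> exp (Re (P z))"
      proof (rule max_principle_exp[OF _ P(1) R1(3) _ that])
        show "(\<lambda>z. exp (- poly p z)) holomorphic_on UNIV" by (intro holomorphic_intros)
        fix z :: complex assume z: "norm z = R1"
        have "logmax z \<le> Re (P z)" using logmax_le_Re[OF P(1), of R z] P(2) z R R1 by simp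
        then show "norm (exp (- poly p z)) \<le> exp (Re (P z))" using p[OF z] by simp
      qed
      then show ?thesis by (simp add: f_def)
    qed
    have "Re (f (0 + w)) \<le> (R1 + norm w) / (R1 - norm w) * Re (f 0)"
      by (rule harnack(2)[OF holomorphic_on_subset[OF hf] _ R1(1)]) (use pos in auto)
    also have "\<dots> \<le> (1 + \<epsilon>) * Re (f 0)"
    proof (rule mult_right_mono)
      show "(R1 + norm w) / (R1 - norm w) \<le> 1 + \<epsilon>"
        using R1 by (simp add: pos_divide_le_eq algebra_simps)
    qed (use pos[of 0] R1 in auto)
    finally show ?thesis by (simp add: f_def C_def algebra_simps)
  qed
  with R1(3) show ?thesis by (rule that)
qed

end

section \<open>Rings of entire functions\<close>

text \<open>An abstract setting for linear algebra with entire coefficients in which nothing is ever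
  divided, so that removable singularities and poles do not arise.\<close>

locale entire_ring =
  fixes \<R> :: "(complex \<Rightarrow> complex) set"
  assumes holomorphic: "f \<in> \<R> \<Longrightarrow> f holomorphic_on UNIV"
    and zero: "(\<lambda>_. 0) \<in> \<R>" and one: "(\<lambda>_. 1) \<in> \<R>"
    and uminus: "f \<in> \<R> \<Longrightarrow> (\<lambda>z. - f z) \<in> \<R>"
    and plus: "f \<in> \<R> \<Longrightarrow> h \<in> \<R> \<Longrightarrow> (\<lambda>z. f z + h z) \<in> \<R>"
    and times: "f \<in> \<R> \<Longrightarrow> h \<in> \<R> \<Longrightarrow> (\<lambda>z. f z * h z) \<in> \<R>"
begin

lemma sum_closed: "(\<And>i. i \<in> I \<Longrightarrow> f i \<in> \<R>) \<Longrightarrow> (\<lambda>z. \<Sum>i\<in>I. f i z) \<in> \<R>"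
  by (induction I rule: infinite_finite_induct) (auto intro: zero plus)

lemma prod_closed: "(\<And>i. i \<in> I \<Longrightarrow> f i \<in> \<R>) \<Longrightarrow> (\<lambda>z. \<Prod>i\<in>I. f i z) \<in> \<R>"
  by (induction I rule: infinite_finite_induct) (auto intro: one times)

lemma mult_nonzero:
  assumes "f \<in> \<R>" "h \<in> \<R>" "f z0 \<noteq> 0" "h z1 \<noteq> 0"
  obtains z where "f z * h z \<noteq> 0"
proof -
  have "eventually (\<lambda>z. f z \<noteq> 0 \<and> h z \<noteq> 0) (at 0)"
    using eventually_nonzero_at[OF holomorphic] assms by (auto intro!: eventually_conj)
  then show ?thesis using eventually_happens[of _ "at (0::complex)"] that by fastforce
qed

lemma prod_nonzero:
  assumes "finite I" "\<And>i. i \<in> I \<Longrightarrow> f i \<in> \<R> \<and> (\<exists>z. f i z \<noteq> 0)"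
  shows "\<exists>z. (\<Prod>i\<in>I. f i z) \<noteq> 0"
  using assms
proof (induction I rule: finite_induct)
  case (insert x F)
  obtain z0 where "f x z0 \<noteq> 0" using insert.prems by blast
  moreover have "\<exists>z. (\<Prod>i\<in>F. f i z) \<noteq> 0" using insert.IH insert.prems by blast
  ultimately obtain z where "f x z * (\<Prod>i\<in>F. f i z) \<noteq> 0"
    using mult_nonzero[of "f x" "\<lambda>z. \<Prod>i\<in>F. f i z"] prod_closed[of F f] insert.prems by auto
  then show ?case using insert.hyps by auto
qed simp

text \<open>Fraction-free Gaussian elimination, by induction on the coordinates. With a pivot
  \<open>v i0 k\<close>, the vectors \<open>w i\<close> have vanishing \<open>k\<close>-th
  coordinate; a relation among them pulls back to the \<open>v i\<close> with the coefficients
  multiplied by the pivot, which preserves nontriviality because zeros are isolated.\<close>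

lemma linear_dependence:
  assumes "finite J" "finite I" "card J < card I" "\<And>i k. i \<in> I \<Longrightarrow> k \<in> J \<Longrightarrow> v i k \<in> \<R>"
  shows "\<exists>\<phi>. (\<forall>i\<in>I. \<phi> i \<in> \<R>) \<and> (\<exists>i\<in>I. \<exists>z. \<phi> i z \<noteq> 0) \<and>
     (\<forall>k\<in>J. \<forall>z. (\<Sum>i\<in>I. \<phi> i z * v i k z) = 0)"
  using assms
proof (induction J arbitrary: I v rule: finite_induct)
  case empty
  then obtain i where "i \<in> I" by (metis card.empty less_nat_zero_code ex_in_conv)
  then show ?case by (intro exI[of _ "\<lambda>_ _. 1"]) (auto intro: one)
next
  case (insert k J)
  show ?case
  proof (cases "\<exists>i\<in>I. \<exists>z. v i k z \<noteq> 0")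
    case False
    have "card J < card I" using insert.prems insert.hyps by simp
    then obtain \<phi> where "\<forall>i\<in>I. \<phi> i \<in> \<R>" "\<exists>i\<in>I. \<exists>z. \<phi> i z \<noteq> 0" "\<forall>k\<in>J. \<forall>z. (\<Sum>i\<in>I. \<phi> i z * v i k z) = 0"
      using insert.IH[of I v] insert.prems by auto
    with False show ?thesis by (intro exI[of _ \<phi>]) auto
  next
    case True
    then obtain i0 z0 where i0: "i0 \<in> I" "v i0 k z0 \<noteq> 0" by blast
    define I' where "I' = I - {i0}"
    have fI: "finite I'" "finite I" "i0 \<notin> I'" "I = insert i0 I'"
      using insert.prems i0 by (auto simp: I'_def)
    have vR: "v i k' \<in> \<R>" if "i \<in> I" "k' \<in> insert k J" for i k' using insert.prems(3) that .
    define w where "w i k' z = v i0 k z * v i k' z + - (v i k z * v i0 k' z)" for i k' z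
    have "w i k' \<in> \<R>" if "i \<in> I'" "k' \<in> J" for i k'
      unfolding w_def[abs_def] using that i0 by (intro plus uminus times vR) (auto simp: I'_def)
    moreover have "card J < card I'" using insert.prems insert.hyps i0 by (simp add: I'_def)
    ultimately obtain \<psi> where \<psi>: "\<forall>i\<in>I'. \<psi> i \<in> \<R>" "\<exists>i\<in>I'. \<exists>z. \<psi> i z \<noteq> 0"
        "\<forall>k\<in>J. \<forall>z. (\<Sum>i\<in>I'. \<psi> i z * w i k z) = 0"
      using insert.IH[of I' w] fI by blast
    define \<phi> where "\<phi> i = (if i = i0 then (\<lambda>z. - (\<Sum>i\<in>I'. \<psi> i z * v i k z)) else (\<lambda>z. \<psi> i z * v i0 k z))" for i
    have 1: "\<phi> i \<in> \<R>" if "i \<in> I" for i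
      unfolding \<phi>_def using \<psi>(1) i0 that fI by (auto intro!: uminus sum_closed times vR)
    obtain i1 z1 where i1: "i1 \<in> I'" "\<psi> i1 z1 \<noteq> 0" using \<psi>(2) by blast
    then obtain z where "\<psi> i1 z * v i0 k z \<noteq> 0"
      using mult_nonzero[of "\<psi> i1" "v i0 k"] \<psi>(1) vR[of i0 k] i0 by auto
    then have 2: "\<exists>i\<in>I. \<exists>z. \<phi> i z \<noteq> 0" using i1 fI by (auto simp: \<phi>_def)
    have s: "(\<Sum>i\<in>I. \<phi> i z * v i k' z) = (\<Sum>i\<in>I'. \<psi> i z * w i k' z)" for k' z
    proof -
      have "(\<Sum>i\<in>I'. \<phi> i z * v i k' z) = (\<Sum>i\<in>I'. \<psi> i z * v i0 k z * v i k' z)"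
        using fI by (intro sum.cong) (auto simp: \<phi>_def)
      then have "(\<Sum>i\<in>I. \<phi> i z * v i k' z) =
          (\<Sum>i\<in>I'. \<psi> i z * v i0 k z * v i k' z) - (\<Sum>i\<in>I'. \<psi> i z * v i k z) * v i0 k' z"
        using fI by (simp add: \<phi>_def)
      also have "\<dots> = (\<Sum>i\<in>I'. \<psi> i z * w i k' z)"
        unfolding sum_distrib_right sum_subtractf[symmetric]
        by (rule sum.cong) (auto simp: w_def algebra_simps)
      finally show ?thesis .
    qed
    have "(\<Sum>i\<in>I. \<phi> i z * v i k' z) = 0" if "k' \<in> insert k J" for k' z
    proof (cases "k' = k")
      case True
      show ?thesis unfolding s True by (simp add: w_def mult.commute)
    next
      case False
      then show ?thesis unfolding s using \<psi>(3) that by auto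
    qed
    then show ?thesis using 1 2 by blast
  qed
qed

text \<open>A relation among the given vectors and the unit vector at \<open>l\<close> exists by
  counting. Its coefficient at the unit vector cannot vanish identically, as it would then be a
  relation among independent vectors; up to sign it is \<open>\<psi>\<close>. The index
  \<open>None\<close> stands for the unit vector.\<close>

lemma unit_vector_combination:
  assumes "finite J" "finite I" "card I = card J" "\<And>i k. i \<in> I \<Longrightarrow> k \<in> J \<Longrightarrow> v i k \<in> \<R>"
    and indep: "\<And>\<phi>. (\<And>i. i \<in> I \<Longrightarrow> \<phi> i \<in> \<R>) \<Longrightarrow> (\<And>k z. k \<in> J \<Longrightarrow> (\<Sum>i\<in>I. \<phi> i z * v i k z) = 0)
      \<Longrightarrow> (\<And>i z. i \<in> I \<Longrightarrow> \<phi> i z = 0)"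
    and "l \<in> J"
  shows "\<exists>\<psi> \<phi>. \<psi> \<in> \<R> \<and> (\<exists>z. \<psi> z \<noteq> 0) \<and> (\<forall>i\<in>I. \<phi> i \<in> \<R>) \<and>
     (\<forall>k\<in>J. \<forall>z. (\<Sum>i\<in>I. \<phi> i z * v i k z) = (if k = l then \<psi> z else 0))"
proof -
  define w where "w i = (case i of Some i \<Rightarrow> v i | None \<Rightarrow> (\<lambda>k z. if k = l then 1 else 0))" for i
  define I' where "I' = insert None (Some ` I)"
  have fI: "finite I'" "None \<notin> Some ` I" using assms(2) by (auto simp: I'_def)
  have "card J < card I'" unfolding I'_def using assms(2,3) by (simp add: card_image)
  moreover have "w i k \<in> \<R>" if "i \<in> I'" "k \<in> J" for i k
    using that assms(4) zero one by (auto simp: w_def I'_def)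
  ultimately obtain \<phi> where \<phi>: "\<forall>i\<in>I'. \<phi> i \<in> \<R>" "\<exists>i\<in>I'. \<exists>z. \<phi> i z \<noteq> 0"
      "\<forall>k\<in>J. \<forall>z. (\<Sum>i\<in>I'. \<phi> i z * w i k z) = 0"
    using linear_dependence[OF assms(1) fI(1)] by blast
  have s: "(\<Sum>i\<in>I'. \<phi> i z * w i k z) = (if k = l then \<phi> None z else 0) + (\<Sum>i\<in>I. \<phi> (Some i) z * v i k z)" for k z
    unfolding I'_def using assms(2) fI(2) by (simp add: sum.reindex w_def)
  have rel: "(\<Sum>i\<in>I. \<phi> (Some i) z * v i k z) = (if k = l then - \<phi> None z else 0)" if "k \<in> J" for k z
    using \<phi>(3) that s[where k=k and z=z] by (auto simp: add_eq_0_iff)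
  have R: "\<phi> None \<in> \<R>" "\<And>i. i \<in> I \<Longrightarrow> \<phi> (Some i) \<in> \<R>" using \<phi>(1) by (auto simp: I'_def)
  have "\<exists>z. \<phi> None z \<noteq> 0"
  proof (rule ccontr)
    assume *: "\<not> (\<exists>z. \<phi> None z \<noteq> 0)"
    then have "\<phi> (Some i) z = 0" if "i \<in> I" for i z
      using indep[of "\<lambda>i. \<phi> (Some i)"] R rel that by auto
    then show False using \<phi>(2) * by (auto simp: I'_def)
  qed
  moreover define \<psi> \<eta> where "\<psi> z = - \<phi> None z" and "\<eta> i = \<phi> (Some i)" for i z
  ultimately have "\<exists>z. \<psi> z \<noteq> 0" by simp
  moreover have "\<psi> \<in> \<R>" unfolding \<psi>_def[abs_def] by (intro uminus R)
  moreover have "\<forall>i\<in>I. \<eta> i \<in> \<R>" using R(2) by (simp add: \<eta>_def)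
  moreover have "\<forall>k\<in>J. \<forall>z. (\<Sum>i\<in>I. \<eta> i z * v i k z) = (if k = l then \<psi> z else 0)"
    unfolding \<psi>_def \<eta>_def using rel by blast
  ultimately show ?thesis by blast
qed

text \<open>Passage to a common denominator: each combination is multiplied by the functions
  \<open>\<psi>\<close> belonging to the others.\<close>

lemma common_unit_vector_combination:
  assumes "finite S" "\<And>s. s \<in> S \<Longrightarrow> \<exists>\<psi> \<phi>. \<psi> \<in> \<R> \<and> (\<exists>z. \<psi> z \<noteq> 0) \<and> (\<forall>i\<in>I s. \<phi> i \<in> \<R>) \<and>
     (\<forall>k\<in>J. \<forall>z. (\<Sum>i\<in>I s. \<phi> i z * v i k z) = (if k = l s then \<psi> z else 0))"
  shows "\<exists>\<psi> \<phi>. \<psi> \<in> \<R> \<and> (\<exists>z. \<psi> z \<noteq> 0) \<and> (\<forall>s\<in>S. (\<forall>i\<in>I s. \<phi> s i \<in> \<R>) \<and>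
     (\<forall>k\<in>J. \<forall>z. (\<Sum>i\<in>I s. \<phi> s i z * v i k z) = (if k = l s then \<psi> z else 0)))"
proof -
  define Q where "Q s \<psi> \<phi> \<longleftrightarrow> \<psi> \<in> \<R> \<and> (\<exists>z. \<psi> z \<noteq> 0) \<and> (\<forall>i\<in>I s. \<phi> i \<in> \<R>) \<and>
     (\<forall>k\<in>J. \<forall>z. (\<Sum>i\<in>I s. \<phi> i z * v i k z) = (if k = l s then \<psi> z else 0))" for s \<psi> \<phi>
  have "\<exists>p. Q s (fst p) (snd p)" if s: "s \<in> S" for s
  proof -
    obtain \<psi> \<phi> where "Q s \<psi> \<phi>" using assms(2)[OF s] unfolding Q_def by blast
    then show ?thesis by (intro exI[of _ "(\<psi>, \<phi>)"]) simp
  qed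
  then obtain p where p: "\<And>s. s \<in> S \<Longrightarrow> Q s (fst (p s)) (snd (p s))"
    using bchoice[of S "\<lambda>s p. Q s (fst p) (snd p)"] by blast
  define \<psi> \<phi> where "\<psi> s = fst (p s)" and "\<phi> s = snd (p s)" for s
  have *: "\<psi> s \<in> \<R> \<and> (\<exists>z. \<psi> s z \<noteq> 0) \<and> (\<forall>i\<in>I s. \<phi> s i \<in> \<R>) \<and>
     (\<forall>k\<in>J. \<forall>z. (\<Sum>i\<in>I s. \<phi> s i z * v i k z) = (if k = l s then \<psi> s z else 0))" if "s \<in> S" for s
    using p[OF that] unfolding Q_def \<psi>_def \<phi>_def .
  define \<Psi> where "\<Psi> z = (\<Prod>s\<in>S. \<psi> s z)" for z
  define \<Phi> where "\<Phi> s i z = (\<Prod>t\<in>S-{s}. \<psi> t z) * \<phi> s i z" for s i z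
  have "\<Psi> \<in> \<R>" unfolding \<Psi>_def[abs_def] using * by (intro prod_closed) auto
  moreover have "\<exists>z. \<Psi> z \<noteq> 0" unfolding \<Psi>_def using * by (intro prod_nonzero assms) auto
  moreover have "\<Phi> s i \<in> \<R>" if "s \<in> S" "i \<in> I s" for s i
    unfolding \<Phi>_def[abs_def] using * that by (intro times prod_closed) auto
  moreover have "(\<Sum>i\<in>I s. \<Phi> s i z * v i k z) = (if k = l s then \<Psi> z else 0)" if "s \<in> S" "k \<in> J" for s k z
  proof -
    have "(\<Sum>i\<in>I s. \<Phi> s i z * v i k z) = (\<Prod>t\<in>S-{s}. \<psi> t z) * (\<Sum>i\<in>I s. \<phi> s i z * v i k z)"
      by (simp add: \<Phi>_def sum_distrib_left mult.assoc)
    also have "\<dots> = (if k = l s then \<Psi> z else 0)"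
      using * that prod.remove[OF assms(1) that(1), of "\<lambda>t. \<psi> t z"] by (simp add: \<Psi>_def mult.commute)
    finally show ?thesis .
  qed
  ultimately show ?thesis by blast
qed

end

section \<open>The characteristic of a curve tends to infinity\<close>

lemma log_plus_eq: "max 0 (ln (norm w)) = ln (max 1 (norm (w :: complex)))"
  by (cases "w = 0"; cases "norm w \<le> 1") (auto simp: max_def)

lemma continuous_log_plus:
  assumes "f holomorphic_on UNIV"
  shows "continuous_on S (\<lambda>z. max 0 (ln (norm (f z))))"
  unfolding log_plus_eq
  by (intro continuous_intros holomorphic_on_imp_continuous_on holomorphic_on_subset[OF assms]) auto

lemma has_circle_mean_log_plus:
  assumes "f holomorphic_on UNIV" "0 \<le> r"
  shows "has_circle_mean (\<lambda>z. max 0 (ln (norm (f z)))) r (nevanlinna_char f r)"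
  unfolding nevanlinna_char_entire[OF assms(1)]
  by (rule continuous_has_circle_mean[OF continuous_log_plus[OF assms(1)] assms(2)])

lemma nevanlinna_char_entire_nonneg:
  assumes "f holomorphic_on UNIV" "0 \<le> r"
  shows "0 \<le> nevanlinna_char f r"
  by (rule has_circle_mean_mono[OF has_circle_mean_const has_circle_mean_log_plus[OF assms] assms(2)]) simp

context holomorphic_curve
begin

text \<open>The easy half of the first main theorem: Jensen's formula, combined with the mean of an
  upper bound for \<open>ln (norm h)\<close>.\<close>

lemma zero_count_le:
  assumes "h holomorphic_on UNIV" "h z0 \<noteq> 0" "\<And>z. norm (h z) \<le> exp (logmax z + \<alpha> z)"
    "continuous_on (sphere 0 r) \<alpha>" "0 < r"
  shows "zero_count h r \<le> T r + logmax 0 + circle_mean \<alpha> r - log_lead h"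
proof -
  have "log_lead h + zero_count h r \<le> T r + logmax 0 + circle_mean \<alpha> r"
  proof (rule has_circle_mean_mono_finite[OF jensen[OF assms(1,2,5)] _ assms(5) finite_zeros_cball[OF assms(1,2)]])
    show "has_circle_mean (\<lambda>z. logmax z + \<alpha> z) r (T r + logmax 0 + circle_mean \<alpha> r)"
      by (intro has_circle_mean_add has_circle_mean_logmax continuous_has_circle_mean assms(4))
         (use assms(5) in auto)
    fix z assume "norm z = r" "z \<notin> {a\<in>cball 0 r. h a = 0}"
    then have "0 < norm (h z)" by auto
    then show "ln (norm (h z)) \<le> logmax z + \<alpha> z"
      using assms(3)[of z] by (metis ln_exp ln_mono)
  qed
  then show ?thesis by simp
qed

text \<open>If \<open>T\<close> were bounded, every combination of two coordinates that is nonzero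
  at 0 would have bounded counting function and so no zero at all. Letting the combination vary then
  forces a constant ratio of the two coordinates, against their independence. Two coordinates exist
  because \<open>1 \<le> n\<close>.\<close>

lemma filterlim_T:
  assumes "1 \<le> n" "lin_indep_functions (periodic_field c) {0..n} g"
  shows "filterlim T at_top at_top"
proof (rule ccontr)
  assume "\<not> filterlim T at_top at_top"
  then obtain M where M: "\<not> eventually (\<lambda>r. M \<le> T r) at_top"
    unfolding filterlim_at_top by blast
  have bd: "T r \<le> M" if "1 \<le> r" for r
  proof (rule ccontr)
    assume nb: "\<not> T r \<le> M"
    have "eventually (\<lambda>s. M \<le> T s) at_top"
      by (rule eventually_mono[OF eventually_ge_at_top[of r]]) (use T_mono[of r] that nb in force)
    with M show False by simp
  qed
  obtain m where m: "m \<le> n" "norm (g m 0) = exp (logmax 0)" by (rule logmax_attained)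
  define k where "k = (if m = 0 then 1 else 0 :: nat)"
  have k: "k \<le> n" "k \<noteq> m" using assms(1) by (auto simp: k_def)
  have nz: "\<gamma> * g k z - \<beta> * g m z \<noteq> 0" if "\<gamma> * g k 0 - \<beta> * g m 0 \<noteq> 0" for \<beta> \<gamma> z
  proof -
    have hol': "(\<lambda>z. \<gamma> * g k z - \<beta> * g m z) holomorphic_on UNIV"
      by (intro holomorphic_intros hol k m)
    have pos: "0 < 1 + norm \<gamma> + norm \<beta>" by (intro add_pos_nonneg) auto
    have le: "norm (\<gamma> * g k z - \<beta> * g m z) \<le> exp (logmax z + ln (1 + norm \<gamma> + norm \<beta>))" for z
    proof -
      have "norm (\<gamma> * g k z - \<beta> * g m z) \<le> norm \<gamma> * norm (g k z) + norm \<beta> * norm (g m z)"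
        by (metis norm_mult norm_triangle_ineq4)
      also have "\<dots> \<le> norm \<gamma> * exp (logmax z) + norm \<beta> * exp (logmax z)"
        by (intro add_mono mult_left_mono norm_le_logmax k m) auto
      also have "\<dots> \<le> exp (logmax z + ln (1 + norm \<gamma> + norm \<beta>))"
        using pos by (simp add: exp_add algebra_simps)
      finally show ?thesis .
    qed
    have cm: "circle_mean (\<lambda>_. ln (1 + norm \<gamma> + norm \<beta>)) r = ln (1 + norm \<gamma> + norm \<beta>)" for r
      by (rule has_circle_mean_imp_eq[OF has_circle_mean_const])
    have "zero_count (\<lambda>z. \<gamma> * g k z - \<beta> * g m z) r \<le>
        M + logmax 0 + ln (1 + norm \<gamma> + norm \<beta>) - log_lead (\<lambda>z. \<gamma> * g k z - \<beta> * g m z)" if "1 \<le> r" for r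
      using zero_count_le[OF hol' \<open>\<gamma> * g k 0 - \<beta> * g m 0 \<noteq> 0\<close> le, of r] bd[OF that] that cm[of r]
      by simp
    then show ?thesis by (rule zero_count_bounded_imp_no_zeros[OF hol' that])
  qed
  have gm0: "g m 0 \<noteq> 0" using m by (metis exp_not_eq_zero norm_zero)
  have gm: "g m z \<noteq> 0" for z
    using nz[of 0 "-1" z] gm0 by simp
  define \<beta> where "\<beta> = g k 0 / g m 0"
  have eq: "g k z - \<beta> * g m z = 0" for z
  proof (rule ccontr)
    assume "g k z - \<beta> * g m z \<noteq> 0"
    then have "g k z / g m z \<noteq> \<beta>" using gm[of z] by (simp add: field_simps)
    \<comment> \<open>The coefficient is the value of the ratio at \<open>z\<close>, so this
      combination vanishes at \<open>z\<close> although it does not vanish at 0.\<close>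
    then have "1 * g k 0 - g k z / g m z * g m 0 \<noteq> 0" using gm0 by (simp add: \<beta>_def field_simps)
    from nz[OF this, of z] show False using gm[of z] by simp
  qed
  define \<phi> where "\<phi> i = (\<lambda>_::complex. if i = k then 1 else if i = m then - \<beta> else 0)" for i :: nat
  have "(\<Sum>i\<in>{0..n}. \<phi> i z * g i z) = 0" for z
  proof -
    have "(\<Sum>i\<in>{0..n}. \<phi> i z * g i z) = (\<Sum>i\<in>{k, m}. \<phi> i z * g i z)"
      by (rule sum.mono_neutral_right) (use k m in \<open>auto simp: \<phi>_def\<close>)
    also have "\<dots> = 0" using k eq[of z] by (simp add: \<phi>_def)
    finally show ?thesis .
  qed
  moreover have "\<phi> i \<in> periodic_field c" for i
    unfolding \<phi>_def by (rule const_in_periodic_field)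
  ultimately have "\<forall>i\<in>{0..n}. \<forall>z. \<phi> i z = 0"
    using assms(2) unfolding lin_indep_functions_def by (auto intro!: always_eventually)
  then have "\<phi> k 0 = 0" using k by simp
  then show False by (simp add: \<phi>_def)
qed

end

section \<open>Small periodic functions\<close>

lemma log_plus_add_le:
  "max 0 (ln (norm (a + b :: complex))) \<le> ln 2 + (max 0 (ln (norm a)) + max 0 (ln (norm b)))"
proof -
  define x y where "x = max 1 (norm a)" and "y = max 1 (norm b)"
  have xy: "1 \<le> x" "1 \<le> y" "norm a \<le> x" "norm b \<le> y" by (auto simp: x_def y_def)
  have "x + y \<le> 2 * (x * y)"
  proof -
    have "x * 1 \<le> x * y" "1 * y \<le> x * y" using xy by (intro mult_mono; simp)+
    then show ?thesis by simp
  qed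
  moreover have "norm (a + b) \<le> norm a + norm b" by (rule norm_triangle_ineq)
  ultimately have "max 1 (norm (a + b)) \<le> 2 * (x * y)" using xy by linarith
  then have "ln (max 1 (norm (a + b))) \<le> ln (2 * (x * y))" by (intro ln_mono) auto
  also have "\<dots> = ln 2 + (ln x + ln y)" using xy by (simp add: ln_mult)
  finally show ?thesis unfolding log_plus_eq x_def y_def .
qed

lemma log_plus_mult_le:
  "max 0 (ln (norm (a * b :: complex))) \<le> max 0 (ln (norm a)) + max 0 (ln (norm b))"
proof -
  define x y where "x = max 1 (norm a)" and "y = max 1 (norm b)"
  have xy: "1 \<le> x" "1 \<le> y" "norm a \<le> x" "norm b \<le> y" by (auto simp: x_def y_def)
  have "1 * 1 \<le> x * y" "norm a * norm b \<le> x * y" using xy by (intro mult_mono; simp)+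
  then have "max 1 (norm (a * b)) \<le> x * y" by (simp add: norm_mult)
  then have "ln (max 1 (norm (a * b))) \<le> ln (x * y)" by (intro ln_mono) auto
  also have "\<dots> = ln x + ln y" using xy by (simp add: ln_mult)
  finally show ?thesis unfolding log_plus_eq x_def y_def .
qed

lemma nevanlinna_char_add_le:
  assumes "f holomorphic_on UNIV" "h holomorphic_on UNIV" "0 \<le> r"
  shows "nevanlinna_char (\<lambda>z. f z + h z) r \<le> ln 2 + (nevanlinna_char f r + nevanlinna_char h r)"
  by (rule has_circle_mean_mono[OF has_circle_mean_log_plus has_circle_mean_add[OF has_circle_mean_const has_circle_mean_add[OF has_circle_mean_log_plus has_circle_mean_log_plus]]])
     (use assms log_plus_add_le in \<open>auto intro!: holomorphic_intros\<close>)

lemma nevanlinna_char_mult_le: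
  assumes "f holomorphic_on UNIV" "h holomorphic_on UNIV" "0 \<le> r"
  shows "nevanlinna_char (\<lambda>z. f z * h z) r \<le> nevanlinna_char f r + nevanlinna_char h r"
  by (rule has_circle_mean_mono[OF has_circle_mean_log_plus has_circle_mean_add[OF has_circle_mean_log_plus has_circle_mean_log_plus]])
     (use assms log_plus_mult_le in \<open>auto intro!: holomorphic_intros\<close>)

lemma nevanlinna_char_const: "nevanlinna_char (\<lambda>_. k) r = max 0 (ln (norm k))"
  by (subst nevanlinna_char_entire) (auto intro!: has_circle_mean_imp_eq has_circle_mean_const)

lemma nevanlinna_char_uminus: "f holomorphic_on UNIV \<Longrightarrow> nevanlinna_char (\<lambda>z. - f z) = nevanlinna_char f"
  by (rule ext) (simp add: nevanlinna_char_entire holomorphic_on_minus)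

lemma smallo_dominated:
  fixes f h k :: "real \<Rightarrow> real"
  assumes "h \<in> o[F](k)" "eventually (\<lambda>r. 0 \<le> f r \<and> f r \<le> h r) F"
  shows "f \<in> o[F](k)"
proof (rule landau_o.big_small_trans[OF _ assms(1)])
  show "f \<in> O[F](h)"
    using assms(2) by (intro bigoI[of _ 1]) (auto elim!: eventually_mono)
qed

section \<open>The ring of small periodic functions\<close>

locale periodic_setting = holomorphic_curve +
  fixes c :: complex and \<sigma> :: real
  assumes T_lim: "filterlim T at_top at_top"
    and \<sigma>: "0 < \<sigma>" "\<sigma> < 1" "eventually (\<lambda>r. ln (T r) \<le> r powr \<sigma>) at_top"
begin

lemma const_smallo: "(\<lambda>_. k) \<in> o[at_top](T)"
proof -
  have "(\<lambda>_. k) \<in> O[at_top](\<lambda>_. 1 :: real)" by simp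
  moreover have "(\<lambda>_. 1 :: real) \<in> o[at_top](T)"
  proof (rule landau_o.smallI)
    fix e :: real assume e: "0 < e"
    have "eventually (\<lambda>r. max 1 (1 / e) \<le> T r) at_top" using T_lim unfolding filterlim_at_top by blast
    then show "eventually (\<lambda>r. norm (1 :: real) \<le> e * norm (T r)) at_top"
      by eventually_elim (use e in \<open>auto simp: field_simps\<close>)
  qed
  ultimately show ?thesis by (rule landau_o.big_small_trans)
qed

text \<open>The ring in which the elimination takes place. Smallness relative to \<open>T\<close> is
  imposed instead of a bound on the hyper-order because it is what the final error terms require;
  membership in \<open>periodic_field\<close> follows after multiplication by a constant.\<close>

definition small :: "(complex \<Rightarrow> complex) set" where
  "small = {f. f holomorphic_on UNIV \<and> (\<forall>z. f (z + c) = f z) \<and> nevanlinna_char f \<in> o[at_top](T)}"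

lemma smallI:
  assumes "f holomorphic_on UNIV" "\<And>z. f (z + c) = f z" "h \<in> o[at_top](T)"
    "eventually (\<lambda>r. nevanlinna_char f r \<le> h r) at_top"
  shows "f \<in> small"
proof -
  have "nevanlinna_char f \<in> o[at_top](T)"
    by (rule smallo_dominated[OF assms(3)])
       (use assms(4) eventually_ge_at_top[of 0] in eventually_elim,
        use nevanlinna_char_entire_nonneg[OF assms(1)] in auto)
  then show ?thesis using assms(1,2) by (simp add: small_def)
qed

lemma small_periodic: "f \<in> small \<Longrightarrow> f (z + of_nat j * c) = f z"
proof (induction j)
  case (Suc j)
  have "f (z + of_nat j * c + c) = f (z + of_nat j * c)" using Suc.prems by (simp add: small_def)
  then show ?case using Suc by (simp add: algebra_simps)
qed simp

lemma const_small: "(\<lambda>_. k) \<in> small"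
  by (rule smallI[OF _ _ const_smallo[of "max 0 (ln (norm k))"]]) (auto simp: nevanlinna_char_const)

sublocale small: entire_ring small
proof
  show "(\<lambda>_. 0) \<in> small" "(\<lambda>_. 1) \<in> small" by (rule const_small)+
  show "f holomorphic_on UNIV" if "f \<in> small" for f using that by (simp add: small_def)
  show "(\<lambda>z. - f z) \<in> small" if "f \<in> small" for f
    using that by (auto simp: small_def nevanlinna_char_uminus intro!: holomorphic_intros)
  fix f h assume fh: "f \<in> small" "h \<in> small"
  have hol: "f holomorphic_on UNIV" "h holomorphic_on UNIV" using fh by (auto simp: small_def)
  show "(\<lambda>z. f z + h z) \<in> small"
  proof (rule smallI)
    show "(\<lambda>r. ln 2 + (nevanlinna_char f r + nevanlinna_char h r)) \<in> o[at_top](T)"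
      using fh by (intro sum_in_smallo const_smallo) (auto simp: small_def)
    show "eventually (\<lambda>r. nevanlinna_char (\<lambda>z. f z + h z) r \<le> ln 2 + (nevanlinna_char f r + nevanlinna_char h r)) at_top"
      using eventually_ge_at_top[of 0] by eventually_elim (rule nevanlinna_char_add_le[OF hol])
  qed (use fh hol in \<open>auto simp: small_def intro!: holomorphic_intros\<close>)
  show "(\<lambda>z. f z * h z) \<in> small"
  proof (rule smallI)
    show "(\<lambda>r. nevanlinna_char f r + nevanlinna_char h r) \<in> o[at_top](T)"
      using fh by (intro sum_in_smallo) (auto simp: small_def)
    show "eventually (\<lambda>r. nevanlinna_char (\<lambda>z. f z * h z) r \<le> nevanlinna_char f r + nevanlinna_char h r) at_top"
      using eventually_ge_at_top[of 0] by eventually_elim (rule nevanlinna_char_mult_le[OF hol])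
  qed (use fh hol in \<open>auto simp: small_def intro!: holomorphic_intros\<close>)
qed

text \<open>The library has \<open>ln x = ln \<bar>x\<bar>\<close>, so a bound on the hyper-order needs a characteristic
  that stays away from 0. This is achieved by multiplication with a large constant.\<close>

lemma small_scaled_in_periodic_field:
  assumes "f \<in> small" "f z0 \<noteq> 0" "exp (1 - log_lead f) \<le> \<Lambda>"
  shows "(\<lambda>z. of_real \<Lambda> * f z) \<in> periodic_field c"
proof -
  define h where "h z = of_real \<Lambda> * f z" for z
  have \<Lambda>: "0 < \<Lambda>" using assms(3) by (rule less_le_trans[OF exp_gt_zero])
  have "h \<in> small" unfolding h_def[abs_def] by (intro small.times const_small assms(1))
  then have hol: "h holomorphic_on UNIV" and per: "h (z + c) = h z" and sm: "nevanlinna_char h \<in> o[at_top](T)" for z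
    by (auto simp: small_def)
  have ll: "ln (norm (h z)) = ln \<Lambda> + ln (norm (f z))" if "f z \<noteq> 0" for z
    using \<Lambda> that by (simp add: h_def norm_mult ln_mult)
  have lower: "1 \<le> nevanlinna_char h r" if r: "1 \<le> r" for r
  proof -
    \<comment> \<open>The positive part of the logarithm dominates the logarithm, whose mean is
      given by Jensen; \<open>\<Lambda>\<close> is calibrated so that this lower bound is at least
      1.\<close>
    have "ln \<Lambda> + (log_lead f + zero_count f r) \<le> nevanlinna_char h r"
    proof (rule has_circle_mean_mono_finite)
      show "has_circle_mean (\<lambda>z. ln \<Lambda> + ln (norm (f z))) r (ln \<Lambda> + (log_lead f + zero_count f r))"
        by (intro has_circle_mean_add has_circle_mean_const jensen[OF small.holomorphic[OF assms(1)] assms(2)])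
           (use r in auto)
      show "has_circle_mean (\<lambda>z. max 0 (ln (norm (h z)))) r (nevanlinna_char h r)"
        by (rule has_circle_mean_log_plus[OF hol]) (use r in auto)
      show "finite {a\<in>cball 0 r. f a = 0}"
        by (rule finite_zeros_cball[OF small.holomorphic[OF assms(1)] assms(2)])
    qed (use r ll in auto)
    moreover have "ln (exp (1 - log_lead f)) \<le> ln \<Lambda>" using assms(3) by (intro ln_mono) auto
    moreover have "0 \<le> zero_count f r" by (rule zero_count_nonneg[OF r])
    ultimately show ?thesis by simp
  qed
  have "hyper_order (nevanlinna_char h) < 1"
  proof (rule hyper_order_less_oneI[OF \<sigma>(2) _ \<sigma>(1)])
    have "eventually (\<lambda>r. norm (nevanlinna_char h r) \<le> 1 * norm (T r)) at_top"
      by (rule landau_o.smallD[OF sm]) simp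
    then show "eventually (\<lambda>r. 1 \<le> nevanlinna_char h r \<and> ln (nevanlinna_char h r) \<le> r powr \<sigma>) at_top"
      using eventually_ge_at_top[of 1] \<sigma>(3)
    proof eventually_elim
      case (elim r)
      have "nevanlinna_char h r \<le> T r" using elim(1) lower[OF elim(2)] T_nonneg[of r] elim(2) by auto
      then have "ln (nevanlinna_char h r) \<le> ln (T r)" using lower[OF elim(2)] by (intro ln_mono) auto
      then show ?case using lower[OF elim(2)] elim(3) by simp
    qed
  qed
  moreover have "h analytic_on UNIV" using hol by (simp add: analytic_on_open)
  ultimately show ?thesis
    using per unfolding periodic_field_def h_def[symmetric]
    by (auto intro: analytic_on_imp_nicely_meromorphic_on)
qed

text \<open>One constant for the whole family, so that a linear relation survives the
  scaling.\<close>

lemma small_family_scaled: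
  assumes "finite I" "\<And>i. i \<in> I \<Longrightarrow> \<phi> i \<in> small"
  obtains \<Lambda> :: real where "0 < \<Lambda>" "\<And>i. i \<in> I \<Longrightarrow> (\<lambda>z. of_real \<Lambda> * \<phi> i z) \<in> periodic_field c"
proof
  define \<Lambda> where "\<Lambda> = 1 + (\<Sum>i\<in>I. exp (1 - log_lead (\<phi> i)))"
  have s: "0 \<le> (\<Sum>i\<in>I. exp (1 - log_lead (\<phi> i)))" by (intro sum_nonneg) auto
  then show "0 < \<Lambda>" by (simp add: \<Lambda>_def)
  show "(\<lambda>z. of_real \<Lambda> * \<phi> i z) \<in> periodic_field c" if "i \<in> I" for i
  proof (cases "\<exists>z. \<phi> i z \<noteq> 0")
    case True
    have "exp (1 - log_lead (\<phi> i)) \<le> (\<Sum>i\<in>I. exp (1 - log_lead (\<phi> i)))"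
      by (rule member_le_sum[OF that]) (use assms in auto)
    then have "exp (1 - log_lead (\<phi> i)) \<le> \<Lambda>" by (simp add: \<Lambda>_def)
    with True show ?thesis using small_scaled_in_periodic_field[OF assms(2)[OF that]] by blast
  next
    case False
    then show ?thesis using const_in_periodic_field[of 0 c] by simp
  qed
qed

text \<open>For each choice \<open>I\<close> of \<open>n + 1\<close> hyperplanes the functions
  \<open>\<phi> (I, k)\<close> form the inverse of the coefficient matrix multiplied by
  \<open>\<psi>\<close>. A relation over \<open>small\<close> becomes one over the periodic field
  after scaling, which is how general position enters. The single \<open>\<psi>\<close> serves all
  \<open>I\<close> and \<open>k\<close>.\<close>

lemma common_inverse:
  assumes a: "\<And>j k. j \<in> {0..q} \<Longrightarrow> k \<in> {0..n} \<Longrightarrow> a j k \<in> small"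
    and gp: "general_position (periodic_field c) n q a"
  obtains \<psi> \<phi> where "\<psi> \<in> small" "\<exists>z. \<psi> z \<noteq> 0"
    "\<And>I k i. I \<subseteq> {0..q} \<Longrightarrow> card I = n + 1 \<Longrightarrow> k \<in> {0..n} \<Longrightarrow> i \<in> I \<Longrightarrow> \<phi> (I, k) i \<in> small"
    "\<And>I k l z. I \<subseteq> {0..q} \<Longrightarrow> card I = n + 1 \<Longrightarrow> k \<in> {0..n} \<Longrightarrow> l \<in> {0..n} \<Longrightarrow>
       (\<Sum>i\<in>I. \<phi> (I, k) i z * a i l z) = (if l = k then \<psi> z else 0)"
proof -
  define S where "S = {I. I \<subseteq> {0..q} \<and> card I = n + 1} \<times> {0..n}"
  have "finite S" unfolding S_def by (rule finite_cartesian_product) (auto intro: finite_subset[of _ "Pow {0..q}"])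
  moreover have "\<exists>\<psi> \<phi>. \<psi> \<in> small \<and> (\<exists>z. \<psi> z \<noteq> 0) \<and> (\<forall>i\<in>fst s. \<phi> i \<in> small) \<and>
     (\<forall>k\<in>{0..n}. \<forall>z. (\<Sum>i\<in>fst s. \<phi> i z * a i k z) = (if k = snd s then \<psi> z else 0))" if s: "s \<in> S" for s
  proof (rule small.unit_vector_combination)
    have I: "fst s \<subseteq> {0..q}" "card (fst s) = n + 1" "snd s \<in> {0..n}" using s by (auto simp: S_def)
    show fin: "finite (fst s)" by (rule finite_subset[OF I(1)]) simp
    show "card (fst s) = card {0..n}" "snd s \<in> {0..n}" using I by auto
    show "a i k \<in> small" if "i \<in> fst s" "k \<in> {0..n}" for i k using a I that by blast
    fix \<phi> i z
    assume \<phi>: "\<And>i. i \<in> fst s \<Longrightarrow> \<phi> i \<in> small"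
      and rel: "\<And>k z. k \<in> {0..n} \<Longrightarrow> (\<Sum>i\<in>fst s. \<phi> i z * a i k z) = 0" and i: "i \<in> fst s"
    obtain \<Lambda> :: real where \<Lambda>: "0 < \<Lambda>" "\<And>i. i \<in> fst s \<Longrightarrow> (\<lambda>z. of_real \<Lambda> * \<phi> i z) \<in> periodic_field c"
      using small_family_scaled[OF fin, of \<phi>] \<phi> by blast
    have li: "lin_indep_vectors (periodic_field c) (fst s) {0..n} a"
      using gp I by (auto simp: general_position_def)
    have "(\<Sum>i\<in>fst s. of_real \<Lambda> * \<phi> i z * a i k z) = 0" if "k \<in> {0..n}" for k z
      using rel[OF that, of z] by (simp add: mult.assoc sum_distrib_left[symmetric])
    then have "\<forall>i\<in>fst s. \<forall>z. of_real \<Lambda> * \<phi> i z = 0"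
      using li[unfolded lin_indep_vectors_def, rule_format, of "\<lambda>i z. of_real \<Lambda> * \<phi> i z"] \<Lambda>(2)
      by (auto intro!: always_eventually)
    then show "\<phi> i z = 0" using i \<Lambda>(1) by simp
  qed simp
  ultimately obtain \<psi> \<phi> where *: "\<psi> \<in> small" "\<exists>z. \<psi> z \<noteq> 0" "\<And>s. s \<in> S \<Longrightarrow> (\<forall>i\<in>fst s. \<phi> s i \<in> small) \<and>
     (\<forall>k\<in>{0..n}. \<forall>z. (\<Sum>i\<in>fst s. \<phi> s i z * a i k z) = (if k = snd s then \<psi> z else 0))"
    using small.common_unit_vector_combination[of S fst "{0..n}" a snd] by blast
  show ?thesis
  proof (rule that[OF *(1,2)])
    fix I k assume I: "I \<subseteq> {0..q}" "card I = n + 1" "k \<in> {0..n}"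
    then have s: "(I, k) \<in> S" by (auto simp: S_def)
    show "\<phi> (I, k) i \<in> small" if "i \<in> I" for i using *(3)[OF s] that by auto
    show "(\<Sum>i\<in>I. \<phi> (I, k) i z * a i l z) = (if l = k then \<psi> z else 0)" if "l \<in> {0..n}" for l z
      using *(3)[OF s] that by simp
  qed
qed

end

section \<open>Quotients of entire functions\<close>

lemma entire_imp_analytic:
  assumes "f holomorphic_on UNIV"
  shows "f analytic_on A"
  by (rule analytic_on_subset[of _ UNIV]) (use assms in \<open>auto simp: analytic_on_open\<close>)

text \<open>\<open>ln (norm F)\<close> is bounded above on the circle, and a nonnegative integrable
  function is absolutely integrable. Absolute integrability, unlike mere gauge integrability, is
  preserved when a maximum with 0 is taken.\<close>

lemma absolutely_integrable_ln_norm: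
  assumes "F holomorphic_on UNIV" "F z0 \<noteq> 0" "0 < r"
  shows "(\<lambda>\<theta>. ln (norm (F (of_real r * cis \<theta>)))) absolutely_integrable_on {0..2*pi}"
proof -
  have "compact (F ` sphere 0 r)"
    by (intro compact_continuous_image holomorphic_on_imp_continuous_on holomorphic_on_subset[OF assms(1)]) auto
  then have "bounded (F ` sphere 0 r)" by (rule compact_imp_bounded)
  then obtain B where "\<forall>x\<in>F ` sphere 0 r. norm x \<le> B" unfolding bounded_iff by blast
  then have B: "norm (F z) \<le> B" if "norm z = r" for z using that by auto
  define M where "M = ln (max 1 B)"
  have le: "ln (norm (F z)) \<le> M" if "norm z = r" for z
  proof (cases "F z = 0")
    case False
    then show ?thesis unfolding M_def using B[OF that] by (intro ln_mono) auto
  qed (simp add: M_def)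
  have "(\<lambda>\<theta>. M - ln (norm (F (of_real r * cis \<theta>)))) integrable_on {0..2*pi}"
    using has_circle_mean_diff[OF has_circle_mean_const jensen[OF assms]]
    unfolding has_circle_mean_def by (rule has_integral_integrable)
  then have "(\<lambda>\<theta>. M - ln (norm (F (of_real r * cis \<theta>)))) absolutely_integrable_on {0..2*pi}"
    by (rule nonnegative_absolutely_integrable_1) (use le assms(3) in \<open>auto simp: norm_mult\<close>)
  moreover have "(\<lambda>\<theta>::real. M) absolutely_integrable_on {0..2*pi}"
    by (intro absolutely_integrable_continuous_real continuous_intros)
  ultimately have "(\<lambda>\<theta>. M - (M - ln (norm (F (of_real r * cis \<theta>))))) absolutely_integrable_on {0..2*pi}"
    by (rule set_integral_diff(1)[rotated])
  then show ?thesis by simp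
qed

lemma has_circle_mean_log_plus_quotient:
  assumes h: "h holomorphic_on UNIV" "h z0 \<noteq> 0" and k: "k holomorphic_on UNIV" "k z1 \<noteq> 0" and r: "0 < r"
  obtains X where "has_circle_mean (\<lambda>z. max 0 (b + (ln (norm (h z)) - ln (norm (k z))))) r X"
proof -
  have "(\<lambda>\<theta>::real. b) absolutely_integrable_on {0..2*pi}"
    by (intro absolutely_integrable_continuous_real continuous_intros)
  moreover have "(\<lambda>\<theta>. ln (norm (h (of_real r * cis \<theta>))) - ln (norm (k (of_real r * cis \<theta>)))) absolutely_integrable_on {0..2*pi}"
    by (rule set_integral_diff(1)[OF absolutely_integrable_ln_norm[OF h r] absolutely_integrable_ln_norm[OF k r]])
  ultimately have "(\<lambda>\<theta>. b + (ln (norm (h (of_real r * cis \<theta>))) - ln (norm (k (of_real r * cis \<theta>))))) absolutely_integrable_on {0..2*pi}"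
    by (rule set_integral_add(1))
  moreover have "(\<lambda>\<theta>::real. 0::real) absolutely_integrable_on {0..2*pi}"
    by (intro absolutely_integrable_continuous_real continuous_intros)
  ultimately have "(\<lambda>\<theta>. max 0 (b + (ln (norm (h (of_real r * cis \<theta>))) - ln (norm (k (of_real r * cis \<theta>)))))) absolutely_integrable_on {0..2*pi}"
    by (rule absolutely_integrable_max_1[rotated])
  then have "(\<lambda>\<theta>. max 0 (b + (ln (norm (h (of_real r * cis \<theta>))) - ln (norm (k (of_real r * cis \<theta>)))))) integrable_on {0..2*pi}"
    using absolutely_integrable_on_def by blast
  then obtain Y where "((\<lambda>\<theta>. max 0 (b + (ln (norm (h (of_real r * cis \<theta>))) - ln (norm (k (of_real r * cis \<theta>)))))) has_integral (2 * pi * (Y / (2 * pi)))) {0..2*pi}"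
    by (auto simp: integrable_on_def)
  then show ?thesis by (intro that[of "Y / (2 * pi)"]) (simp only: has_circle_mean_def)
qed

text \<open>The pole order of \<open>h / k\<close> at a point is the positive part of
  \<open>zorder k - zorder h\<close>; it lies between this difference and \<open>zorder k\<close>,
  and the weights are nonnegative for \<open>1 \<le> r\<close>.\<close>

lemma quotient_pole_counting:
  assumes h: "h holomorphic_on UNIV" "h z0 \<noteq> 0" and k: "k holomorphic_on UNIV" "k z1 \<noteq> 0"
    and r: "1 \<le> r" and f: "f = remove_sings (\<lambda>z. h z / k z)"
  shows "zero_count k r - zero_count h r \<le> integrated_counting (pole_count f) r"
    and "integrated_counting (pole_count f) r \<le> zero_count k r"
proof -
  have mh: "h meromorphic_on A" and mk: "k meromorphic_on A" for A
    by (intro analytic_on_imp_meromorphic_on entire_imp_analytic h k)+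
  have mq: "(\<lambda>z. h z / k z) meromorphic_on A" for A
    by (intro meromorphic_intros mh mk)
  have iso: "isolated_singularity_at (\<lambda>z. h z / k z) z" for z
    by (rule meromorphic_on_isolated_singularity[OF mq])
  have evh: "eventually (\<lambda>w. h w \<noteq> 0) (at z)" and evk: "eventually (\<lambda>w. k w \<noteq> 0) (at z)" for z
    by (rule eventually_nonzero_at[OF h], rule eventually_nonzero_at[OF k])
  have zo: "zorder f z = zorder h z - zorder k z" for z
  proof -
    have "frequently (\<lambda>w. h w \<noteq> 0) (at z)" "frequently (\<lambda>w. k w \<noteq> 0) (at z)"
      by (rule eventually_frequently[OF at_neq_bot evh], rule eventually_frequently[OF at_neq_bot evk])
    then have "zorder (\<lambda>w. h w / k w) z = zorder h z - zorder k z"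
      by (intro Meromorphic.zorder_divide mh mk)
    then show ?thesis unfolding f using zorder_remove_sings[OF iso] by simp
  qed
  have pole: "is_pole f z \<longleftrightarrow> zorder f z < 0" for z
  proof
    assume "is_pole f z"
    then show "zorder f z < 0" unfolding f using iso isolated_pole_imp_neg_zorder by auto
  next
    assume "zorder f z < 0"
    then have "zorder (\<lambda>z. h z / k z) z < 0" unfolding f using iso by simp
    moreover have "eventually (\<lambda>w. h w / k w \<noteq> 0) (at z)"
      using evh evk by eventually_elim auto
    ultimately have "is_pole (\<lambda>z. h z / k z) z" using zorder_neg_imp_is_pole[OF mq] by blast
    then show "is_pole f z" unfolding f using iso by simp
  qed
  have z0: "0 \<le> zorder F z" if "F holomorphic_on UNIV" "F w \<noteq> 0" for F z w
    using zorder_zero_pos[OF that, of z] zorder_nonzero[OF that(1), of z] by (cases "F z = 0") auto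
  define Pol where "Pol = {z. is_pole f z}"
  define p where "p a = nat (- zorder f a)" for a
  define Zk where "Zk = {a\<in>cball 0 r. k a = 0}"
  define Zh where "Zh = {a\<in>cball 0 r. h a = 0}"
  have fin: "finite Zk" "finite Zh"
    unfolding Zk_def Zh_def by (rule finite_zeros_cball[OF k], rule finite_zeros_cball[OF h])
  have polk: "k a = 0" if "a \<in> Pol" for a
  proof (rule ccontr)
    assume "k a \<noteq> 0"
    then show False using zorder_nonzero[OF k(1)] zo[of a] pole[of a] that z0[OF h, of a] by (auto simp: Pol_def)
  qed
  have sub: "Pol \<inter> cball 0 r \<subseteq> Zk" using polk by (auto simp: Zk_def)
  have pc: "pole_count f = (\<lambda>t. \<Sum>z\<in>Pol \<inter> cball 0 t. p z)"
    unfolding pole_count_def p_def Pol_def by (rule ext, rule sum.cong) auto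
  have N: "integrated_counting (pole_count f) r = (\<Sum>a\<in>Pol \<inter> cball 0 r. real (p a) * zero_weight r a)"
    unfolding pc by (rule integrated_counting_eq) (use finite_subset[OF sub fin(1)] r in auto)
  have zw: "0 \<le> zero_weight r a" if "a \<in> cball 0 r" for a using that by (intro zero_weight_nonneg r) auto
  show "integrated_counting (pole_count f) r \<le> zero_count k r"
  proof -
    have "(\<Sum>a\<in>Pol \<inter> cball 0 r. real (p a) * zero_weight r a) \<le> (\<Sum>a\<in>Pol \<inter> cball 0 r. real (nat (zorder k a)) * zero_weight r a)"
      by (intro sum_mono mult_right_mono zw) (use zo z0[OF h] in \<open>auto simp: p_def intro!: nat_mono\<close>)
    also have "\<dots> \<le> (\<Sum>a\<in>Zk. real (nat (zorder k a)) * zero_weight r a)"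
      by (rule sum_mono2[OF fin(1) sub]) (auto intro!: mult_nonneg_nonneg zw simp: Zk_def)
    finally show ?thesis unfolding N zero_count_def Zk_def .
  qed
  have ck: "zero_count k r = (\<Sum>a\<in>Zk \<union> Zh. real (nat (zorder k a)) * zero_weight r a)"
    unfolding zero_count_def Zk_def[symmetric]
    using fin by (intro sum.mono_neutral_left ballI) (auto simp: Zk_def Zh_def zorder_nonzero[OF k(1)])
  have ch: "zero_count h r = (\<Sum>a\<in>Zk \<union> Zh. real (nat (zorder h a)) * zero_weight r a)"
    unfolding zero_count_def Zh_def[symmetric]
    using fin by (intro sum.mono_neutral_left ballI) (auto simp: Zk_def Zh_def zorder_nonzero[OF h(1)])
  have "zero_count k r - zero_count h r = (\<Sum>a\<in>Zk \<union> Zh. (real (nat (zorder k a)) - real (nat (zorder h a))) * zero_weight r a)"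
    unfolding ck ch by (simp add: sum_subtractf left_diff_distrib)
  also have "\<dots> \<le> (\<Sum>a\<in>Zk \<union> Zh. (if a \<in> Pol then real (p a) else 0) * zero_weight r a)"
  proof (intro sum_mono mult_right_mono zw)
    fix a assume "a \<in> Zk \<union> Zh"
    then show "a \<in> cball 0 r" by (auto simp: Zk_def Zh_def)
    show "real (nat (zorder k a)) - real (nat (zorder h a)) \<le> (if a \<in> Pol then real (p a) else 0)"
      using zo[of a] pole[of a] z0[OF h, of a] z0[OF k, of a] by (auto simp: Pol_def p_def)
  qed
  also have "\<dots> = (\<Sum>a\<in>Pol \<inter> cball 0 r. (if a \<in> Pol then real (p a) else 0) * zero_weight r a)"
    using fin sub by (intro sum.mono_neutral_right) (auto simp: Zk_def Zh_def)
  also have "\<dots> = integrated_counting (pole_count f) r" unfolding N by (intro sum.cong) auto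
  finally show "zero_count k r - zero_count h r \<le> integrated_counting (pole_count f) r" .
qed

text \<open>In both bounds Jensen's formula produces zero counts that cancel against those of the
  pole counting. Above, the positive part of \<open>ln (norm (h / k))\<close> is at most
  \<open>V - ln (norm k)\<close> since \<open>V\<close> majorizes both logarithms.\<close>

lemma quotient_nevanlinna_char:
  assumes h: "h holomorphic_on UNIV" "h z0 \<noteq> 0" and k: "k holomorphic_on UNIV" "k z1 \<noteq> 0"
    and f: "f = remove_sings (\<lambda>z. h z / k z)" and r: "1 \<le> r"
    and V: "continuous_on (sphere 0 r) V" "\<And>z. norm z = r \<Longrightarrow> norm (h z) \<le> exp (V z)"
      "\<And>z. norm z = r \<Longrightarrow> norm (k z) \<le> exp (V z)"
  shows "log_lead h - log_lead k \<le> nevanlinna_char f r"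
    and "nevanlinna_char f r \<le> circle_mean V r - log_lead k"
proof -
  have r0: "0 < r" using r by simp
  obtain X where X: "has_circle_mean (\<lambda>z. max 0 (0 + (ln (norm (h z)) - ln (norm (k z))))) r X"
    by (rule has_circle_mean_log_plus_quotient[OF h k r0])
  define E where "E = {a\<in>cball 0 r. h a = 0} \<union> {a\<in>cball 0 r. k a = 0}"
  have finE: "finite E" unfolding E_def using finite_zeros_cball[OF h] finite_zeros_cball[OF k] by blast
  have nzE: "h z \<noteq> 0 \<and> k z \<noteq> 0" if "norm z = r" "z \<notin> E" for z using that by (auto simp: E_def)
  have fz: "ln (norm (f z)) = ln (norm (h z)) - ln (norm (k z))" if "norm z = r" "z \<notin> E" for z
  proof -
    have "(\<lambda>z. h z / k z) analytic_on {z}"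
      using nzE[OF that] by (intro analytic_intros entire_imp_analytic h k) auto
    then have "f z = h z / k z" unfolding f by simp
    then show ?thesis using nzE[OF that] by (simp add: norm_divide ln_div)
  qed
  have Y: "has_circle_mean (\<lambda>z. max 0 (ln (norm (f z)))) r X"
    by (rule has_circle_mean_cong_finite[OF X finE r0]) (simp add: fz)
  have T: "nevanlinna_char f r = X + integrated_counting (pole_count f) r"
    unfolding nevanlinna_char_def has_circle_mean_imp_eq[OF Y] ..
  have "(log_lead h + zero_count h r) - (log_lead k + zero_count k r) \<le> X"
    by (rule has_circle_mean_mono[OF has_circle_mean_diff[OF jensen[OF h r0] jensen[OF k r0]] X]) (use r in auto)
  then show "log_lead h - log_lead k \<le> nevanlinna_char f r"
    using quotient_pole_counting(1)[OF h k r f] unfolding T by linarith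
  have "X \<le> circle_mean V r - (log_lead k + zero_count k r)"
  proof (rule has_circle_mean_mono_finite[OF X has_circle_mean_diff[OF continuous_has_circle_mean[OF V(1)] jensen[OF k r0]] r0 finE])
    fix z assume z: "norm z = r" "z \<notin> E"
    have "ln (norm (h z)) \<le> V z" "ln (norm (k z)) \<le> V z"
      using nzE[OF z] V(2,3)[OF z(1)] by (metis ln_exp ln_mono zero_less_norm_iff)+
    then show "max 0 (0 + (ln (norm (h z)) - ln (norm (k z)))) \<le> V z - ln (norm (k z))" by simp
  qed (use r in auto)
  then show "nevanlinna_char f r \<le> circle_mean V r - log_lead k"
    using quotient_pole_counting(2)[OF h k r f] unfolding T by linarith
qed

text \<open>Comparison of Jensen's formula for the two functions on the unit circle; their zero
  counts agree, so Taylor coefficients need not be computed.\<close>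

lemma log_lead_cmult:
  assumes "h holomorphic_on UNIV" "h z0 \<noteq> 0" "0 < \<Lambda>"
  shows "log_lead (\<lambda>z. of_real \<Lambda> * h z) = ln \<Lambda> + log_lead h"
proof -
  have zo: "zorder (\<lambda>z. of_real \<Lambda> * h z) a = zorder h a" for a
    by (rule zorder_cmult) (use assms(3) in auto)
  have hol: "(\<lambda>z. of_real \<Lambda> * h z) holomorphic_on UNIV" by (intro holomorphic_intros assms)
  have one: "(0 :: real) < 1" by simp
  have "of_real \<Lambda> * h z0 \<noteq> 0" using assms by simp
  note J = jensen[OF hol this one]
  have "has_circle_mean (\<lambda>z. ln (norm (of_real \<Lambda> * h z))) 1 (ln \<Lambda> + (log_lead h + zero_count h 1))"
    by (rule has_circle_mean_cong_finite[OF has_circle_mean_add[OF has_circle_mean_const jensen[OF assms(1,2) one]]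
          finite_zeros_cball[OF assms(1,2), of 1] one])
       (use assms(3) in \<open>auto simp: norm_mult ln_mult\<close>)
  from has_circle_mean_imp_eq[OF this] has_circle_mean_imp_eq[OF J]
  show ?thesis using assms(3) by (simp add: zero_count_def zo)
qed

context periodic_setting
begin

text \<open>A harmonic majorant on the circle of radius \<open>r + norm w\<close> dominates the
  shifted curve on the circle of radius \<open>r\<close>, where its shifted mean is
  \<open>Re (P w)\<close>. By \<open>majorant_shift\<close> with \<open>\<epsilon> = 1\<close> this
  is at most \<open>2 * Re (P 0)\<close> plus a constant.\<close>

lemma shifted_logmax_mean:
  obtains C R1 where "0 < R1" "\<And>r. R1 \<le> r \<Longrightarrow> circle_mean (\<lambda>z. logmax (z + w)) r \<le> 2 * T (r + norm w) + C"
proof -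
  have one: "(0 :: real) < 1" by simp
  obtain C R1 where R1: "0 < R1" "\<And>R P. R1 \<le> R \<Longrightarrow> P holomorphic_on UNIV \<Longrightarrow>
     (\<And>z. norm z = R \<Longrightarrow> logmax z \<le> Re (P z)) \<Longrightarrow> Re (P w) - Re (P 0) \<le> 1 * Re (P 0) + C"
    by (rule majorant_shift[OF one, of w]) (rule that, assumption, blast)
  have "circle_mean (\<lambda>z. logmax (z + w)) r \<le> 2 * T (r + norm w) + (2 * logmax 0 + 2 + C)" if r: "R1 \<le> r" for r
  proof -
    define R where "R = r + norm w"
    have R: "0 < R" "R1 \<le> R" using r R1(1) norm_ge_zero[of w] unfolding R_def by linarith+
    obtain P where P: "P holomorphic_on UNIV" "\<And>z. norm z = R \<Longrightarrow> logmax z + 0 \<le> Re (P z)"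
      "Re (P 0) \<le> T R + logmax 0 + circle_mean (\<lambda>_. 0) R + 1"
      by (rule harmonic_majorant[of R 1 "\<lambda>_. 0"]) (use R in auto)
    have c0: "circle_mean (\<lambda>_. 0) R = 0" using has_circle_mean_imp_eq[OF has_circle_mean_const] .
    have "circle_mean (\<lambda>z. logmax (z + w)) r \<le> Re (P w)"
    proof (rule has_circle_mean_mono[OF continuous_has_circle_mean has_circle_mean_Re_entire[OF P(1), of _ w]])
      show "continuous_on (sphere 0 r) (\<lambda>z. logmax (z + w))"
        by (rule continuous_on_compose2[OF continuous_logmax[of UNIV]]) (auto intro!: continuous_intros)
      show "logmax (z + w) \<le> Re (P (z + w))" if "norm z = r" for z
        by (rule logmax_le_Re[OF P(1) R(1)]) (use P(2) that norm_triangle_ineq[of z w] in \<open>auto simp: R_def\<close>)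
    qed (use r R1 in auto)
    also have "\<dots> \<le> 2 * Re (P 0) + C" using R1(2)[OF R(2) P(1)] P(2) by simp
    also have "\<dots> \<le> 2 * (T R + logmax 0 + 1) + C" using P(3) c0 by simp
    finally show ?thesis by (simp add: R_def)
  qed
  with R1(1) show ?thesis by (rule that)
qed

text \<open>The condition \<open>per\<close> is periodicity of \<open>h / k\<close> with
  denominators cleared. The characteristic of the quotient is bounded by a multiple of
  \<open>T (r + \<kappa>)\<close>, and neither the factor nor the shift spoils hyper-order below 1.
  The constant \<open>\<Lambda>\<close> lifts the characteristic to at least 1.\<close>

lemma quotient_in_periodic_field:
  assumes h: "h holomorphic_on UNIV" "h z0 \<noteq> 0" and k: "k holomorphic_on UNIV" "k z1 \<noteq> 0"
    and per: "\<And>z. k (z + c) * h z = k z * h (z + c)"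
    and V: "\<And>A. continuous_on A V" "\<And>z. norm (h z) \<le> exp (V z)" "\<And>z. norm (k z) \<le> exp (V z)"
    and mV: "eventually (\<lambda>r. circle_mean V r \<le> B * T (r + \<kappa>)) at_top"
    and \<Lambda>: "exp (1 + log_lead k - log_lead h) \<le> \<Lambda>"
  shows "remove_sings (\<lambda>z. of_real \<Lambda> * h z / k z) \<in> periodic_field c"
proof -
  define H where "H z = of_real \<Lambda> * h z" for z
  define f where "f = remove_sings (\<lambda>z. H z / k z)"
  have \<Lambda>0: "0 < \<Lambda>" using \<Lambda> by (rule less_le_trans[OF exp_gt_zero])
  have H: "H holomorphic_on UNIV" "H z0 \<noteq> 0"
    using h \<Lambda>0 by (auto simp: H_def[abs_def] intro!: holomorphic_intros)
  have lH: "log_lead H = ln \<Lambda> + log_lead h" unfolding H_def[abs_def] by (rule log_lead_cmult[OF h \<Lambda>0])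
  define b where "b = \<bar>ln \<Lambda>\<bar>"
  have ln\<Lambda>: "1 + log_lead k - log_lead h \<le> ln \<Lambda>"
    using ln_mono[OF \<Lambda>] by simp
  have VH: "norm (H z) \<le> exp (V z + b)" "norm (k z) \<le> exp (V z + b)" for z
  proof -
    have "\<Lambda> = exp (ln \<Lambda>)" using \<Lambda>0 by simp
    also have "\<dots> \<le> exp b" by (simp add: b_def)
    finally have "norm (h z) * \<Lambda> \<le> exp (V z) * exp b" using V(2)[of z] \<Lambda>0 by (intro mult_mono) auto
    then show "norm (H z) \<le> exp (V z + b)" using \<Lambda>0 by (simp add: H_def norm_mult exp_add mult.commute)
    show "norm (k z) \<le> exp (V z + b)"
      by (rule order_trans[OF V(3)]) (simp add: b_def)
  qed
  have Vb: "continuous_on A (\<lambda>z. V z + b)" for A by (intro continuous_intros V(1))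
  have cVb: "circle_mean (\<lambda>z. V z + b) r = circle_mean V r + b" if "0 \<le> r" for r
    by (rule has_circle_mean_imp_eq) (intro has_circle_mean_add has_circle_mean_const continuous_has_circle_mean V(1) that)
  \<comment> \<open>An exponent strictly between \<open>\<sigma>\<close> and 1, with room to absorb
    \<open>ln B'\<close> and the shift by \<open>\<kappa>\<close>.\<close>
  define \<sigma>' where "\<sigma>' = (1 + \<sigma>) / 2"
  have \<sigma>': "0 < \<sigma>'" "\<sigma>' < 1" "\<sigma> < \<sigma>'" using \<sigma> by (auto simp: \<sigma>'_def)
  define D where "D = b - log_lead k"
  define B' where "B' = \<bar>B\<bar> + \<bar>D\<bar> + 1"
  have B': "1 \<le> B'" by (simp add: B'_def)
  have sh: "filterlim (\<lambda>r::real. r + \<kappa>) at_top at_top" by real_asymp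
  have "hyper_order (nevanlinna_char f) < 1"
  proof (rule hyper_order_less_oneI[OF \<sigma>'(2) _ \<sigma>'(1)])
    have as: "eventually (\<lambda>r. ln B' + (r + \<kappa>) powr \<sigma> \<le> r powr \<sigma>') at_top"
      using \<sigma> \<sigma>' by real_asymp
    have ev1: "eventually (\<lambda>r. ln (T (r + \<kappa>)) \<le> (r + \<kappa>) powr \<sigma>) at_top"
      by (rule eventually_compose_filterlim[OF \<sigma>(3) sh])
    have ev2: "eventually (\<lambda>r. 1 \<le> T (r + \<kappa>)) at_top"
      by (rule eventually_compose_filterlim[OF _ sh]) (use T_lim in \<open>auto simp: filterlim_at_top\<close>)
    show "eventually (\<lambda>r. 1 \<le> nevanlinna_char f r \<and> ln (nevanlinna_char f r) \<le> r powr \<sigma>') at_top"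
      using as ev1 ev2 mV eventually_ge_at_top[of 1]
    proof eventually_elim
      case (elim r)
      note Q = quotient_nevanlinna_char[OF H k f_def elim(5) Vb VH]
      have 1: "1 \<le> nevanlinna_char f r" using Q(1) lH ln\<Lambda> by linarith
      have "nevanlinna_char f r \<le> B * T (r + \<kappa>) + D"
        using Q(2) elim(4,5) cVb[of r] by (simp add: D_def)
      also have "\<dots> \<le> \<bar>B\<bar> * T (r + \<kappa>) + \<bar>D\<bar> * T (r + \<kappa>)"
      proof (rule add_mono)
        show "B * T (r + \<kappa>) \<le> \<bar>B\<bar> * T (r + \<kappa>)" using elim(3) by (intro mult_right_mono) auto
        show "D \<le> \<bar>D\<bar> * T (r + \<kappa>)" using mult_left_mono[OF elim(3), of "\<bar>D\<bar>"] by simp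
      qed
      also have "\<dots> \<le> B' * T (r + \<kappa>)" using elim(3) by (simp add: B'_def algebra_simps)
      finally have "ln (nevanlinna_char f r) \<le> ln (B' * T (r + \<kappa>))" using 1 by (intro ln_mono) auto
      also have "\<dots> = ln B' + ln (T (r + \<kappa>))" using B' elim(3) by (intro ln_mult_pos) auto
      also have "\<dots> \<le> r powr \<sigma>'" using elim(1,2) by simp
      finally show ?case using 1 by simp
    qed
  qed
  moreover have "f nicely_meromorphic_on UNIV"
    unfolding f_def
    by (intro remove_sings_nicely_meromorphic meromorphic_intros analytic_on_imp_meromorphic_on)
       (use H k in \<open>auto simp: analytic_on_open\<close>)
  moreover have "f (z + c) = f z" for z
  proof -
    have ev: "eventually (\<lambda>w. k (a + w) \<noteq> 0) (at 0)" for a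
      using eventually_nonzero_at[OF k, of a]
      unfolding at_to_0[of a] eventually_filtermap by (simp add: add.commute)
    have "eventually (\<lambda>w. k (z + w) \<noteq> 0 \<and> k (z + c + w) \<noteq> 0) (at 0)"
      by (rule eventually_conj[OF ev ev])
    then have "eventually (\<lambda>w. H (z + c + w) / k (z + c + w) = H (z + w) / k (z + w)) (at 0)"
    proof eventually_elim
      case (elim w)
      then show ?case using per[of "z + w"] by (simp add: H_def field_simps add_ac)
    qed
    then show ?thesis unfolding f_def remove_sings_shift_0[of _ "z + c"] remove_sings_shift_0[of _ z]
      by (rule remove_sings_cong) simp
  qed
  ultimately show ?thesis unfolding periodic_field_def f_def H_def by simp
qed

end

section \<open>The Casoratian\<close>

lemma det_mat_leibniz:
  fixes f :: "nat \<Rightarrow> nat \<Rightarrow> 'a :: comm_ring_1"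
  shows "det (mat N N (\<lambda>(i, j). f i j)) =
    (\<Sum>p | p permutes {0..<N}. signof p * (\<Prod>i = 0..<N. f i (p i)))"
proof -
  have "det (mat N N (\<lambda>(i, j). f i j)) =
    (\<Sum>p | p permutes {0..<N}. signof p * (\<Prod>i = 0..<N. mat N N (\<lambda>(i, j). f i j) $$ (i, p i)))"
    by (rule det_def') simp
  also have "\<dots> = (\<Sum>p | p permutes {0..<N}. signof p * (\<Prod>i = 0..<N. f i (p i)))"
  proof (intro sum.cong refl arg_cong2[where f = "(*)"] prod.cong)
    fix p i assume p: "p \<in> {p. p permutes {0..<N}}" and i: "i \<in> {0..<N}"
    then have "p i < N" using permutes_in_image[of p "{0..<N}" i] by auto
    then show "mat N N (\<lambda>(i, j). f i j) $$ (i, p i) = f i (p i)" using i by simp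
  qed
  finally show ?thesis .
qed

lemma det_mat_holomorphic:
  fixes f :: "nat \<Rightarrow> nat \<Rightarrow> complex \<Rightarrow> complex"
  assumes "\<And>i j. i < N \<Longrightarrow> j < N \<Longrightarrow> f i j holomorphic_on A"
  shows "(\<lambda>z. det (mat N N (\<lambda>(i, j). f i j z))) holomorphic_on A"
  unfolding det_mat_leibniz
proof (intro holomorphic_intros)
  fix p i assume p: "p \<in> {p. p permutes {0..<N}}" and i: "i \<in> {0..<N}"
  then have "p i < N" using permutes_in_image[of p "{0..<N}" i] by auto
  then show "(\<lambda>z. f i (p i) z) holomorphic_on A" using assms i by simp
qed

lemma norm_signof: "norm (signof p :: complex) = 1"
  by (simp add: sign_def)

lemma norm_det_mat_le:
  fixes f :: "nat \<Rightarrow> nat \<Rightarrow> complex"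
  assumes "\<And>p. p permutes {0..<N} \<Longrightarrow> (\<Prod>i = 0..<N. norm (f i (p i))) \<le> B"
  shows "norm (det (mat N N (\<lambda>(i, j). f i j))) \<le> fact N * B"
proof -
  have "norm (det (mat N N (\<lambda>(i, j). f i j))) \<le> (\<Sum>p | p permutes {0..<N}. norm (signof p * (\<Prod>i = 0..<N. f i (p i))))"
    unfolding det_mat_leibniz by (rule norm_sum)
  also have "\<dots> = (\<Sum>p | p permutes {0..<N}. \<Prod>i = 0..<N. norm (f i (p i)))"
    by (simp only: norm_mult norm_signof mult_1_left prod_norm)
  also have "\<dots> \<le> (\<Sum>p | p permutes {0..<N}. B)"
    by (rule sum_mono) (use assms in auto)
  also have "\<dots> = fact N * B" by (simp add: card_permutations)
  finally show ?thesis .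
qed

text \<open>The cofactors along the last row do not involve that row, so pairing them with any
  \<open>x\<close> expands the determinant with \<open>x\<close> in its place.\<close>

lemma cofactor_last_row:
  fixes A :: "'a :: comm_ring_1 mat"
  assumes A: "A \<in> carrier_mat (Suc m) (Suc m)"
  shows "(\<Sum>i<Suc m. x i * cofactor A m i) = det (mat (Suc m) (Suc m) (\<lambda>(j, i). if j = m then x i else A $$ (j, i)))"
proof -
  define B where "B = mat (Suc m) (Suc m) (\<lambda>(j, i). if j = m then x i else A $$ (j, i))"
  have B: "B \<in> carrier_mat (Suc m) (Suc m)" by (simp add: B_def)
  have "cofactor B m i = cofactor A m i" if "i < Suc m" for i
  proof -
    have "mat_delete B m i = mat_delete A m i"
      unfolding mat_delete_def using A that by (intro eq_matI) (auto simp: B_def)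
    then show ?thesis by (simp add: cofactor_def)
  qed
  then have "(\<Sum>i<Suc m. x i * cofactor A m i) = (\<Sum>i<Suc m. B $$ (m, i) * cofactor B m i)"
    by (intro sum.cong) (auto simp: B_def)
  also have "\<dots> = det B" by (rule laplace_expansion_row[OF B, symmetric]) simp
  finally show ?thesis by (simp add: B_def)
qed

text \<open>The difference analogue of the Wronskian: row \<open>j\<close> holds the functions
  shifted by \<open>j * c\<close> in place of their \<open>j\<close>-th derivatives.\<close>

definition casoratian :: "complex \<Rightarrow> nat \<Rightarrow> (nat \<Rightarrow> complex \<Rightarrow> complex) \<Rightarrow> complex \<Rightarrow> complex" where
  "casoratian c N f z = det (mat N N (\<lambda>(j, i). f i (z + of_nat j * c)))"

lemma casoratian_holomorphic:
  assumes "\<And>i. i < N \<Longrightarrow> f i holomorphic_on UNIV"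
  shows "casoratian c N f holomorphic_on UNIV"
  unfolding casoratian_def[abs_def]
  by (rule det_mat_holomorphic) (rule holomorphic_shift[OF assms])

context periodic_setting
begin

lemma shifted_logmax_sum_mean:
  obtains B where "eventually (\<lambda>r. circle_mean (\<lambda>z. b + (\<Sum>j<m. logmax (z + of_nat j * c))) r
     \<le> B * T (r + real m * norm c)) at_top"
proof -
  define \<kappa> where "\<kappa> = real m * norm c"
  have \<kappa>: "0 \<le> \<kappa>" by (simp add: \<kappa>_def)
  have ev1: "eventually (\<lambda>r. 1 \<le> T r) at_top" using T_lim unfolding filterlim_at_top by blast
  have "\<exists>B. eventually (\<lambda>r. circle_mean (\<lambda>z. logmax (z + of_nat j * c)) r \<le> B * T (r + \<kappa>)) at_top" if j: "j < m" for j
  proof -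
    obtain C R1 where C: "0 < R1" "\<And>r. R1 \<le> r \<Longrightarrow>
        circle_mean (\<lambda>z. logmax (z + of_nat j * c)) r \<le> 2 * T (r + norm (of_nat j * c)) + C"
      by (rule shifted_logmax_mean[of "of_nat j * c"]) (rule that, assumption, blast)
    have jk: "norm (of_nat j * c) \<le> \<kappa>" unfolding \<kappa>_def norm_mult using j by (intro mult_right_mono) auto
    have "eventually (\<lambda>r. circle_mean (\<lambda>z. logmax (z + of_nat j * c)) r \<le> (2 + \<bar>C\<bar>) * T (r + \<kappa>)) at_top"
      using eventually_ge_at_top[of R1] ev1 eventually_gt_at_top[of 0]
    proof eventually_elim
      case (elim r)
      have "circle_mean (\<lambda>z. logmax (z + of_nat j * c)) r \<le> 2 * T (r + norm (of_nat j * c)) + C"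
        by (rule C(2)[OF elim(1)])
      also have "\<dots> \<le> 2 * T (r + \<kappa>) + \<bar>C\<bar> * 1"
      proof -
        have "0 < r + norm (of_nat j * c)" by (intro add_pos_nonneg elim) auto
        then show ?thesis using T_mono[of "r + norm (of_nat j * c)" "r + \<kappa>"] jk by simp
      qed
      also have "\<dots> \<le> 2 * T (r + \<kappa>) + \<bar>C\<bar> * T (r + \<kappa>)"
        using T_mono[of r "r + \<kappa>"] \<kappa> elim by (intro add_left_mono mult_left_mono) auto
      finally show ?case by (simp add: distrib_right)
    qed
    then show ?thesis by blast
  qed
  then obtain B where B: "\<And>j. j < m \<Longrightarrow>
      eventually (\<lambda>r. circle_mean (\<lambda>z. logmax (z + of_nat j * c)) r \<le> B j * T (r + \<kappa>)) at_top"
    by metis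
  have "eventually (\<lambda>r. \<forall>j\<in>{..<m}. circle_mean (\<lambda>z. logmax (z + of_nat j * c)) r \<le> B j * T (r + \<kappa>)) at_top"
    by (intro eventually_ball_finite) (auto intro: B)
  then have "eventually (\<lambda>r. circle_mean (\<lambda>z. b + (\<Sum>j<m. logmax (z + of_nat j * c))) r
     \<le> (\<bar>b\<bar> + (\<Sum>j<m. B j)) * T (r + \<kappa>)) at_top"
    using ev1 eventually_gt_at_top[of 0]
  proof eventually_elim
    case (elim r)
    have "circle_mean (\<lambda>z. b + (\<Sum>j<m. logmax (z + of_nat j * c))) r =
        b + (\<Sum>j<m. circle_mean (\<lambda>z. logmax (z + of_nat j * c)) r)"
    proof (intro has_circle_mean_imp_eq has_circle_mean_add has_circle_mean_const has_circle_mean_sum continuous_has_circle_mean)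
      show "continuous_on (sphere 0 r) (\<lambda>z. logmax (z + of_nat j * c))" for j
        by (rule continuous_on_compose2[OF continuous_logmax[of UNIV]]) (auto intro!: continuous_intros)
    qed (use elim in auto)
    also have "\<dots> \<le> \<bar>b\<bar> * 1 + (\<Sum>j<m. B j * T (r + \<kappa>))"
      using elim(1) by (intro add_mono sum_mono) auto
    also have "\<dots> \<le> \<bar>b\<bar> * T (r + \<kappa>) + (\<Sum>j<m. B j * T (r + \<kappa>))"
      using T_mono[of r "r + \<kappa>"] \<kappa> elim by (intro add_right_mono mult_left_mono) auto
    finally show ?case by (simp add: sum_distrib_right distrib_right)
  qed
  then show ?thesis unfolding \<kappa>_def by (rule that)
qed

text \<open>If the Casoratian vanishes identically, the cofactors of the first vanishing principal
  Casoratian give a linear relation whose coefficients have periodic quotients.\<close>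

lemma casoratian_nonzero:
  assumes li: "lin_indep_functions (periodic_field c) {0..n} g"
  shows "\<exists>z. casoratian c (Suc n) g z \<noteq> 0"
proof (rule ccontr)
  assume "\<not> ?thesis"
  then have "\<forall>z. casoratian c (Suc n) g z = 0" by simp
  moreover have "\<not> (\<forall>z. casoratian c 0 g z = 0)" by (simp add: casoratian_def)
  \<comment> \<open>The empty determinant is 1, so a last nonvanishing Casoratian before the first
    vanishing one exists. The coefficients \<open>C i\<close> will be the cofactors of the last row
    of the vanishing one.\<close>
  ultimately obtain m where m: "m < Suc n" "\<not> (\<forall>z. casoratian c m g z = 0)" "\<forall>z. casoratian c (Suc m) g z = 0"
    using ex_least_nat_less[of "\<lambda>N. \<forall>z. casoratian c N g z = 0" "Suc n"] by blast
  define M where "M z = mat (Suc m) (Suc m) (\<lambda>(j, i). g i (z + of_nat j * c))" for z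
  have M: "M z \<in> carrier_mat (Suc m) (Suc m)" for z by (simp add: M_def)
  define C where "C i z = cofactor (M z) m i" for i z
  define s where "s i i' = (if i' < i then i' else Suc i')" for i i' :: nat
  have C_eq: "C i z = (-1) ^ (m + i) * det (mat m m (\<lambda>(j, i'). g (s i i') (z + of_nat j * c)))" if "i \<le> m" for i z
  proof -
    have "mat_delete (M z) m i = mat m m (\<lambda>(j, i'). g (s i i') (z + of_nat j * c))"
      unfolding mat_delete_def M_def s_def using that by (intro eq_matI) auto
    then show ?thesis by (simp add: C_def cofactor_def)
  qed
  have sn: "s i i' \<le> n" if "i \<le> m" "i' < m" for i i' using that m(1) by (auto simp: s_def)
  have Cm: "C m z = casoratian c m g z" for z
  proof -
    have "mat m m (\<lambda>(j, i'). g (s m i') (z + of_nat j * c)) = mat m m (\<lambda>(j, i). g i (z + of_nat j * c))"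
      by (intro eq_matI) (auto simp: s_def)
    then show ?thesis by (simp add: C_eq casoratian_def mult_2[symmetric])
  qed
  obtain z1 where z1: "C m z1 \<noteq> 0" using m(2) Cm by auto
  have holC: "C i holomorphic_on UNIV" if "i \<le> m" for i
    unfolding C_eq[OF that, abs_def]
    by (intro holomorphic_intros det_mat_holomorphic holomorphic_shift[OF hol] sn that)
  define V where "V z = ln (fact m) + (\<Sum>j<m. logmax (z + of_nat j * c))" for z
  have V: "norm (C i z) \<le> exp (V z)" if "i \<le> m" for i z
  proof -
    have "norm (C i z) = norm (det (mat m m (\<lambda>(j, i'). g (s i i') (z + of_nat j * c))))"
      unfolding C_eq[OF that] by (simp add: norm_mult norm_power)
    also have "\<dots> \<le> fact m * (\<Prod>j = 0..<m. exp (logmax (z + of_nat j * c)))"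
    proof (rule norm_det_mat_le, rule prod_mono)
      fix p j assume p: "p permutes {0..<m}" and j: "j \<in> {0..<m}"
      then have "p j < m" using permutes_in_image[of p "{0..<m}" j] by auto
      then show "0 \<le> norm (g (s i (p j)) (z + of_nat j * c)) \<and>
          norm (g (s i (p j)) (z + of_nat j * c)) \<le> exp (logmax (z + of_nat j * c))"
        using norm_le_logmax sn that by auto
    qed
    also have "\<dots> = exp (V z)" by (simp add: V_def exp_add exp_sum atLeast0LessThan)
    finally show ?thesis .
  qed
  have contV: "continuous_on A V" for A
    unfolding V_def
    by (intro continuous_intros continuous_on_compose2[OF continuous_logmax[of UNIV]]) auto
  obtain B where B: "eventually (\<lambda>r. circle_mean V r \<le> B * T (r + real m * norm c)) at_top"
    unfolding V_def[abs_def] by (rule shifted_logmax_sum_mean)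
  \<comment> \<open>The cofactor vector annihilates every row: for \<open>j < m\<close> two rows of
    \<open>A\<close> coincide, and for \<open>j = m\<close> the determinant is the vanishing
    Casoratian.\<close>
  have rel: "(\<Sum>i<Suc m. g i (z + of_nat j * c) * C i z) = 0" if "j \<le> m" for j z
  proof -
    define A where "A = mat (Suc m) (Suc m) (\<lambda>(j', i). if j' = m then g i (z + of_nat j * c) else M z $$ (j', i))"
    have eq: "(\<Sum>i<Suc m. g i (z + of_nat j * c) * C i z) = det A"
      unfolding C_def A_def by (rule cofactor_last_row[OF M])
    show ?thesis
    proof (cases "j = m")
      case True
      have "A = mat (Suc m) (Suc m) (\<lambda>(j, i). g i (z + of_nat j * c))"
        unfolding A_def M_def using True by (intro eq_matI) auto
      then show ?thesis using m(3) unfolding eq casoratian_def by simp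
    next
      case False
      have "det A = 0"
        by (rule det_identical_rows[of A "Suc m" j m]) (use that False in \<open>auto simp: A_def M_def intro!: eq_vecI\<close>)
      then show ?thesis using eq by simp
    qed
  qed
  \<comment> \<open>The vectors \<open>C z\<close> and \<open>C (z + c)\<close> both annihilate the
    rows with shifts \<open>1\<close> to \<open>m\<close>. Their combination \<open>y\<close> has
    zero entry at \<open>m\<close>, so its remaining entries solve a square homogeneous system with
    determinant \<open>C m (z + c)\<close>. Where that is nonzero \<open>y\<close> vanishes;
    isolation of zeros gives the rest.\<close>
  have per: "C m (z + c) * C i z = C m z * C i (z + c)" if i: "i \<le> m" for i z
  proof -
    define y where "y i z = C m (z + c) * C i z - C m z * C i (z + c)" for i z
    have y0: "y i z = 0" if nz: "C m (z + c) \<noteq> 0" for z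
    proof (cases "i = m")
      case False
      define A where "A = mat m m (\<lambda>(j, i). g i (z + c + of_nat j * c))"
      have A: "A \<in> carrier_mat m m" by (simp add: A_def)
      define v where "v = vec m (\<lambda>i. y i z)"
      have sh: "z + of_nat (Suc j) * c = z + c + of_nat j * c" for j by (simp add: algebra_simps)
      have row: "(\<Sum>i<m. g i (z + c + of_nat j * c) * y i z) = 0" if j: "j < m" for j
      proof -
        have "(\<Sum>i<Suc m. g i (z + c + of_nat j * c) * y i z) =
            C m (z + c) * (\<Sum>i<Suc m. g i (z + of_nat (Suc j) * c) * C i z) -
            C m z * (\<Sum>i<Suc m. g i (z + c + of_nat j * c) * C i (z + c))"
          unfolding sh y_def sum_distrib_left sum_subtractf[symmetric] by (intro sum.cong) (auto simp: algebra_simps)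
        also have "\<dots> = 0" using rel[of "Suc j" z] rel[of j "z + c"] j by simp
        finally show ?thesis by (simp add: y_def)
      qed
      have "A *\<^sub>v v = 0\<^sub>v m"
        by (rule eq_vecI) (use row in \<open>auto simp: A_def v_def scalar_prod_def atLeast0LessThan\<close>)
      moreover have "det A \<noteq> 0" using nz unfolding Cm casoratian_def A_def .
      moreover have "v \<in> carrier_vec m" by (simp add: v_def)
      ultimately have "v = 0\<^sub>v m"
        using det_0_iff_vec_prod_zero_field[OF A] by blast
      then have "v $ i = 0\<^sub>v m $ i" by simp
      then show ?thesis using i False by (simp add: v_def)
    qed (simp add: y_def)
    have hy: "y i holomorphic_on UNIV"
      unfolding y_def[abs_def] by (intro holomorphic_intros holC i holomorphic_shift le_refl)
    have "y i z = 0"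
    proof (rule ccontr)
      assume "y i z \<noteq> 0"
      then have "eventually (\<lambda>z. y i z \<noteq> 0) (at z)" by (rule eventually_nonzero_at[OF hy])
      moreover have "C m ((z1 - c) + c) \<noteq> 0" using z1 by simp
      then have "eventually (\<lambda>z. C m (z + c) \<noteq> 0) (at z)"
        by (rule eventually_nonzero_at[OF holomorphic_shift[OF holC[OF le_refl]]])
      ultimately have "eventually (\<lambda>z. False) (at z)" by eventually_elim (use y0 in auto)
      then show False by simp
    qed
    then show ?thesis by (simp add: y_def)
  qed
  define \<Lambda> where "\<Lambda> = (\<Sum>i\<le>m. exp (1 + log_lead (C m) - log_lead (C i)))"
  have \<Lambda>: "exp (1 + log_lead (C m) - log_lead (C i)) \<le> \<Lambda>" if "i \<le> m" for i
    unfolding \<Lambda>_def by (rule member_le_sum) (use that in auto)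
  have \<Lambda>0: "0 < \<Lambda>" using \<Lambda>[of m] by (rule less_le_trans[OF exp_gt_zero]) simp
  \<comment> \<open>Identically vanishing cofactors are treated apart because the bound on the
    characteristic of a quotient assumes a nonzero numerator.\<close>
  define \<phi> where "\<phi> i = (if i \<le> m \<and> (\<exists>z. C i z \<noteq> 0) then remove_sings (\<lambda>z. of_real \<Lambda> * C i z / C m z) else (\<lambda>_. 0))" for i
  have \<phi>K: "\<phi> i \<in> periodic_field c" for i
  proof (cases "i \<le> m \<and> (\<exists>z. C i z \<noteq> 0)")
    case True
    then obtain z0 where z0: "C i z0 \<noteq> 0" by blast
    have "remove_sings (\<lambda>z. of_real \<Lambda> * C i z / C m z) \<in> periodic_field c"
      by (rule quotient_in_periodic_field[OF holC z0 holC z1 per contV V V B \<Lambda>]) (use True in auto)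
    then show ?thesis using True by (simp add: \<phi>_def)
  qed (auto simp: \<phi>_def const_in_periodic_field)
  have \<phi>v: "\<phi> i z = of_real \<Lambda> * C i z / C m z" if "i \<le> m" "C m z \<noteq> 0" for i z
  proof (cases "\<exists>z. C i z \<noteq> 0")
    case True
    have "(\<lambda>z. of_real \<Lambda> * C i z / C m z) analytic_on {z}"
      using that by (intro analytic_intros entire_imp_analytic holC) auto
    then show ?thesis using True that by (simp add: \<phi>_def)
  qed (use that in \<open>auto simp: \<phi>_def\<close>)
  have sum0: "(\<Sum>i\<in>{0..n}. \<phi> i z * g i z) = 0" if "C m z \<noteq> 0" for z
  proof -
    have "(\<Sum>i\<in>{0..n}. \<phi> i z * g i z) = (\<Sum>i<Suc m. \<phi> i z * g i z)"
      by (rule sum.mono_neutral_right) (use m(1) in \<open>auto simp: \<phi>_def\<close>)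
    also have "\<dots> = (\<Sum>i<Suc m. of_real \<Lambda> / C m z * (g i (z + of_nat 0 * c) * C i z))"
      by (intro sum.cong) (auto simp: \<phi>v that)
    also have "\<dots> = of_real \<Lambda> / C m z * (\<Sum>i<Suc m. g i (z + of_nat 0 * c) * C i z)"
      by (rule sum_distrib_left[symmetric])
    also have "\<dots> = 0" using rel[of 0 z] by simp
    finally show ?thesis .
  qed
  have "eventually (\<lambda>z. C m z \<noteq> 0) (cosparse UNIV)"
    using eventually_nonzero_at[OF holC[OF le_refl] z1] by (simp add: eventually_cosparse_open_eq)
  then have "eventually (\<lambda>z. (\<Sum>i\<in>{0..n}. \<phi> i z * g i z) = 0) (cosparse UNIV)"
    by eventually_elim (rule sum0)
  then have "\<forall>i\<in>{0..n}. \<forall>z. \<phi> i z = 0"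
    using li \<phi>K unfolding lin_indep_functions_def by blast
  then have "\<phi> m z1 = 0" using m(1) by simp
  then show False using \<phi>v[of m z1] z1 \<Lambda>0 by simp
qed

end

section \<open>Multiplicities of successive zeros\<close>

lemma exists_top_subset:
  fixes f :: "'a \<Rightarrow> 'b :: linorder"
  assumes "finite S" "N \<le> card S"
  obtains I where "I \<subseteq> S" "card I = N" "\<And>i j. i \<in> I \<Longrightarrow> j \<in> S - I \<Longrightarrow> f j \<le> f i"
proof -
  have "\<exists>I\<subseteq>S. card I = N \<and> (\<forall>i\<in>I. \<forall>j\<in>S - I. f j \<le> f i)"
    using assms(2)
  proof (induction N)
    case (Suc N)
    then obtain I where I: "I \<subseteq> S" "card I = N" "\<forall>i\<in>I. \<forall>j\<in>S - I. f j \<le> f i" by auto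
    have fI: "finite I" using I(1) assms(1) by (rule finite_subset)
    have "S - I \<noteq> {}" using Suc.prems I(2) card_mono[OF fI, of S] by fastforce
    then obtain m where m: "m \<in> S - I" "f m = Max (f ` (S - I))"
      using Max_in[of "f ` (S - I)"] assms(1) by fastforce
    have "f j \<le> f m" if "j \<in> S - I" for j
      unfolding m(2) using assms(1) that by (intro Max_ge) auto
    then have "\<forall>i\<in>insert m I. \<forall>j\<in>S - insert m I. f j \<le> f i" using I(3) by blast
    moreover have "card (insert m I) = Suc N" using fI m(1) I(2) by simp
    ultimately show ?case using I(1) m(1) by (intro exI[of _ "insert m I"]) auto
  qed (auto intro!: exI[of _ "{}"])
  then show ?thesis using that by blast
qed

text \<open>A lower bound on the multiplicity that also makes sense for the zero function, so that
  terms of a determinant can be added and multiplied without nonvanishing conditions.\<close>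

definition vanishes_to_order :: "(complex \<Rightarrow> complex) \<Rightarrow> complex \<Rightarrow> nat \<Rightarrow> bool" where
  "vanishes_to_order f z m \<longleftrightarrow>
     (\<exists>h. h analytic_on {z} \<and> eventually (\<lambda>w. f w = (w - z) ^ m * h w) (nhds z))"

lemma vanishes_to_order_0: "f analytic_on {z} \<Longrightarrow> vanishes_to_order f z 0"
  unfolding vanishes_to_order_def by (intro exI[of _ f]) simp

lemma vanishes_to_order_add:
  assumes "vanishes_to_order f z m" "vanishes_to_order h z m"
  shows "vanishes_to_order (\<lambda>w. f w + h w) z m"
proof -
  obtain u v where u: "u analytic_on {z}" "eventually (\<lambda>w. f w = (w - z) ^ m * u w) (nhds z)"
    and v: "v analytic_on {z}" "eventually (\<lambda>w. h w = (w - z) ^ m * v w) (nhds z)"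
    using assms by (auto simp: vanishes_to_order_def)
  have "eventually (\<lambda>w. f w + h w = (w - z) ^ m * (u w + v w)) (nhds z)"
    using u(2) v(2) by eventually_elim (simp add: distrib_left)
  then show ?thesis unfolding vanishes_to_order_def
    by (intro exI[of _ "\<lambda>w. u w + v w"] conjI analytic_intros u v)
qed

lemma vanishes_to_order_mult:
  assumes "vanishes_to_order f z m" "vanishes_to_order h z m'"
  shows "vanishes_to_order (\<lambda>w. f w * h w) z (m + m')"
proof -
  obtain u v where u: "u analytic_on {z}" "eventually (\<lambda>w. f w = (w - z) ^ m * u w) (nhds z)"
    and v: "v analytic_on {z}" "eventually (\<lambda>w. h w = (w - z) ^ m' * v w) (nhds z)"
    using assms by (auto simp: vanishes_to_order_def)
  have "eventually (\<lambda>w. f w * h w = (w - z) ^ (m + m') * (u w * v w)) (nhds z)"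
    using u(2) v(2) by eventually_elim (simp add: power_add mult_ac)
  then show ?thesis unfolding vanishes_to_order_def
    by (intro exI[of _ "\<lambda>w. u w * v w"] conjI analytic_intros u v)
qed

lemma vanishes_to_order_mult_right:
  "vanishes_to_order f z m \<Longrightarrow> h analytic_on {z} \<Longrightarrow> vanishes_to_order (\<lambda>w. h w * f w) z m"
  using vanishes_to_order_mult[OF vanishes_to_order_0] by fastforce

lemma vanishes_to_order_zero: "vanishes_to_order (\<lambda>_. 0) z m"
  unfolding vanishes_to_order_def by (intro exI[of _ "\<lambda>_. 0"]) auto

lemma vanishes_to_order_sum:
  "(\<And>i. i \<in> I \<Longrightarrow> vanishes_to_order (f i) z m) \<Longrightarrow> vanishes_to_order (\<lambda>w. \<Sum>i\<in>I. f i w) z m"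
  by (induction I rule: infinite_finite_induct) (auto intro: vanishes_to_order_zero vanishes_to_order_add)

lemma vanishes_to_order_prod:
  "(\<And>i. i \<in> I \<Longrightarrow> vanishes_to_order (f i) z (m i)) \<Longrightarrow> vanishes_to_order (\<lambda>w. \<Prod>i\<in>I. f i w) z (\<Sum>i\<in>I. m i)"
  by (induction I rule: infinite_finite_induct)
     (auto intro: vanishes_to_order_0 vanishes_to_order_mult)

lemma vanishes_to_order_le:
  assumes "vanishes_to_order f z m" "m' \<le> m"
  shows "vanishes_to_order f z m'"
proof -
  obtain u where u: "u analytic_on {z}" "eventually (\<lambda>w. f w = (w - z) ^ m * u w) (nhds z)"
    using assms by (auto simp: vanishes_to_order_def)
  have "eventually (\<lambda>w. f w = (w - z) ^ m' * ((w - z) ^ (m - m') * u w)) (nhds z)"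
    using u(2) by eventually_elim (use assms(2) in \<open>simp add: power_add[symmetric] mult.assoc[symmetric]\<close>)
  then show ?thesis unfolding vanishes_to_order_def
    by (intro exI[of _ "\<lambda>w. (w - z) ^ (m - m') * u w"] conjI analytic_intros u)
qed

lemma vanishes_to_order_zorder:
  assumes "f holomorphic_on UNIV" "f z0 \<noteq> 0"
  shows "vanishes_to_order f z (nat (zorder f z))"
proof -
  have "\<exists>w\<in>UNIV. f w \<noteq> 0" using assms(2) by blast
  from conjunct2[OF zorder_exist_zero[OF assms(1) open_UNIV convex_connected[OF convex_UNIV] UNIV_I this, of z]]
  obtain s where s0: "0 < s \<and> cball z s \<subseteq> (UNIV :: complex set) \<and> zor_poly f z holomorphic_on cball z s \<and>
      (\<forall>w\<in>cball z s. f w = zor_poly f z w * (w - z) ^ nat (zorder f z) \<and> zor_poly f z w \<noteq> 0)"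
    by (elim exE) (rule that, assumption)
  have "zor_poly f z holomorphic_on ball z s" by (rule holomorphic_on_subset[of _ "cball z s"]) (use s0 in auto)
  then have "zor_poly f z analytic_on {z}"
    unfolding analytic_at using s0 by (intro exI[of _ "ball z s"]) auto
  moreover have "eventually (\<lambda>w. w \<in> ball z s) (nhds z)" using s0 by (intro eventually_nhds_in_open) auto
  then have "eventually (\<lambda>w. f w = (w - z) ^ nat (zorder f z) * zor_poly f z w) (nhds z)"
    by eventually_elim (use s0 in \<open>auto simp: mult.commute\<close>)
  ultimately show ?thesis unfolding vanishes_to_order_def by blast
qed

lemma vanishes_to_order_le_zorder:
  assumes "f holomorphic_on UNIV" "f z0 \<noteq> 0" "vanishes_to_order f z m"
  shows "int m \<le> zorder f z"
proof -
  obtain u where u: "u analytic_on {z}" "eventually (\<lambda>w. f w = (w - z) ^ m * u w) (nhds z)"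
    using assms(3) by (auto simp: vanishes_to_order_def)
  have u2: "eventually (\<lambda>w. f w = (w - z) ^ m * u w) (at z)"
    using u(2) by (simp add: eventually_at_filter eventually_mono)
  have nz: "eventually (\<lambda>w. (w - z) ^ m * u w \<noteq> 0) (at z)"
    using u2 eventually_nonzero_at[OF assms(1,2), of z] by eventually_elim simp
  have "eventually (\<lambda>w. u w \<noteq> 0) (at z)" using nz by eventually_elim auto
  then have fu: "frequently (\<lambda>w. u w \<noteq> 0) (at z)" by (rule eventually_frequently[OF at_neq_bot])
  have "zorder f z = zorder (\<lambda>w. (w - z) ^ m * u w) z" by (rule zorder_cong[OF u2 refl])
  also have "\<dots> = zorder (\<lambda>w. (w - z) ^ m) z + zorder u z"
    by (rule zorder_times_analytic[OF _ u(1) nz]) (intro analytic_intros)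
  also have "zorder (\<lambda>w. (w - z) ^ m) z = int m"
    by (rule zorder_eqI[of UNIV _ "\<lambda>_. 1"]) auto
  finally show ?thesis using zorder_ge_0[OF u(1) fu] by simp
qed

lemma zorder_mult_entire:
  assumes "f holomorphic_on UNIV" "f z0 \<noteq> 0" "h holomorphic_on UNIV" "h z1 \<noteq> 0"
  shows "zorder (\<lambda>w. f w * h w) z = zorder f z + zorder h z"
proof (rule zorder_times_analytic)
  show "eventually (\<lambda>w. f w * h w \<noteq> 0) (at z)"
    using eventually_nonzero_at[OF assms(1,2), of z] eventually_nonzero_at[OF assms(3,4), of z]
    by eventually_elim simp
qed (intro entire_imp_analytic assms)+

lemma zorder_power_entire:
  assumes "f holomorphic_on UNIV" "f z0 \<noteq> 0"
  shows "zorder (\<lambda>w. f w ^ m) z = int m * zorder f z"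
proof (induction m)
  case (Suc m)
  have "zorder (\<lambda>w. f w * f w ^ m) z = zorder f z + zorder (\<lambda>w. f w ^ m) z"
    by (rule zorder_mult_entire[OF assms, of _ z0]) (use assms in \<open>auto intro!: holomorphic_intros\<close>)
  then show ?case using Suc by (simp add: algebra_simps)
qed simp

lemma zorder_entire_nonneg:
  assumes "f holomorphic_on UNIV" "f z0 \<noteq> 0"
  shows "0 \<le> zorder f z"
  using zorder_zero_pos[OF assms, of z] zorder_nonzero[OF assms(1), of z] by (cases "f z = 0") auto

text \<open>The exponential factor has no zeros, so the zero counts agree. Jensen's formula on the
  unit circle then shows that the leading logarithms differ by the mean of
  \<open>Re P\<close>.\<close>

lemma log_lead_mult_exp:
  assumes "F holomorphic_on UNIV" "F z0 \<noteq> 0" "P holomorphic_on UNIV"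
  shows "log_lead (\<lambda>z. F z * exp (- P z)) = log_lead F - Re (P 0)"
    and "zero_count (\<lambda>z. F z * exp (- P z)) r = zero_count F r"
proof -
  have hol: "(\<lambda>z. F z * exp (- P z)) holomorphic_on UNIV" by (intro holomorphic_intros assms)
  have nz: "F z0 * exp (- P z0) \<noteq> 0" using assms(2) by simp
  have he: "(\<lambda>z. exp (- P z)) holomorphic_on UNIV" by (intro holomorphic_intros assms)
  have "zorder (\<lambda>z. F z * exp (- P z)) a = zorder F a" for a
    using zorder_mult_entire[OF assms(1,2) he, of 0 a] zorder_nonzero[OF he, of a] by simp
  then show zc: "zero_count (\<lambda>z. F z * exp (- P z)) r = zero_count F r" for r
    by (simp add: zero_count_def)
  have one: "(0 :: real) < 1" by simp
  have mP: "has_circle_mean (\<lambda>z. Re (P z)) 1 (Re (P 0))"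
    using has_circle_mean_Re_entire[OF assms(3) one, of 0] by simp
  have "has_circle_mean (\<lambda>z. ln (norm (F z * exp (- P z)))) 1 ((log_lead F + zero_count F 1) - Re (P 0))"
    by (rule has_circle_mean_cong_finite[OF has_circle_mean_diff[OF jensen[OF assms(1,2) one] mP]
          finite_zeros_cball[OF assms(1,2), of 1] one])
       (auto simp: norm_mult ln_mult)
  from has_circle_mean_imp_eq[OF this] has_circle_mean_imp_eq[OF jensen[OF hol nz one]]
  show "log_lead (\<lambda>z. F z * exp (- P z)) = log_lead F - Re (P 0)" by (simp add: zc)
qed

section \<open>Forms of the curve and their determinant identity\<close>

locale moving_hyperplanes = periodic_setting n g c \<sigma> for n g c \<sigma> +
  fixes q :: nat and a :: "nat \<Rightarrow> nat \<Rightarrow> complex \<Rightarrow> complex"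
    and \<psi> :: "complex \<Rightarrow> complex" and \<phi> :: "nat set \<times> nat \<Rightarrow> nat \<Rightarrow> complex \<Rightarrow> complex"
  assumes q: "n \<le> q"
    and a_small: "\<And>j k. j \<in> {0..q} \<Longrightarrow> k \<in> {0..n} \<Longrightarrow> a j k \<in> small"
    and \<psi>_small: "\<psi> \<in> small" and \<psi>_nonzero: "\<exists>z. \<psi> z \<noteq> 0"
    and \<phi>_small: "\<And>I k i. I \<subseteq> {0..q} \<Longrightarrow> card I = n + 1 \<Longrightarrow> k \<in> {0..n} \<Longrightarrow> i \<in> I \<Longrightarrow> \<phi> (I, k) i \<in> small"
    and inverse: "\<And>I k l z. I \<subseteq> {0..q} \<Longrightarrow> card I = n + 1 \<Longrightarrow> k \<in> {0..n} \<Longrightarrow> l \<in> {0..n} \<Longrightarrow>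
       (\<Sum>i\<in>I. \<phi> (I, k) i z * a i l z) = (if l = k then \<psi> z else 0)"
    and W_nonzero: "\<exists>z. casoratian c (Suc n) g z \<noteq> 0"
begin

abbreviation W :: "complex \<Rightarrow> complex" where "W \<equiv> casoratian c (Suc n) g"

definition L :: "nat \<Rightarrow> complex \<Rightarrow> complex" where "L j = hyperplane_form n g (a j)"

lemma L_eq: "L j z = (\<Sum>k\<in>{0..n}. a j k z * g k z)"
  by (simp add: L_def hyperplane_form_def)

lemma W_hol: "W holomorphic_on UNIV"
  by (rule casoratian_holomorphic) (use hol in auto)

lemma \<psi>_hol: "\<psi> holomorphic_on UNIV" by (rule small.holomorphic[OF \<psi>_small])

lemma L_hol: "j \<in> {0..q} \<Longrightarrow> L j holomorphic_on UNIV"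
  unfolding L_eq[abs_def] by (intro holomorphic_intros small.holomorphic a_small hol) auto

text \<open>The coefficients \<open>a i l\<close> have the same values at \<open>z\<close> and
  \<open>z + j * c\<close>, so the inverse taken at \<open>z\<close> recovers the coordinates at
  every shifted point.\<close>

lemma \<psi>_g:
  assumes "I \<subseteq> {0..q}" "card I = n + 1" "k \<in> {0..n}"
  shows "\<psi> z * g k (z + of_nat j * c) = (\<Sum>i\<in>I. \<phi> (I, k) i z * L i (z + of_nat j * c))"
proof -
  have "(\<Sum>i\<in>I. \<phi> (I, k) i z * L i (z + of_nat j * c)) =
      (\<Sum>i\<in>I. \<Sum>l\<in>{0..n}. \<phi> (I, k) i z * a i l z * g l (z + of_nat j * c))"
  proof (intro sum.cong refl)
    fix i assume i: "i \<in> I"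
    have "a i l (z + of_nat j * c) = a i l z" if "l \<in> {0..n}" for l
      using small_periodic[OF a_small] assms(1) i that by blast
    then show "\<phi> (I, k) i z * L i (z + of_nat j * c) = (\<Sum>l\<in>{0..n}. \<phi> (I, k) i z * a i l z * g l (z + of_nat j * c))"
      unfolding L_eq sum_distrib_left by (intro sum.cong) (auto simp: mult.assoc)
  qed
  also have "\<dots> = (\<Sum>l\<in>{0..n}. \<Sum>i\<in>I. \<phi> (I, k) i z * a i l z * g l (z + of_nat j * c))"
    by (rule sum.swap)
  also have "\<dots> = (\<Sum>l\<in>{0..n}. (if l = k then \<psi> z else 0) * g l (z + of_nat j * c))"
    by (intro sum.cong refl) (simp only: sum_distrib_right[symmetric] inverse[OF assms])
  also have "\<dots> = (\<Sum>l\<in>{k}. (if l = k then \<psi> z else 0) * g l (z + of_nat j * c))"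
    by (rule sum.mono_neutral_right) (use assms(3) in auto)
  finally show ?thesis by simp
qed

definition det_\<phi> :: "nat set \<Rightarrow> (nat \<Rightarrow> nat) \<Rightarrow> complex \<Rightarrow> complex" where
  "det_\<phi> I e z = det (mat (Suc n) (Suc n) (\<lambda>(i, k). \<phi> (I, k) (e i) z))"

definition det_L :: "(nat \<Rightarrow> nat) \<Rightarrow> complex \<Rightarrow> complex" where
  "det_L e z = det (mat (Suc n) (Suc n) (\<lambda>(j, i). L (e i) (z + of_nat j * c)))"

text \<open>Matrix form of the relations \<open>\<psi>_g\<close>: row \<open>j\<close> collects
  those for the shift \<open>j * c\<close>, and \<open>\<psi>\<close> times the Casorati matrix of
  the curve factors into that of the forms and the matrix of the \<open>\<phi>\<close>.\<close>

lemma determinant_identity: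
  assumes "I \<subseteq> {0..q}" "card I = n + 1" and e: "bij_betw e {0..<Suc n} I"
  shows "\<psi> z ^ Suc n * W z = det_L e z * det_\<phi> I e z"
proof -
  define A where "A = mat (Suc n) (Suc n) (\<lambda>(j, i). g i (z + of_nat j * c))"
  define B where "B = mat (Suc n) (Suc n) (\<lambda>(j, i). L (e i) (z + of_nat j * c))"
  define D where "D = mat (Suc n) (Suc n) (\<lambda>(i, k). \<phi> (I, k) (e i) z)"
  have c: "B \<in> carrier_mat (Suc n) (Suc n)" "D \<in> carrier_mat (Suc n) (Suc n)" by (auto simp: B_def D_def)
  have "\<psi> z \<cdot>\<^sub>m A = B * D"
  proof (rule eq_matI)
    fix j k assume "j < dim_row (B * D)" "k < dim_col (B * D)"
    then have jk: "j < Suc n" "k < Suc n" by (auto simp: B_def D_def)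
    have "(\<psi> z \<cdot>\<^sub>m A) $$ (j, k) = \<psi> z * g k (z + of_nat j * c)" using jk by (simp add: A_def)
    also have "\<dots> = (\<Sum>i\<in>I. \<phi> (I, k) i z * L i (z + of_nat j * c))"
      by (rule \<psi>_g[OF assms(1,2)]) (use jk in auto)
    also have "\<dots> = (\<Sum>i = 0..<Suc n. \<phi> (I, k) (e i) z * L (e i) (z + of_nat j * c))"
      by (rule sum.reindex_bij_betw[OF e, symmetric])
    also have "\<dots> = (B * D) $$ (j, k)"
      using jk by (simp add: B_def D_def scalar_prod_def mult.commute)
    finally show "(\<psi> z \<cdot>\<^sub>m A) $$ (j, k) = (B * D) $$ (j, k)" .
  qed (auto simp: A_def B_def D_def)
  then have "det (\<psi> z \<cdot>\<^sub>m A) = det B * det D" using det_mult[OF c] by simp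
  moreover have "det (\<psi> z \<cdot>\<^sub>m A) = \<psi> z ^ Suc n * det A" by (simp add: A_def)
  ultimately show ?thesis by (simp add: A_def B_def D_def casoratian_def det_L_def det_\<phi>_def)
qed

lemma \<psi>W_nonzero: "\<exists>z. \<psi> z ^ Suc n * W z \<noteq> 0"
proof -
  obtain z0 z1 where "\<psi> z0 \<noteq> 0" "W z1 \<noteq> 0" using \<psi>_nonzero W_nonzero by blast
  then have "eventually (\<lambda>z. \<psi> z ^ Suc n * W z \<noteq> 0) (at 0)"
    using eventually_nonzero_at[OF \<psi>_hol, of z0 0] eventually_nonzero_at[OF W_hol, of z1 0]
    by (auto elim: eventually_elim2)
  then show ?thesis using eventually_happens[of _ "at (0::complex)"] by fastforce
qed

text \<open>If \<open>L j\<close> vanished identically, a set \<open>I\<close> containing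
  \<open>j\<close> would give a zero column in \<open>det_L\<close>, and so a vanishing
  \<open>\<psi> ^ Suc n * W\<close>. Maximizing the indicator of \<open>j\<close> forces
  \<open>j\<close> into \<open>I\<close>.\<close>

lemma L_nonzero:
  assumes j: "j \<in> {0..q}"
  shows "\<exists>z. L j z \<noteq> 0"
proof (rule ccontr)
  assume "\<not> ?thesis"
  then have L0: "L j z = 0" for z by blast
  obtain I where I: "I \<subseteq> {0..q}" "card I = n + 1" "\<And>i k. i \<in> I \<Longrightarrow> k \<in> {0..q} - I \<Longrightarrow> (if k = j then 1 else 0 :: nat) \<le> (if i = j then 1 else 0)"
    using exists_top_subset[of "{0..q}" "n + 1" "\<lambda>i. if i = j then 1 else 0 :: nat"] q by auto
  have "j \<in> I"
  proof (rule ccontr)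
    assume "j \<notin> I"
    moreover obtain i where "i \<in> I" using I(2) by fastforce
    ultimately show False using I(3)[of i j] j by (auto split: if_splits)
  qed
  obtain e where e: "bij_betw e {0..<Suc n} I"
    using ex_bij_betw_nat_finite[of I] I(2) finite_subset[OF I(1)] by auto
  then obtain i0 where i0: "i0 < Suc n" "e i0 = j" using \<open>j \<in> I\<close> by (auto simp: bij_betw_def)
  have "det_L e z = 0" for z
  proof -
    have "(\<Prod>k = 0..<Suc n. L (e (p k)) (z + of_nat k * c)) = 0" if p: "p permutes {0..<Suc n}" for p
    proof (rule prod_zero)
      obtain k where "k \<in> {0..<Suc n}" "p k = i0" using permutes_image[OF p] i0(1) by (metis atLeastLessThan_iff imageE zero_le)
      then show "\<exists>k\<in>{0..<Suc n}. L (e (p k)) (z + of_nat k * c) = 0"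
        using i0 L0 by (intro bexI[of _ k]) auto
    qed simp
    then show ?thesis unfolding det_L_def det_mat_leibniz
      by (intro sum.neutral ballI) (simp only: mem_Collect_eq mult_zero_right)
  qed
  then show False using determinant_identity[OF I(1,2) e] \<psi>W_nonzero by simp
qed

text \<open>The part of the multiplicity that \<open>aperiodic_counting\<close> leaves out.\<close>

definition succ_mult :: "nat \<Rightarrow> complex \<Rightarrow> nat" where
  "succ_mult j z = (if L j z = 0 \<and> successive_separated n c (L j) z then nat (zorder (L j) z) else 0)"

text \<open>Let \<open>I\<close> hold the \<open>n + 1\<close> forms of largest successive
  multiplicity at \<open>z\<close>. Successive zeros persist under the shifts, so each term of
  \<open>det_L\<close> vanishes at least to the sum of these multiplicities, which the determinant
  identity transfers to \<open>W\<close> and \<open>\<psi> ^ Suc n\<close>. A form outside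
  \<open>I\<close> has multiplicity at most that of every form in \<open>I\<close>, hence at most
  that of \<open>\<psi> * g k\<close>; with \<open>g k z \<noteq> 0\<close> only the zero of
  \<open>\<psi>\<close> remains.\<close>

lemma succ_mult_le:
  "(\<Sum>j\<in>{0..q}. succ_mult j z) \<le> nat (zorder W z) + (q + 1) * nat (zorder \<psi> z)"
proof -
  obtain I where I: "I \<subseteq> {0..q}" "card I = n + 1"
      "\<And>i j. i \<in> I \<Longrightarrow> j \<in> {0..q} - I \<Longrightarrow> succ_mult j z \<le> succ_mult i z"
    using exists_top_subset[of "{0..q}" "n + 1" "\<lambda>j. succ_mult j z"] q by auto
  have finI: "finite I" by (rule finite_subset[OF I(1)]) simp
  obtain e where e: "bij_betw e {0..<Suc n} I" using ex_bij_betw_nat_finite[of I] I(2) finI by auto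
  have shift: "vanishes_to_order (\<lambda>z. L i (z + of_nat \<nu> * c)) z (succ_mult i z)" if i: "i \<in> {0..q}" and \<nu>: "\<nu> \<le> n" for i \<nu>
  proof -
    obtain w where w: "L i w \<noteq> 0" using L_nonzero[OF i] by blast
    have hs: "(\<lambda>z. L i (z + of_nat \<nu> * c)) holomorphic_on UNIV" by (rule holomorphic_shift[OF L_hol[OF i]])
    have ns: "L i ((w - of_nat \<nu> * c) + of_nat \<nu> * c) \<noteq> 0" using w by simp
    have "succ_mult i z \<le> nat (zorder (\<lambda>z. L i (z + of_nat \<nu> * c)) z)"
    proof (cases "L i z = 0 \<and> successive_separated n c (L i) z")
      case True
      then have "zorder (L i) z \<le> zorder (\<lambda>z. L i (z + of_nat \<nu> * c)) z"
        using \<nu> by (cases "\<nu> = 0") (auto simp: successive_separated_def)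
      then show ?thesis by (simp add: succ_mult_def nat_mono)
    qed (auto simp: succ_mult_def)
    with vanishes_to_order_zorder[OF hs ns] show ?thesis by (rule vanishes_to_order_le)
  qed
  obtain z0 z1 where nz: "\<psi> z0 \<noteq> 0" "W z1 \<noteq> 0" using \<psi>_nonzero W_nonzero by blast
  have o\<psi>: "0 \<le> zorder \<psi> z" and oW: "0 \<le> zorder W z"
    by (rule zorder_entire_nonneg[OF \<psi>_hol nz(1)], rule zorder_entire_nonneg[OF W_hol nz(2)])
  have in1: "(\<Sum>i\<in>I. succ_mult i z) \<le> nat (zorder W z) + (n + 1) * nat (zorder \<psi> z)"
  proof -
    have "vanishes_to_order (det_L e) z (\<Sum>i\<in>I. succ_mult i z)"
      unfolding det_L_def[abs_def] det_mat_leibniz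
    proof (rule vanishes_to_order_sum)
      fix p assume "p \<in> {p. p permutes {0..<Suc n}}"
      then have p: "p permutes {0..<Suc n}" by simp
      have bij: "bij_betw (\<lambda>k. e (p k)) {0..<Suc n} I"
        using bij_betw_trans[OF permutes_imp_bij[OF p] e] by (simp add: o_def)
      have "vanishes_to_order (\<lambda>w. \<Prod>k = 0..<Suc n. L (e (p k)) (w + of_nat k * c)) z (\<Sum>k = 0..<Suc n. succ_mult (e (p k)) z)"
      proof (rule vanishes_to_order_prod, rule shift)
        fix k assume k: "k \<in> {0..<Suc n}"
        then show "e (p k) \<in> {0..q}" using bij_betwE[OF bij] I(1) by blast
        show "k \<le> n" using k by simp
      qed
      then have "vanishes_to_order (\<lambda>w. \<Prod>k = 0..<Suc n. L (e (p k)) (w + of_nat k * c)) z (\<Sum>i\<in>I. succ_mult i z)"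
        using sum.reindex_bij_betw[OF bij, of "\<lambda>i. succ_mult i z"] by simp
      then show "vanishes_to_order (\<lambda>w. signof p * (\<Prod>k = 0..<Suc n. L (e (p k)) (w + of_nat k * c))) z (\<Sum>i\<in>I. succ_mult i z)"
        by (rule vanishes_to_order_mult_right) auto
    qed
    moreover have "det_\<phi> I e analytic_on {z}"
      unfolding det_\<phi>_def[abs_def]
      by (rule entire_imp_analytic, rule det_mat_holomorphic, rule small.holomorphic, rule \<phi>_small)
         (use I bij_betwE[OF e] in auto)
    ultimately have "vanishes_to_order (\<lambda>z. det_\<phi> I e z * det_L e z) z (\<Sum>i\<in>I. succ_mult i z)"
      by (rule vanishes_to_order_mult_right)
    then have v: "vanishes_to_order (\<lambda>z. \<psi> z ^ Suc n * W z) z (\<Sum>i\<in>I. succ_mult i z)"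
      unfolding determinant_identity[OF I(1,2) e] by (simp add: mult.commute)
    have hp: "(\<lambda>z. \<psi> z ^ Suc n) holomorphic_on UNIV" by (intro holomorphic_intros \<psi>_hol)
    have np: "\<psi> z0 ^ Suc n \<noteq> 0" using nz by simp
    obtain z2 where z2: "\<psi> z2 ^ Suc n * W z2 \<noteq> 0" using \<psi>W_nonzero by blast
    have "int (\<Sum>i\<in>I. succ_mult i z) \<le> zorder (\<lambda>z. \<psi> z ^ Suc n * W z) z"
      by (rule vanishes_to_order_le_zorder[OF _ z2 v]) (intro holomorphic_intros \<psi>_hol W_hol)
    also have "\<dots> = int (Suc n) * zorder \<psi> z + zorder W z"
      unfolding zorder_mult_entire[OF hp np W_hol nz(2)] zorder_power_entire[OF \<psi>_hol nz(1)] ..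
    also have "\<dots> = int (nat (zorder W z) + (n + 1) * nat (zorder \<psi> z))"
      using o\<psi> oW by (simp add: distrib_right)
    finally show ?thesis by linarith
  qed
  have out: "succ_mult j z \<le> nat (zorder \<psi> z)" if j: "j \<in> {0..q} - I" for j
  proof -
    obtain k where k: "k \<in> {0..n}" "g k z \<noteq> 0"
      using reduced unfolding reduced_representation_def by blast
    have "vanishes_to_order (\<lambda>z. \<Sum>i\<in>I. \<phi> (I, k) i z * L i (z + of_nat 0 * c)) z (succ_mult j z)"
    proof (rule vanishes_to_order_sum, rule vanishes_to_order_mult_right)
      fix i assume i: "i \<in> I"
      show "vanishes_to_order (\<lambda>z. L i (z + of_nat 0 * c)) z (succ_mult j z)"
        by (rule vanishes_to_order_le[OF shift I(3)[OF i j]]) (use i I(1) in auto)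
      show "\<phi> (I, k) i analytic_on {z}"
        by (rule entire_imp_analytic[OF small.holomorphic[OF \<phi>_small[OF I(1,2) k(1) i]]])
    qed
    then have v: "vanishes_to_order (\<lambda>z. \<psi> z * g k z) z (succ_mult j z)"
      using \<psi>_g[OF I(1,2) k(1), of _ 0] by simp
    have hg: "g k holomorphic_on UNIV" using hol k by simp
    obtain z2 where z2: "\<psi> z2 * g k z2 \<noteq> 0"
      using eventually_happens[OF eventually_conj[OF eventually_nonzero_at[OF \<psi>_hol nz(1), of 0] eventually_nonzero_at[OF hg k(2), of 0]]]
      by auto
    have "int (succ_mult j z) \<le> zorder (\<lambda>z. \<psi> z * g k z) z"
      by (rule vanishes_to_order_le_zorder[OF _ z2 v]) (intro holomorphic_intros \<psi>_hol hg)
    also have "\<dots> = zorder \<psi> z"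
      unfolding zorder_mult_entire[OF \<psi>_hol nz(1) hg k(2)] using zorder_nonzero[OF hg k(2)] by simp
    finally show ?thesis by linarith
  qed
  have cardO: "card ({0..q} - I) = q - n" using I finI by (simp add: card_Diff_subset)
  have "(\<Sum>j\<in>{0..q}. succ_mult j z) = (\<Sum>j\<in>{0..q} - I. succ_mult j z) + (\<Sum>i\<in>I. succ_mult i z)"
    by (rule sum.subset_diff[OF I(1)]) simp
  also have "\<dots> \<le> (q - n) * nat (zorder \<psi> z) + (nat (zorder W z) + (n + 1) * nat (zorder \<psi> z))"
    using sum_bounded_above[of "{0..q} - I" "\<lambda>j. succ_mult j z" "nat (zorder \<psi> z)"] out in1 cardO
    by (intro add_mono) auto
  also have "\<dots> = nat (zorder W z) + (q - n + (n + 1)) * nat (zorder \<psi> z)" by (simp add: algebra_simps)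
  also have "q - n + (n + 1) = q + 1" using q by simp
  finally show ?thesis .
qed

text \<open>All sums are taken over one finite set \<open>Z\<close> of zeros, so that the local
  estimate \<open>succ_mult_le\<close> can be weighted and added point by point.\<close>

lemma counting_le:
  assumes r: "1 \<le> r"
  shows "(\<Sum>j\<in>{0..q}. zero_count (L j) r) \<le>
    (\<Sum>j\<in>{0..q}. aperiodic_counting n c (L j) r) + zero_count W r + (real q + 1) * zero_count \<psi> r"
proof -
  obtain z0 z1 where nz: "\<psi> z0 \<noteq> 0" "W z1 \<noteq> 0" using \<psi>_nonzero W_nonzero by blast
  define Z where "Z = (\<Union>j\<in>{0..q}. {w\<in>cball 0 r. L j w = 0}) \<union> {w\<in>cball 0 r. \<psi> w = 0} \<union> {w\<in>cball 0 r. W w = 0}"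
  have finL: "finite {w\<in>cball 0 r. L j w = 0}" if "j \<in> {0..q}" for j
    using finite_zeros_cball[OF L_hol[OF that]] L_nonzero[OF that] by blast
  have finZ: "finite Z" unfolding Z_def
    using finL finite_zeros_cball[OF \<psi>_hol nz(1), of r] finite_zeros_cball[OF W_hol nz(2), of r] by auto
  have Zr: "w \<in> cball 0 r" if "w \<in> Z" for w using that by (auto simp: Z_def)
  have zw: "0 \<le> zero_weight r w" if "w \<in> Z" for w using Zr[OF that] by (intro zero_weight_nonneg r) auto
  have zc: "zero_count F r = (\<Sum>w\<in>Z. real (nat (zorder F w)) * zero_weight r w)"
    if "F holomorphic_on UNIV" "{w\<in>cball 0 r. F w = 0} \<subseteq> Z" for F
    unfolding zero_count_def using finZ that(2) Zr
    by (intro sum.mono_neutral_left ballI) (auto simp: zorder_nonzero[OF that(1)])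
  have ap: "zero_count (L j) r = aperiodic_counting n c (L j) r + (\<Sum>w\<in>Z. real (succ_mult j w) * zero_weight r w)"
    if j: "j \<in> {0..q}" for j
  proof -
    have sub: "aperiodic_zeros n c (L j) \<inter> cball 0 r \<subseteq> Z" using j by (auto simp: Z_def aperiodic_zeros_def)
    have "aperiodic_counting n c (L j) r =
        (\<Sum>w\<in>aperiodic_zeros n c (L j) \<inter> cball 0 r. real (nat (zorder (L j) w)) * zero_weight r w)"
      unfolding aperiodic_counting_def
      by (rule integrated_counting_eq) (use finite_subset[OF sub finZ] r in auto)
    also have "\<dots> = (\<Sum>w\<in>Z. if w \<in> aperiodic_zeros n c (L j) then real (nat (zorder (L j) w)) * zero_weight r w else 0)"
      using finZ sub Zr by (intro sum.mono_neutral_cong_left) auto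
    finally have *: "aperiodic_counting n c (L j) r = \<dots>" .
    have "zero_count (L j) r = (\<Sum>w\<in>Z. real (nat (zorder (L j) w)) * zero_weight r w)"
      by (rule zc[OF L_hol[OF j]]) (use j in \<open>auto simp: Z_def\<close>)
    also have "\<dots> = (\<Sum>w\<in>Z. (if w \<in> aperiodic_zeros n c (L j) then real (nat (zorder (L j) w)) * zero_weight r w else 0)
        + real (succ_mult j w) * zero_weight r w)"
      by (intro sum.cong) (auto simp: aperiodic_zeros_def succ_mult_def zorder_nonzero[OF L_hol[OF j]])
    finally show ?thesis using * by (simp add: sum.distrib)
  qed
  have "(\<Sum>j\<in>{0..q}. \<Sum>w\<in>Z. real (succ_mult j w) * zero_weight r w) =
      (\<Sum>w\<in>Z. real (\<Sum>j\<in>{0..q}. succ_mult j w) * zero_weight r w)"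
    by (subst sum.swap) (simp add: sum_distrib_right)
  also have "\<dots> \<le> (\<Sum>w\<in>Z. real (nat (zorder W w) + (q + 1) * nat (zorder \<psi> w)) * zero_weight r w)"
    by (intro sum_mono mult_right_mono zw of_nat_mono succ_mult_le)
  also have "\<dots> = (\<Sum>w\<in>Z. real (nat (zorder W w)) * zero_weight r w) + (real q + 1) * (\<Sum>w\<in>Z. real (nat (zorder \<psi> w)) * zero_weight r w)"
    by (simp add: sum.distrib sum_distrib_left algebra_simps)
  also have "\<dots> = zero_count W r + (real q + 1) * zero_count \<psi> r"
  proof -
    have "zero_count W r = (\<Sum>w\<in>Z. real (nat (zorder W w)) * zero_weight r w)"
      by (rule zc[OF W_hol]) (auto simp: Z_def)
    moreover have "zero_count \<psi> r = (\<Sum>w\<in>Z. real (nat (zorder \<psi> w)) * zero_weight r w)"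
      by (rule zc[OF \<psi>_hol]) (auto simp: Z_def)
    ultimately show ?thesis by simp
  qed
  finally show ?thesis using ap by (simp add: sum.distrib)
qed

end

section \<open>The pointwise inequality\<close>

text \<open>A continuous nonnegative majorant for finitely many logarithms; the summand 1 avoids
  \<open>ln 0\<close> at common zeros.\<close>

definition log_sum :: "'i set \<Rightarrow> ('i \<Rightarrow> complex \<Rightarrow> complex) \<Rightarrow> complex \<Rightarrow> real" where
  "log_sum S f z = ln (1 + (\<Sum>s\<in>S. norm (f s z)))"

lemma exp_log_sum: "exp (log_sum S f z) = 1 + (\<Sum>s\<in>S. norm (f s z))"
  unfolding log_sum_def by (intro exp_ln add_pos_nonneg sum_nonneg) auto

lemma norm_le_exp_log_sum:
  assumes "finite S" "s \<in> S"
  shows "norm (f s z) \<le> exp (log_sum S f z)"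
proof -
  have "norm (f s z) \<le> (\<Sum>s\<in>S. norm (f s z))" using assms by (intro member_le_sum) auto
  then show ?thesis unfolding exp_log_sum by simp
qed

lemma continuous_log_sum:
  assumes "\<And>s. s \<in> S \<Longrightarrow> f s holomorphic_on UNIV"
  shows "continuous_on A (log_sum S f)"
proof -
  have "1 + (\<Sum>s\<in>S. norm (f s z)) \<noteq> 0" for z
    using sum_nonneg[of S "\<lambda>s. norm (f s z)"] by auto
  then show ?thesis unfolding log_sum_def
    by (intro continuous_intros holomorphic_on_imp_continuous_on holomorphic_on_subset[OF assms]) auto
qed

lemma log_sum_le:
  assumes "finite S"
  shows "log_sum S f z \<le> ln (1 + real (card S)) + (\<Sum>s\<in>S. max 0 (ln (norm (f s z))))"
proof -
  define p where "p = (\<Prod>s\<in>S. max 1 (norm (f s z)))"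
  have p1: "1 \<le> p" unfolding p_def by (rule prod_ge_1) auto
  have le: "norm (f s z) \<le> p" if "s \<in> S" for s
  proof -
    have "p = max 1 (norm (f s z)) * (\<Prod>s\<in>S-{s}. max 1 (norm (f s z)))"
      unfolding p_def by (rule prod.remove[OF assms that])
    moreover have "1 \<le> (\<Prod>s\<in>S-{s}. max 1 (norm (f s z)))" by (rule prod_ge_1) auto
    ultimately have "max 1 (norm (f s z)) * 1 \<le> p" by (simp only: mult_left_mono)
    then show ?thesis by simp
  qed
  have "(\<Sum>s\<in>S. norm (f s z)) \<le> real (card S) * p" using sum_bounded_above[of S "\<lambda>s. norm (f s z)" p] le by simp
  then have "1 + (\<Sum>s\<in>S. norm (f s z)) \<le> (1 + real (card S)) * p"
    using p1 by (simp add: distrib_right)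
  moreover have "0 < 1 + (\<Sum>s\<in>S. norm (f s z))" by (intro add_pos_nonneg sum_nonneg) auto
  ultimately have "log_sum S f z \<le> ln ((1 + real (card S)) * p)"
    unfolding log_sum_def by (intro ln_mono)
  also have "\<dots> = ln (1 + real (card S)) + ln p" using p1 by (intro ln_mult_pos) auto
  also have "ln p = (\<Sum>s\<in>S. ln (max 1 (norm (f s z))))"
  proof -
    have "max 1 x \<noteq> 0" for x :: real by (simp add: max_def)
    then show ?thesis unfolding p_def by (intro ln_prod assms)
  qed
  finally show ?thesis by (simp only: log_plus_eq)
qed

lemma log_sum_nonneg: "0 \<le> log_sum S f z"
  unfolding log_sum_def by (intro ln_ge_zero) (simp add: sum_nonneg)

lemma (in periodic_setting) log_sum_small:
  assumes "finite S" "\<And>s. s \<in> S \<Longrightarrow> f s \<in> small"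
  shows "circle_mean (log_sum S f) \<in> o[at_top](T)"
proof (rule smallo_dominated)
  show "(\<lambda>r. ln (1 + real (card S)) + (\<Sum>s\<in>S. nevanlinna_char (f s) r)) \<in> o[at_top](T)"
    by (intro sum_in_smallo const_smallo big_sum_in_smallo) (use assms(2) in \<open>auto simp: small_def\<close>)
  show "eventually (\<lambda>r. 0 \<le> circle_mean (log_sum S f) r \<and>
      circle_mean (log_sum S f) r \<le> ln (1 + real (card S)) + (\<Sum>s\<in>S. nevanlinna_char (f s) r)) at_top"
    using eventually_ge_at_top[of 0]
  proof eventually_elim
    case (elim r)
    have c: "has_circle_mean (log_sum S f) r (circle_mean (log_sum S f) r)"
      by (rule continuous_has_circle_mean[OF continuous_log_sum elim]) (rule small.holomorphic[OF assms(2)])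
    have m: "has_circle_mean (\<lambda>z. ln (1 + real (card S)) + (\<Sum>s\<in>S. max 0 (ln (norm (f s z))))) r
       (ln (1 + real (card S)) + (\<Sum>s\<in>S. nevanlinna_char (f s) r))"
      by (intro has_circle_mean_add has_circle_mean_const has_circle_mean_sum assms(1)
            has_circle_mean_log_plus small.holomorphic assms(2) elim)
    show ?case
      using has_circle_mean_mono[OF has_circle_mean_const c elim, of 0] log_sum_nonneg
        has_circle_mean_mono[OF c m elim log_sum_le[OF assms(1)]] by blast
  qed
qed

context moving_hyperplanes
begin

definition coeffs :: "((nat set \<times> nat) \<times> nat) set" where
  "coeffs = {(s, i). fst s \<subseteq> {0..q} \<and> card (fst s) = n + 1 \<and> snd s \<in> {0..n} \<and> i \<in> fst s}"

lemma finite_coeffs: "finite coeffs"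
proof (rule finite_subset)
  show "coeffs \<subseteq> (Pow {0..q} \<times> {0..n}) \<times> {0..q}" by (auto simp: coeffs_def)
qed auto

definition \<beta> :: "complex \<Rightarrow> real" where
  "\<beta> = log_sum coeffs (\<lambda>(s, i). \<phi> s i)"

definition \<alpha> :: "complex \<Rightarrow> real" where
  "\<alpha> = log_sum ({0..q} \<times> {0..n}) (\<lambda>(j, k). a j k)"

lemma \<beta>_hol: "x \<in> coeffs \<Longrightarrow> (case x of (s, i) \<Rightarrow> \<phi> s i) \<in> small"
  using \<phi>_small by (auto simp: coeffs_def)

lemma \<alpha>_hol: "x \<in> {0..q} \<times> {0..n} \<Longrightarrow> (case x of (j, k) \<Rightarrow> a j k) \<in> small"
  using a_small by auto

lemma continuous_\<alpha>: "continuous_on A \<alpha>" and continuous_\<beta>: "continuous_on A \<beta>"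
  unfolding \<alpha>_def \<beta>_def
  by (rule continuous_log_sum, rule small.holomorphic, erule \<alpha>_hol,
      rule continuous_log_sum, rule small.holomorphic, erule \<beta>_hol)

lemma norm_\<phi>_le:
  assumes "I \<subseteq> {0..q}" "card I = n + 1" "k \<in> {0..n}" "i \<in> I"
  shows "norm (\<phi> (I, k) i z) \<le> exp (\<beta> z)"
  unfolding \<beta>_def
  using norm_le_exp_log_sum[OF finite_coeffs, of "((I, k), i)" "\<lambda>(s, i). \<phi> s i" z] assms
  by (simp add: coeffs_def)

lemma sum_norm_\<phi>_le:
  assumes "I \<subseteq> {0..q}" "card I = n + 1" "k \<in> {0..n}"
  shows "(\<Sum>i\<in>I. norm (\<phi> (I, k) i z)) \<le> exp (\<beta> z)"
proof -
  have "(\<Sum>i\<in>I. norm (\<phi> (I, k) i z)) = (\<Sum>x\<in>(\<lambda>i. ((I, k), i)) ` I. norm ((case x of (s, i) \<Rightarrow> \<phi> s i) z))"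
    by (subst sum.reindex) (auto simp: inj_on_def)
  also have "\<dots> \<le> (\<Sum>x\<in>coeffs. norm ((case x of (s, i) \<Rightarrow> \<phi> s i) z))"
    by (rule sum_mono2[OF finite_coeffs]) (use assms in \<open>auto simp: coeffs_def\<close>)
  finally show ?thesis unfolding \<beta>_def exp_log_sum by simp
qed

lemma norm_L_le:
  assumes "j \<in> {0..q}"
  shows "norm (L j z) \<le> exp (logmax z + \<alpha> z)"
proof -
  have "norm (L j z) \<le> (\<Sum>k\<in>{0..n}. norm (a j k z) * norm (g k z))"
    unfolding L_eq norm_mult[symmetric] by (rule norm_sum)
  also have "\<dots> \<le> (\<Sum>k\<in>{0..n}. norm (a j k z) * exp (logmax z))"
    by (intro sum_mono mult_left_mono norm_le_logmax) auto
  also have "\<dots> = (\<Sum>k\<in>{0..n}. norm (a j k z)) * exp (logmax z)" by (rule sum_distrib_right[symmetric])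
  also have "\<dots> \<le> exp (\<alpha> z) * exp (logmax z)"
  proof (rule mult_right_mono)
    have "(\<Sum>k\<in>{0..n}. norm (a j k z)) = (\<Sum>x\<in>(\<lambda>k. (j, k)) ` {0..n}. norm ((case x of (j, k) \<Rightarrow> a j k) z))"
      by (subst sum.reindex) (auto simp: inj_on_def)
    also have "\<dots> \<le> (\<Sum>x\<in>{0..q} \<times> {0..n}. norm ((case x of (j, k) \<Rightarrow> a j k) z))"
      by (rule sum_mono2) (use assms in auto)
    finally show "(\<Sum>k\<in>{0..n}. norm (a j k z)) \<le> exp (\<alpha> z)" unfolding \<alpha>_def exp_log_sum by simp
  qed simp
  finally show ?thesis by (simp add: exp_add mult.commute)
qed

text \<open>The maximum includes the unshifted term \<open>j = 0\<close>, so its logarithm minus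
  that of the modulus at \<open>z\<close> is nonnegative wherever
  \<open>L i z \<noteq> 0\<close>.\<close>

definition shift_max :: "(complex \<Rightarrow> complex) \<Rightarrow> nat \<Rightarrow> complex \<Rightarrow> real" where
  "shift_max P i z = Max ((\<lambda>j. norm (L i (z + of_nat j * c) * exp (- P (z + of_nat j * c)))) ` {0..n})"

lemma shift_max_ge:
  "j \<le> n \<Longrightarrow> norm (L i (z + of_nat j * c)) \<le> shift_max P i z * exp (Re (P (z + of_nat j * c)))"
proof -
  assume j: "j \<le> n"
  have "norm (L i (z + of_nat j * c) * exp (- P (z + of_nat j * c))) \<le> shift_max P i z"
    unfolding shift_max_def using j by (intro Max_ge) auto
  then show ?thesis by (simp add: norm_mult norm_divide exp_minus field_simps)
qed

lemma pointwise_inequality: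
  assumes Lz: "\<And>j. j \<in> {0..q} \<Longrightarrow> L j z \<noteq> 0" and Wz: "W z \<noteq> 0" and \<psi>z: "\<psi> z \<noteq> 0"
  shows "(real q - real n) * logmax z \<le>
     (real q + 1) * \<beta> z + 2 * ln (fact (n + 1)) + (\<Sum>j\<in>{0..q}. ln (norm (L j z)))
     - ln (norm (W z)) - (real q + 1) * ln (norm (\<psi> z))
     + (\<Sum>i\<in>{0..q}. ln (shift_max P i z) - ln (norm (L i z * exp (- P z))))
     + (\<Sum>j\<in>{0..n}. Re (P (z + of_nat j * c)) - Re (P z))"
proof -
  obtain I where I: "I \<subseteq> {0..q}" "card I = n + 1"
      \<comment> \<open>The negative sign selects the forms of smallest modulus; \<open>I\<close>
        depends on \<open>z\<close> and must disappear from the final estimate.\<close>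
      "\<And>i j. i \<in> I \<Longrightarrow> j \<in> {0..q} - I \<Longrightarrow> - norm (L j z) \<le> - norm (L i z)"
    using exists_top_subset[of "{0..q}" "n + 1" "\<lambda>j. - norm (L j z)"] q by auto
  have finI: "finite I" by (rule finite_subset[OF I(1)]) simp
  obtain e where e: "bij_betw e {0..<Suc n} I" using ex_bij_betw_nat_finite[of I] I(2) finI by auto
  define M where "M i = shift_max P i z" for i
  define E where "E j = exp (Re (P (z + of_nat j * c)))" for j
  define l where "l j = ln (norm (L j z))" for j
  define X where "X i = ln (M i) - ln (norm (L i z * exp (- P z)))" for i
  have M0: "norm (L i z) \<le> M i * exp (Re (P z))" for i
    using shift_max_ge[of 0 i z P] by (simp add: M_def)
  have Mpos: "0 < M i" if "i \<in> {0..q}" for i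
  proof -
    have "0 < norm (L i z)" using Lz[OF that] by simp
    then have "0 < M i * exp (Re (P z))" using M0[of i] by linarith
    then show ?thesis by (simp add: zero_less_mult_iff)
  qed
  have Xeq: "X i = ln (M i) - l i + Re (P z)" if "i \<in> {0..q}" for i
    using Lz[OF that] by (simp add: X_def l_def norm_mult ln_mult)
  \<comment> \<open>Nonnegativity allows the sum of the \<open>X i\<close> over \<open>I\<close> to
    be enlarged to all of \<open>{0..q}\<close>, which removes its dependence on \<open>z\<close>
    through \<open>I\<close>.\<close>
  have Xpos: "0 \<le> X i" if i: "i \<in> {0..q}" for i
  proof -
    have "l i \<le> ln (M i * exp (Re (P z)))" unfolding l_def using M0[of i] Lz[OF i] by (intro ln_mono) auto
    also have "\<dots> = ln (M i) + Re (P z)" using Mpos[OF i] by (simp add: ln_mult)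
    finally show ?thesis using Xeq[OF i] by simp
  qed
  \<comment> \<open>A largest coordinate is expressed through the forms in \<open>I\<close>, each of
    which is at most \<open>L j\<close> in modulus.\<close>
  have out: "ln (norm (\<psi> z)) + logmax z \<le> \<beta> z + l j" if j: "j \<in> {0..q} - I" for j
  proof -
    obtain k where k: "k \<le> n" "norm (g k z) = exp (logmax z)" by (rule logmax_attained)
    have "norm (\<psi> z) * exp (logmax z) = norm (\<psi> z * g k z)" by (simp only: norm_mult k(2))
    also have "\<psi> z * g k z = (\<Sum>i\<in>I. \<phi> (I, k) i z * L i z)"
      using \<psi>_g[OF I(1,2), of k z 0] k by simp
    also have "norm \<dots> \<le> (\<Sum>i\<in>I. norm (\<phi> (I, k) i z) * norm (L i z))"
      unfolding norm_mult[symmetric] by (rule norm_sum)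
    also have "\<dots> \<le> (\<Sum>i\<in>I. norm (\<phi> (I, k) i z) * norm (L j z))"
      using I(3)[OF _ j] by (intro sum_mono mult_left_mono) auto
    also have "\<dots> = (\<Sum>i\<in>I. norm (\<phi> (I, k) i z)) * norm (L j z)" by (rule sum_distrib_right[symmetric])
    also have "\<dots> \<le> exp (\<beta> z) * norm (L j z)"
      by (intro mult_right_mono sum_norm_\<phi>_le I) (use k in auto)
    finally have "ln (norm (\<psi> z) * exp (logmax z)) \<le> ln (exp (\<beta> z) * norm (L j z))"
      using \<psi>z by (intro ln_mono) auto
    then show ?thesis using \<psi>z Lz[of j] j by (simp add: ln_mult l_def)
  qed
  \<comment> \<open>In each permutation product every form of \<open>I\<close> occurs once, giving
    the factor \<open>M i\<close>, and every shift occurs once, giving the exponential factor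
    \<open>E j\<close>.\<close>
  have detL: "norm (det_L e z) \<le> fact (Suc n) * ((\<Prod>i\<in>I. M i) * (\<Prod>j = 0..<Suc n. E j))"
    unfolding det_L_def
  proof (rule norm_det_mat_le)
    fix p assume p: "p permutes {0..<Suc n}"
    have bij: "bij_betw (\<lambda>k. e (p k)) {0..<Suc n} I"
      using bij_betw_trans[OF permutes_imp_bij[OF p] e] by (simp add: o_def)
    have "(\<Prod>j = 0..<Suc n. norm (L (e (p j)) (z + of_nat j * c))) \<le> (\<Prod>j = 0..<Suc n. M (e (p j)) * E j)"
      unfolding M_def E_def by (intro prod_mono conjI norm_ge_zero shift_max_ge) auto
    also have "\<dots> = (\<Prod>i\<in>I. M i) * (\<Prod>j = 0..<Suc n. E j)"
      unfolding prod.distrib prod.reindex_bij_betw[OF bij, of M] ..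
    finally show "(\<Prod>j = 0..<Suc n. norm (L (e (p j)) (z + of_nat j * c))) \<le> (\<Prod>i\<in>I. M i) * (\<Prod>j = 0..<Suc n. E j)" .
  qed
  have det\<phi>: "norm (det_\<phi> I e z) \<le> fact (Suc n) * exp (\<beta> z) ^ Suc n"
    unfolding det_\<phi>_def
  proof (rule norm_det_mat_le)
    fix p assume p: "p permutes {0..<Suc n}"
    have "(\<Prod>i = 0..<Suc n. norm (\<phi> (I, p i) (e i) z)) \<le> (\<Prod>i = 0..<Suc n. exp (\<beta> z))"
    proof (intro prod_mono conjI norm_ge_zero norm_\<phi>_le I)
      fix i assume i: "i \<in> {0..<Suc n}"
      show "p i \<in> {0..n}" using permutes_in_image[OF p, of i] i by auto
      show "e i \<in> I" using bij_betwE[OF e] i by blast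
    qed
    then show "(\<Prod>i = 0..<Suc n. norm (\<phi> (I, p i) (e i) z)) \<le> exp (\<beta> z) ^ Suc n" by simp
  qed
  have prodM: "0 < (\<Prod>i\<in>I. M i)" using Mpos I(1) by (intro prod_pos) auto
  have prodE: "0 < (\<Prod>j = 0..<Suc n. E j)" by (intro prod_pos) (auto simp: E_def)
  \<comment> \<open>One factorial comes from each of the two determinants, hence the term
    \<open>2 * ln (fact (n + 1))\<close>.\<close>
  have "norm (\<psi> z ^ Suc n * W z) \<le> (fact (Suc n) * ((\<Prod>i\<in>I. M i) * (\<Prod>j = 0..<Suc n. E j))) * (fact (Suc n) * exp (\<beta> z) ^ Suc n)"
    unfolding determinant_identity[OF I(1,2) e] norm_mult
    by (rule mult_mono[OF detL det\<phi>]) (use prodM prodE in auto)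
  then have "ln (norm (\<psi> z ^ Suc n * W z)) \<le> ln ((fact (Suc n) * ((\<Prod>i\<in>I. M i) * (\<Prod>j = 0..<Suc n. E j))) * (fact (Suc n) * exp (\<beta> z) ^ Suc n))"
    using \<psi>z Wz by (intro ln_mono) auto
  moreover have "ln (norm (\<psi> z ^ Suc n * W z)) = (real n + 1) * ln (norm (\<psi> z)) + ln (norm (W z))"
    using \<psi>z Wz by (simp add: norm_mult norm_power ln_mult ln_realpow algebra_simps del: power_Suc)
  moreover have "ln ((fact (Suc n) * ((\<Prod>i\<in>I. M i) * (\<Prod>j = 0..<Suc n. E j))) * (fact (Suc n) * exp (\<beta> z) ^ Suc n))
      = ln (fact (Suc n)) + (ln (\<Prod>i\<in>I. M i) + ln (\<Prod>j = 0..<Suc n. E j)) + (ln (fact (Suc n)) + (real n + 1) * \<beta> z)"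
  proof -
    have f: "0 < (fact (Suc n) :: real)" by (rule fact_gt_zero)
    have "ln (exp (\<beta> z) ^ Suc n) = (real n + 1) * \<beta> z" by (simp add: ln_realpow del: power_Suc)
    then show ?thesis using f prodM prodE
      by (simp only: ln_mult_pos mult_pos_pos zero_less_power exp_gt_zero)
  qed
  moreover have "ln (\<Prod>i\<in>I. M i) = (\<Sum>i\<in>I. ln (M i))"
  proof (rule ln_prod[OF finI])
    fix i assume "i \<in> I"
    then have "0 < M i" using Mpos I(1) by blast
    then show "M i \<noteq> 0" by simp
  qed
  moreover have "(\<Sum>i\<in>I. ln (M i)) = (\<Sum>i\<in>I. X i) + (\<Sum>i\<in>I. l i) - (real n + 1) * Re (P z)"
  proof -
    have "(\<Sum>i\<in>I. ln (M i)) = (\<Sum>i\<in>I. X i + l i - Re (P z))"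
      using Xeq I(1) by (intro sum.cong) auto
    then show ?thesis using I(2) by (simp add: sum.distrib sum_subtractf algebra_simps)
  qed
  moreover have "ln (\<Prod>j = 0..<Suc n. E j) = (\<Sum>j\<in>{0..n}. Re (P (z + of_nat j * c)))"
    by (subst ln_prod) (auto simp: E_def atLeastLessThanSuc_atLeastAtMost simp del: sum.op_ivl_Suc)
  ultimately have main: "(real n + 1) * ln (norm (\<psi> z)) + ln (norm (W z)) \<le>
      2 * ln (fact (n + 1)) + (real n + 1) * \<beta> z + (\<Sum>i\<in>I. X i) + (\<Sum>i\<in>I. l i)
      + ((\<Sum>j\<in>{0..n}. Re (P (z + of_nat j * c))) - (real n + 1) * Re (P z))"
    by simp
  \<comment> \<open>The \<open>q - n\<close> forms outside \<open>I\<close> each bring one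
    \<open>\<beta>\<close> and one \<open>ln (norm \<psi>)\<close>, and the determinant identity
    brings \<open>n + 1\<close> more: altogether \<open>q + 1\<close>.\<close>
  have cardO: "real (card ({0..q} - I)) = real q - real n" using I finI q by (simp add: card_Diff_subset)
  have "(\<Sum>j\<in>{0..q} - I. ln (norm (\<psi> z)) + logmax z) \<le> (\<Sum>j\<in>{0..q} - I. \<beta> z + l j)"
    by (rule sum_mono) (rule out)
  then have o: "(real q - real n) * (ln (norm (\<psi> z)) + logmax z) \<le> (real q - real n) * \<beta> z + (\<Sum>j\<in>{0..q} - I. l j)"
    by (simp only: sum_constant cardO sum.distrib)
  have sl: "(\<Sum>j\<in>{0..q}. l j) = (\<Sum>j\<in>{0..q} - I. l j) + (\<Sum>i\<in>I. l i)"
    by (rule sum.subset_diff[OF I(1)]) simp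
  have sX: "(\<Sum>i\<in>I. X i) \<le> (\<Sum>i\<in>{0..q}. X i)"
    by (rule sum_mono2) (use I(1) Xpos in auto)
  have sP: "(\<Sum>j\<in>{0..n}. Re (P (z + of_nat j * c)) - Re (P z)) = (\<Sum>j\<in>{0..n}. Re (P (z + of_nat j * c))) - (real n + 1) * Re (P z)"
    by (simp add: sum_subtractf)
  have "(real q - real n) * logmax z \<le>
     (real q + 1) * \<beta> z + 2 * ln (fact (n + 1)) + (\<Sum>j\<in>{0..q}. l j)
     - ln (norm (W z)) - (real q + 1) * ln (norm (\<psi> z)) + (\<Sum>i\<in>{0..q}. X i)
     + (\<Sum>j\<in>{0..n}. Re (P (z + of_nat j * c)) - Re (P z))"
    unfolding sP using main o sl sX by (simp add: algebra_simps)
  then show ?thesis unfolding X_def M_def l_def .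
qed

end

section \<open>The second main theorem\<close>

context moving_hyperplanes
begin

definition \<kappa> :: real where "\<kappa> = real n * norm c"

definition C0 :: real where
  "C0 = 2 * ln (fact (n + 1)) + (\<Sum>j\<in>{0..q}. log_lead (L j)) - log_lead W
     - (real q + 1) * log_lead \<psi> - (real q - real n) * logmax 0"

text \<open>The circle mean of \<open>pointwise_inequality\<close>. The summand 1 in the majorant
  makes the normalized forms at most \<open>exp (-1)\<close> in modulus, as
  \<open>shift_mean_bound\<close> demands. Absence of zeros on the circle makes the shift quotients
  continuous there.\<close>

lemma mean_inequality:
  assumes r: "1 \<le> r" "r < R" "\<kappa> < R - r"
    and nz: "\<And>z j. norm z = r \<Longrightarrow> j \<in> {0..q} \<Longrightarrow> L j z \<noteq> 0"
      "\<And>z. norm z = r \<Longrightarrow> W z \<noteq> 0" "\<And>z. norm z = r \<Longrightarrow> \<psi> z \<noteq> 0"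
    and P: "P holomorphic_on UNIV" "\<And>z. norm z = R \<Longrightarrow> logmax z + (\<alpha> z + 1) \<le> Re (P z)"
  shows "(real q - real n) * T r \<le> (\<Sum>j\<in>{0..q}. aperiodic_counting n c (L j) r) + C0
    + (real q + 1) * circle_mean \<beta> r
    + (\<Sum>i\<in>{0..q}. 2 * \<kappa> / (R - r) * (Re (P 0) - log_lead (L i)) + (zero_count (L i) R - zero_count (L i) r))
    + (\<Sum>j\<in>{0..n}. Re (P (of_nat j * c)) - Re (P 0))"
proof -
  have r0: "0 < r" "0 \<le> r" using r by auto
  obtain z0 z1 where z01: "\<psi> z0 \<noteq> 0" "W z1 \<noteq> 0" using \<psi>_nonzero W_nonzero by blast
  define F where "F i z = L i z * exp (- P z)" for i z
  have holF: "F i holomorphic_on UNIV" if "i \<in> {0..q}" for i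
    unfolding F_def[abs_def] by (intro holomorphic_intros L_hol that P)
  define X where "X i = circle_mean (\<lambda>z. ln (shift_max P i z) - ln (norm (F i z))) r" for i
  have mX: "has_circle_mean (\<lambda>z. ln (shift_max P i z) - ln (norm (F i z))) r (X i)" if i: "i \<in> {0..q}" for i
    unfolding X_def
  proof (rule continuous_has_circle_mean[OF _ r0(2)])
    have "continuous_on (sphere 0 r) (shift_max P i)"
      unfolding shift_max_def[abs_def] F_def[symmetric]
      by (rule continuous_on_Max_norm)
         (auto intro!: holomorphic_on_imp_continuous_on holomorphic_shift[OF holF[OF i]])
    moreover have "shift_max P i z \<noteq> 0" if "z \<in> sphere 0 r" for z
    proof -
      have "norm (L i z) \<le> shift_max P i z * exp (Re (P z))" using shift_max_ge[of 0 i z P] by simp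
      then show ?thesis using nz(1)[of z i] i that by auto
    qed
    ultimately have "continuous_on (sphere 0 r) (\<lambda>z. ln (shift_max P i z))" by (intro continuous_on_ln) auto
    moreover have "continuous_on (sphere 0 r) (\<lambda>z. ln (norm (F i z)))"
      by (rule continuous_on_ln_norm_entire[OF holF[OF i]]) (use nz(1) i in \<open>auto simp: F_def\<close>)
    ultimately show "continuous_on (sphere 0 r) (\<lambda>z. ln (shift_max P i z) - ln (norm (F i z)))"
      by (rule continuous_on_diff)
  qed
  have Xle: "X i \<le> 2 * \<kappa> / (R - r) * (Re (P 0) - log_lead (L i)) + (zero_count (L i) R - zero_count (L i) r)"
    if i: "i \<in> {0..q}" for i
  proof -
    obtain w where w: "L i w \<noteq> 0" using L_nonzero[OF i] by blast
    have "X i \<le> 2 * \<kappa> / (R - r) * (- log_lead (F i)) + (zero_count (F i) R - zero_count (F i) r)"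
    proof (rule shift_mean_bound[OF holF[OF i], of w r R "{0..n}" "\<lambda>j. of_nat j * c" \<kappa> "X i" 0])
      show "F i w \<noteq> 0" using w by (simp add: F_def)
      show "norm (F i z) \<le> exp (-1)" if "norm z \<le> R" for z
      proof -
        have "norm (L i z) \<le> exp (Re (P z - 1))"
        proof (rule max_principle_exp[OF L_hol[OF i] _ _ _ that])
          show "(\<lambda>z. P z - 1) holomorphic_on UNIV" by (intro holomorphic_intros P)
          show "0 < R" using r by simp
          show "norm (L i z) \<le> exp (Re (P z - 1))" if "norm z = R" for z
            using order_trans[OF norm_L_le[OF i, of z]] P(2)[OF that] by simp
        qed
        then show ?thesis by (simp add: F_def norm_mult norm_divide exp_minus exp_diff field_simps)
      qed
      show "norm (of_nat j * c) \<le> \<kappa>" if "j \<in> {0..n}" for j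
        unfolding \<kappa>_def norm_mult using that by (intro mult_right_mono) auto
      show "has_circle_mean (\<lambda>z. ln (Max ((\<lambda>j. norm (F i (z + of_nat j * c))) ` {0..n})) - ln (norm (F i z))) r (X i)"
        using mX[OF i] unfolding shift_max_def F_def .
      show "F i z \<noteq> 0" if "norm z = r" for z using nz(1)[OF that i] by (simp add: F_def)
    qed (use r in auto)
    moreover have "log_lead (F i) = log_lead (L i) - Re (P 0)"
      unfolding F_def[abs_def] by (rule log_lead_mult_exp(1)[OF L_hol[OF i] w P(1)])
    moreover have "zero_count (F i) s = zero_count (L i) s" for s
      unfolding F_def[abs_def] by (rule log_lead_mult_exp(2)[OF L_hol[OF i] w P(1)])
    ultimately show ?thesis by simp
  qed
  have mL: "has_circle_mean (\<lambda>z. ln (norm (L j z))) r (log_lead (L j) + zero_count (L j) r)" if j: "j \<in> {0..q}" for j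
    using L_nonzero[OF j] jensen[OF L_hol[OF j] _ r0(1)] by blast
  have mu: "has_circle_mean (\<lambda>z. (real q - real n) * logmax z) r ((real q - real n) * (T r + logmax 0))"
    by (intro has_circle_mean_cmult has_circle_mean_logmax r0)
  have mP: "has_circle_mean (\<lambda>z. Re (P z)) r (Re (P 0))"
    using has_circle_mean_Re_entire[OF P(1) r0(1), of 0] by simp
  have mR: "has_circle_mean (\<lambda>z. (real q + 1) * \<beta> z + 2 * ln (fact (n + 1)) + (\<Sum>j\<in>{0..q}. ln (norm (L j z)))
     - ln (norm (W z)) - (real q + 1) * ln (norm (\<psi> z))
     + (\<Sum>i\<in>{0..q}. ln (shift_max P i z) - ln (norm (F i z)))
     + (\<Sum>j\<in>{0..n}. Re (P (z + of_nat j * c)) - Re (P z))) r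
    ((real q + 1) * circle_mean \<beta> r + 2 * ln (fact (n + 1)) + (\<Sum>j\<in>{0..q}. log_lead (L j) + zero_count (L j) r)
     - (log_lead W + zero_count W r) - (real q + 1) * (log_lead \<psi> + zero_count \<psi> r)
     + (\<Sum>i\<in>{0..q}. X i) + (\<Sum>j\<in>{0..n}. Re (P (of_nat j * c)) - Re (P 0)))"
    by (intro has_circle_mean_add has_circle_mean_diff has_circle_mean_sum has_circle_mean_cmult has_circle_mean_const
          continuous_has_circle_mean[OF continuous_\<beta>] r0 mL mX mP has_circle_mean_Re_entire P
          jensen[OF W_hol z01(2)] jensen[OF \<psi>_hol z01(1)]) auto
  have "(real q - real n) * (T r + logmax 0) \<le>
    (real q + 1) * circle_mean \<beta> r + 2 * ln (fact (n + 1)) + (\<Sum>j\<in>{0..q}. log_lead (L j) + zero_count (L j) r)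
     - (log_lead W + zero_count W r) - (real q + 1) * (log_lead \<psi> + zero_count \<psi> r)
     + (\<Sum>i\<in>{0..q}. X i) + (\<Sum>j\<in>{0..n}. Re (P (of_nat j * c)) - Re (P 0))"
  proof (rule has_circle_mean_mono[OF mu mR r0(2)])
    fix z :: complex assume "norm z = r"
    then show "(real q - real n) * logmax z \<le> (real q + 1) * \<beta> z + 2 * ln (fact (n + 1)) + (\<Sum>j\<in>{0..q}. ln (norm (L j z)))
     - ln (norm (W z)) - (real q + 1) * ln (norm (\<psi> z))
     + (\<Sum>i\<in>{0..q}. ln (shift_max P i z) - ln (norm (F i z)))
     + (\<Sum>j\<in>{0..n}. Re (P (z + of_nat j * c)) - Re (P z))"
      unfolding F_def by (intro pointwise_inequality nz)
  qed
  moreover have "(\<Sum>i\<in>{0..q}. X i) \<le> (\<Sum>i\<in>{0..q}. 2 * \<kappa> / (R - r) * (Re (P 0) - log_lead (L i)) + (zero_count (L i) R - zero_count (L i) r))"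
    by (rule sum_mono) (rule Xle)
  moreover note counting_le[OF r(1)]
  ultimately show ?thesis by (simp add: C0_def sum.distrib algebra_simps)
qed

definition exceptional_radii :: "real set" where
  "exceptional_radii = norm ` ((\<Union>j\<in>{0..q}. {z. L j z = 0}) \<union> {z. W z = 0} \<union> {z. \<psi> z = 0})"

lemma countable_exceptional_radii: "countable exceptional_radii"
proof -
  have "countable {z. L j z = 0}" if "j \<in> {0..q}" for j
    using L_nonzero[OF that] countable_zeros[OF L_hol[OF that]] by blast
  moreover have "countable {z. W z = 0}" using W_nonzero countable_zeros[OF W_hol] by blast
  moreover have "countable {z. \<psi> z = 0}" using \<psi>_nonzero countable_zeros[OF \<psi>_hol] by blast
  ultimately show ?thesis unfolding exceptional_radii_def by (intro countable_image countable_Un countable_UN) auto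
qed

text \<open>Combining the characteristic with all counting functions lets one exceptional set
  control the growth of both.\<close>

definition \<Phi> :: "real \<Rightarrow> real" where "\<Phi> t = T t + (\<Sum>j\<in>{0..q}. zero_count (L j) t)"

lemma eventually_const_le_T: "0 < e \<Longrightarrow> eventually (\<lambda>r. C \<le> e * T r) at_top"
  using T_lim[unfolded filterlim_at_top, rule_format, of "C / e"]
  by (rule eventually_mono) (simp add: field_simps)

lemma eventually_smallo_le_T:
  assumes "f \<in> o[at_top](T)" "0 < e"
  shows "eventually (\<lambda>r. f r \<le> e * T r) at_top"
  using landau_o.smallD[OF assms] eventually_ge_at_top[of 1]
  by eventually_elim (use T_nonneg in \<open>auto simp: abs_le_iff\<close>)

lemma \<alpha>_small: "circle_mean \<alpha> \<in> o[at_top](T)"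
  unfolding \<alpha>_def by (rule log_sum_small) (use \<alpha>_hol in auto)

lemma \<beta>_small: "circle_mean \<beta> \<in> o[at_top](T)"
  unfolding \<beta>_def by (rule log_sum_small[OF finite_coeffs]) (use \<beta>_hol in auto)

lemma zero_count_L_mono: "j \<in> {0..q} \<Longrightarrow> 1 \<le> r \<Longrightarrow> r \<le> s \<Longrightarrow> zero_count (L j) r \<le> zero_count (L j) s"
  using L_nonzero[of j] zero_count_mono[OF L_hol] by blast

lemma \<Phi>_mono: "1 \<le> r \<Longrightarrow> r \<le> s \<Longrightarrow> \<Phi> r \<le> \<Phi> s"
  unfolding \<Phi>_def by (intro add_mono T_mono sum_mono zero_count_L_mono) auto

lemma T_le_\<Phi>: "1 \<le> r \<Longrightarrow> T r \<le> \<Phi> r"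
  unfolding \<Phi>_def by (simp add: sum_nonneg zero_count_nonneg)

text \<open>One \<open>T\<close> for the characteristic itself and three for each of the
  \<open>q + 1\<close> counting functions: \<open>T\<close> again, the mean of
  \<open>\<alpha>\<close>, and the constants of Jensen's formula.\<close>

definition B where "B = 1 + 3 * (real q + 1)"

lemma \<Phi>_le: "eventually (\<lambda>r. \<Phi> r \<le> B * T r) at_top"
proof -
  have "eventually (\<lambda>r. zero_count (L j) r \<le> 3 * T r) at_top" if j: "j \<in> {0..q}" for j
  proof -
    obtain w where w: "L j w \<noteq> 0" using L_nonzero[OF j] by blast
    have one: "(0 :: real) < 1" by simp
    show ?thesis
      using eventually_const_le_T[OF one, of "logmax 0 - log_lead (L j)"] eventually_smallo_le_T[OF \<alpha>_small one]
        eventually_gt_at_top[of 0]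
    proof eventually_elim
      case (elim r)
      have "zero_count (L j) r \<le> T r + logmax 0 + circle_mean \<alpha> r - log_lead (L j)"
        by (rule zero_count_le[OF L_hol[OF j] w norm_L_le[OF j] continuous_\<alpha> elim(3)])
      then show ?case using elim by simp
    qed
  qed
  then have "eventually (\<lambda>r. \<forall>j\<in>{0..q}. zero_count (L j) r \<le> 3 * T r) at_top"
    by (intro eventually_ball_finite) auto
  then show ?thesis
  proof eventually_elim
    case (elim r)
    have "(\<Sum>j\<in>{0..q}. zero_count (L j) r) \<le> (\<Sum>j\<in>{0..q}. 3 * T r)"
      by (rule sum_mono) (use elim in blast)
    then show ?case by (simp add: \<Phi>_def B_def algebra_simps)
  qed
qed

lemma \<Phi>_growth:
  obtains E where "finite_log_measure E"
    "\<And>K::nat. 1 \<le> K \<Longrightarrow> eventually (\<lambda>r. r \<notin> E \<longrightarrow> \<Phi> (r + real K) \<le> (1 + 1 / real K) * \<Phi> r) at_top"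
proof -
  define \<sigma>' where "\<sigma>' = (1 + \<sigma>) / 2"
  have \<sigma>': "0 < \<sigma>'" "\<sigma>' < 1" "\<sigma> < \<sigma>'" using \<sigma> by (auto simp: \<sigma>'_def)
  have B1: "1 \<le> B" by (simp add: B_def)
  have as: "eventually (\<lambda>r. ln B + r powr \<sigma> \<le> r powr \<sigma>') at_top"
    using \<sigma> \<sigma>' by real_asymp
  have "eventually (\<lambda>r. 1 \<le> T r) at_top" using T_lim unfolding filterlim_at_top by blast
  then have "eventually (\<lambda>r. 1 \<le> r \<and> 1 \<le> \<Phi> r \<and> ln (\<Phi> r) \<le> r powr \<sigma>') at_top"
    using eventually_ge_at_top[of 1] \<Phi>_le \<sigma>(3) as
  proof eventually_elim
    case (elim r)
    have 1: "1 \<le> \<Phi> r" using T_le_\<Phi>[OF elim(2)] elim(1) by simp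
    have "ln (\<Phi> r) \<le> ln (B * T r)" using elim(3) 1 by (intro ln_mono) auto
    also have "\<dots> = ln B + ln (T r)" using B1 elim(1) by (intro ln_mult_pos) auto
    finally show ?case using elim 1 by simp
  qed
  then obtain r0 where r0: "\<And>r. r0 \<le> r \<Longrightarrow> 1 \<le> r \<and> 1 \<le> \<Phi> r \<and> ln (\<Phi> r) \<le> r powr \<sigma>'"
    unfolding eventually_at_top_linorder by blast
  show ?thesis
    by (rule growth_outside_exceptional_set[of r0 \<Phi> \<sigma>'])
       (use r0 \<Phi>_mono \<sigma>' that in blast)+
qed

text \<open>The precision \<open>e\<close> determines the gap \<open>K\<close>; only then is the
  growth estimate for that \<open>K\<close> used. The set \<open>E\<close> does not depend on
  \<open>e\<close>.\<close>

lemma asymptotic_inequality: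
  assumes E: "\<And>K::nat. 1 \<le> K \<Longrightarrow> eventually (\<lambda>r. r \<notin> E \<longrightarrow> \<Phi> (r + real K) \<le> (1 + 1 / real K) * \<Phi> r) at_top"
    and e: "0 < e"
  shows "eventually (\<lambda>r. r \<notin> E \<longrightarrow> r \<notin> exceptional_radii \<longrightarrow>
    (real q - real n) * T r - (\<Sum>j\<in>{0..q}. aperiodic_counting n c (L j) r) \<le> e * T r) at_top"
proof -
  have B1: "1 \<le> B" by (simp add: B_def)
  have \<kappa>0: "0 \<le> \<kappa>" by (simp add: \<kappa>_def)
  \<comment> \<open>Five errors are to be absorbed: the mean of \<open>\<beta>\<close>, the Harnack
    loss, the increase of the counting functions, the shifts of \<open>Re P\<close>, and the
    constants.\<close>
  define e' where "e' = e / 5"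
  have e': "0 < e'" using e by (simp add: e'_def)
  \<comment> \<open>The Harnack loss is at most \<open>D / K * T r\<close>: outside \<open>E\<close>
    one has \<open>T R \<le> 2 * B * T r\<close>, the remaining terms in the bound for
    \<open>Re (P 0)\<close> cost at most \<open>2 * T R\<close>, so
    \<open>Re (P 0) \<le> 6 * B * T r\<close>, and \<open>- log_lead\<close> adds one more
    \<open>T r\<close>.\<close>
  define D where "D = (real q + 1) * (2 * \<kappa>) * (6 * B + 1)"
  have D0: "0 \<le> D" using \<kappa>0 B1 by (simp add: D_def)
  obtain K :: nat where K: "1 + \<kappa> + D / e' + B / e' \<le> real K" using real_arch_simple by blast
  have De: "0 \<le> D / e'" "0 \<le> B / e'" using D0 B1 e' by auto
  have K1: "1 \<le> K" and K\<kappa>: "\<kappa> < real K" and KD: "D / real K \<le> e'" and KB: "B / real K \<le> e'"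
  proof -
    have *: "1 \<le> real K" using K De \<kappa>0 by linarith
    then show "1 \<le> K" by simp
    show "\<kappa> < real K" using K De by linarith
    have "D / e' \<le> real K" "B / e' \<le> real K" using K De \<kappa>0 by linarith+
    then show "D / real K \<le> e'" "B / real K \<le> e'" using e' * by (auto simp: field_simps)
  qed
  \<comment> \<open>Distributes \<open>e'\<close> over the \<open>n + 1\<close> shifts, given the
    bound \<open>6 * B * T r\<close> for \<open>Re (P 0)\<close>.\<close>
  define \<epsilon> where "\<epsilon> = e' / (6 * B * (real n + 1))"
  have \<epsilon>: "0 < \<epsilon>" "(real n + 1) * (\<epsilon> * (6 * B)) = e'" using e' B1 by (auto simp: \<epsilon>_def)
  have "\<exists>C R1. \<forall>R P. R1 \<le> R \<longrightarrow> P holomorphic_on UNIV \<longrightarrow> (\<forall>z. norm z = R \<longrightarrow> logmax z \<le> Re (P z)) \<longrightarrow>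
      Re (P (of_nat j * c)) - Re (P 0) \<le> \<epsilon> * Re (P 0) + C" for j
    by (rule majorant_shift[OF \<epsilon>(1), of "of_nat j * c"]) blast
  then obtain C R1 where CR: "\<And>j R P. R1 j \<le> R \<Longrightarrow> P holomorphic_on UNIV \<Longrightarrow>
      (\<And>z. norm z = R \<Longrightarrow> logmax z \<le> Re (P z)) \<Longrightarrow> Re (P (of_nat j * c)) - Re (P 0) \<le> \<epsilon> * Re (P 0) + C j"
    by metis
  have one: "(0 :: real) < 1" by simp
  have q0: "0 < e' / (real q + 1)" using e' by simp
  have sh: "filterlim (\<lambda>r. r + real K) at_top at_top" by real_asymp
  have ev\<alpha>: "eventually (\<lambda>r. circle_mean \<alpha> (r + real K) \<le> 1 * T (r + real K)) at_top"
    by (rule eventually_compose_filterlim[OF eventually_smallo_le_T[OF \<alpha>_small one] sh])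
  have evu: "eventually (\<lambda>r. logmax 0 + 2 \<le> 1 * T (r + real K)) at_top"
    by (rule eventually_compose_filterlim[OF eventually_const_le_T[OF one] sh])
  have evR: "eventually (\<lambda>r. \<forall>j\<in>{0..n}. R1 j \<le> r) at_top"
    by (intro eventually_ball_finite) (auto intro: eventually_ge_at_top)
  have evl: "eventually (\<lambda>r. \<forall>i\<in>{0..q}. - log_lead (L i) \<le> 1 * T r) at_top"
    by (intro eventually_ball_finite) (auto intro: eventually_const_le_T[OF one, simplified])
  show ?thesis
    using E[OF K1] ev\<alpha> evu evR evl eventually_const_le_T[OF e', of "C0 + (\<Sum>j\<in>{0..n}. C j)"]
      eventually_smallo_le_T[OF \<beta>_small q0] \<Phi>_le eventually_ge_at_top[of 1]
  proof eventually_elim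
    case (elim r)
    show ?case
    proof (intro impI)
      assume rE: "r \<notin> E" and rX: "r \<notin> exceptional_radii"
      define R where "R = r + real K"
      have r: "1 \<le> r" "r < R" "\<kappa> < R - r" "1 \<le> R" using elim(9) K1 K\<kappa> by (auto simp: R_def)
      have RK: "R - r = real K" by (simp add: R_def)
      have Tr: "0 \<le> T r" using T_nonneg r by simp
      obtain P where P: "P holomorphic_on UNIV" "\<And>z. norm z = R \<Longrightarrow> logmax z + (\<alpha> z + 1) \<le> Re (P z)"
        "Re (P 0) \<le> T R + logmax 0 + circle_mean (\<lambda>z. \<alpha> z + 1) R + 1"
        by (rule harmonic_majorant[of R 1 "\<lambda>z. \<alpha> z + 1"]) (use r in \<open>auto intro!: continuous_intros continuous_\<alpha>\<close>)
      have \<alpha>1: "circle_mean (\<lambda>z. \<alpha> z + 1) R = circle_mean \<alpha> R + 1"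
        by (intro has_circle_mean_imp_eq has_circle_mean_add has_circle_mean_const continuous_has_circle_mean continuous_\<alpha>)
           (use r in auto)
      have \<Phi>R: "\<Phi> R \<le> (1 + 1 / real K) * \<Phi> r" using elim(1) rE by (simp add: R_def)
      have \<Phi>r0: "0 \<le> \<Phi> r" using T_le_\<Phi>[OF r(1)] Tr by linarith
      have "(1 + 1 / real K) * \<Phi> r \<le> 2 * \<Phi> r" using K1 \<Phi>r0 by (intro mult_right_mono) auto
      then have TR: "T R \<le> 2 * (B * T r)" using T_le_\<Phi>[OF r(4)] \<Phi>R elim(8) by linarith
      have P0: "Re (P 0) \<le> 6 * B * T r"
        using P(3) \<alpha>1 elim(2,3) TR unfolding R_def[symmetric] by linarith
      have BT: "0 \<le> 6 * B * T r" using B1 Tr by simp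
      have "(real q - real n) * T r \<le> (\<Sum>j\<in>{0..q}. aperiodic_counting n c (L j) r) + C0
        + (real q + 1) * circle_mean \<beta> r
        + (\<Sum>i\<in>{0..q}. 2 * \<kappa> / (R - r) * (Re (P 0) - log_lead (L i)) + (zero_count (L i) R - zero_count (L i) r))
        + (\<Sum>j\<in>{0..n}. Re (P (of_nat j * c)) - Re (P 0))"
        by (rule mean_inequality[OF r(1-3) _ _ _ P(1,2)]) (use rX in \<open>auto simp: exceptional_radii_def\<close>)
      moreover have "(real q + 1) * circle_mean \<beta> r \<le> e' * T r"
      proof -
        have "(real q + 1) * circle_mean \<beta> r \<le> (real q + 1) * (e' / (real q + 1) * T r)"
          by (rule mult_left_mono[OF elim(7)]) simp
        then show ?thesis by simp
      qed
      moreover have "(\<Sum>i\<in>{0..q}. 2 * \<kappa> / (R - r) * (Re (P 0) - log_lead (L i)) + (zero_count (L i) R - zero_count (L i) r))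
          \<le> e' * T r + e' * T r"
      proof -
        have "(\<Sum>i\<in>{0..q}. 2 * \<kappa> / (R - r) * (Re (P 0) - log_lead (L i))) \<le> (\<Sum>i\<in>{0..q}. 2 * \<kappa> / real K * ((6 * B + 1) * T r))"
        proof (rule sum_mono)
          fix i assume "i \<in> {0..q}"
          then have "Re (P 0) - log_lead (L i) \<le> (6 * B + 1) * T r" using P0 elim(5) by (fastforce simp: distrib_right)
          then show "2 * \<kappa> / (R - r) * (Re (P 0) - log_lead (L i)) \<le> 2 * \<kappa> / real K * ((6 * B + 1) * T r)"
            unfolding RK using \<kappa>0 by (intro mult_left_mono) auto
        qed
        also have "\<dots> = (real q + 1) * (2 * \<kappa> / real K * ((6 * B + 1) * T r))" by simp
        also have "\<dots> = D / real K * T r"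
          unfolding D_def by (simp only: times_divide_eq_left times_divide_eq_right mult_ac)
        also have "\<dots> \<le> e' * T r" using KD Tr by (rule mult_right_mono)
        finally have 1: "(\<Sum>i\<in>{0..q}. 2 * \<kappa> / (R - r) * (Re (P 0) - log_lead (L i))) \<le> e' * T r" .
        have "(\<Sum>i\<in>{0..q}. zero_count (L i) R - zero_count (L i) r) \<le> \<Phi> R - \<Phi> r"
          unfolding \<Phi>_def sum_subtractf using T_mono[of r R] r by simp
        also have "\<dots> \<le> \<Phi> r / real K" using \<Phi>R by (simp add: algebra_simps)
        also have "\<dots> \<le> B * T r / real K" using elim(8) by (intro divide_right_mono) auto
        also have "\<dots> = B / real K * T r" by simp
        also have "\<dots> \<le> e' * T r" using KB Tr by (rule mult_right_mono)
        finally show ?thesis using 1 by (simp add: sum.distrib)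
      qed
      moreover have "(\<Sum>j\<in>{0..n}. Re (P (of_nat j * c)) - Re (P 0)) \<le> e' * T r + (\<Sum>j\<in>{0..n}. C j)"
      proof -
        have "(\<Sum>j\<in>{0..n}. Re (P (of_nat j * c)) - Re (P 0)) \<le> (\<Sum>j\<in>{0..n}. \<epsilon> * (6 * B * T r) + C j)"
        proof (rule sum_mono)
          fix j assume j: "j \<in> {0..n}"
          have "Re (P (of_nat j * c)) - Re (P 0) \<le> \<epsilon> * Re (P 0) + C j"
          proof (rule CR[of j R, OF _ P(1)])
            show "R1 j \<le> R" using elim(4) j r by force
            show "logmax z \<le> Re (P z)" if "norm z = R" for z
              using P(2)[OF that] log_sum_nonneg[of "{0..q} \<times> {0..n}" "\<lambda>(j, k). a j k" z] by (simp add: \<alpha>_def)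
          qed
          also have "\<epsilon> * Re (P 0) \<le> \<epsilon> * (6 * B * T r)" using P0 \<epsilon>(1) by (intro mult_left_mono) auto
          finally show "Re (P (of_nat j * c)) - Re (P 0) \<le> \<epsilon> * (6 * B * T r) + C j" by simp
        qed
        also have "\<dots> = (real n + 1) * (\<epsilon> * (6 * B)) * T r + (\<Sum>j\<in>{0..n}. C j)"
          by (simp add: sum.distrib algebra_simps)
        finally show ?thesis unfolding \<epsilon>(2) .
      qed
      moreover have "e * T r = e' * T r + e' * T r + e' * T r + e' * T r + e' * T r" by (simp add: e'_def)
      ultimately show "(real q - real n) * T r - (\<Sum>j\<in>{0..q}. aperiodic_counting n c (L j) r) \<le> e * T r"
        using elim(6) by linarith
    qed
  qed
qed

end

theorem theorem4p3:
  fixes c :: complex and n q :: nat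
    and g :: "nat \<Rightarrow> complex \<Rightarrow> complex"
    and a :: "nat \<Rightarrow> nat \<Rightarrow> complex \<Rightarrow> complex"
  assumes "c \<noteq> 0" and "n \<ge> 1"
    and "reduced_representation n g"
    and "hyper_order (cartan_char n g) < 1"
    and "lin_indep_functions (periodic_field c) {0..n} g"
    and "\<And>j k. j \<in> {0..q} \<Longrightarrow> k \<in> {0..n} \<Longrightarrow> a j k holomorphic_on UNIV"
    and "\<And>j k z. j \<in> {0..q} \<Longrightarrow> k \<in> {0..n} \<Longrightarrow> a j k (z + c) = a j k z"
    and "\<And>j k. j \<in> {0..q} \<Longrightarrow> k \<in> {0..n} \<Longrightarrow>
           nevanlinna_char (a j k) \<in> o[at_top](cartan_char n g)"
    and "general_position (periodic_field c) n q a"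
  shows "\<exists>E S. finite_log_measure E \<and>
           S \<in> o[inf at_top (principal (- E))](cartan_char n g) \<and>
           (\<forall>r\<in>{0<..} - E.
              (real q - real n) * cartan_char n g r
                \<le> (\<Sum>j\<in>{0..q}. aperiodic_counting n c (hyperplane_form n g (a j)) r) + S r)"
proof -
  interpret holomorphic_curve n g by unfold_locales (rule assms(3))
  have T_lim: "filterlim T at_top at_top" by (rule filterlim_T[OF assms(2,5)])
  obtain \<sigma> where \<sigma>: "0 < \<sigma>" "\<sigma> < 1" "eventually (\<lambda>r. ln (T r) \<le> r powr \<sigma>) at_top"
    by (rule hyper_order_less_one_imp[OF assms(4) T_lim])
  interpret periodic_setting n g c \<sigma> by unfold_locales (rule T_lim \<sigma>)+
  have a_small: "a j k \<in> small" if "j \<in> {0..q}" "k \<in> {0..n}" for j k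
    using assms(6-8)[OF that] by (simp add: small_def)
  obtain \<psi> \<phi> where \<psi>\<phi>: "\<psi> \<in> small" "\<exists>z. \<psi> z \<noteq> 0"
    "\<And>I k i. I \<subseteq> {0..q} \<Longrightarrow> card I = n + 1 \<Longrightarrow> k \<in> {0..n} \<Longrightarrow> i \<in> I \<Longrightarrow> \<phi> (I, k) i \<in> small"
    "\<And>I k l z. I \<subseteq> {0..q} \<Longrightarrow> card I = n + 1 \<Longrightarrow> k \<in> {0..n} \<Longrightarrow> l \<in> {0..n} \<Longrightarrow>
       (\<Sum>i\<in>I. \<phi> (I, k) i z * a i l z) = (if l = k then \<psi> z else 0)"
    using common_inverse[OF a_small assms(9)] by blast
  interpret moving_hyperplanes n g c \<sigma> q a \<psi> \<phi>
    by unfold_locales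
       (use assms(9) a_small \<psi>\<phi> casoratian_nonzero[OF assms(5)] in \<open>auto simp: general_position_def\<close>)
  obtain E where E: "finite_log_measure E"
    "\<And>K::nat. 1 \<le> K \<Longrightarrow> eventually (\<lambda>r. r \<notin> E \<longrightarrow> \<Phi> (r + real K) \<le> (1 + 1 / real K) * \<Phi> r) at_top"
    by (rule \<Phi>_growth) (rule that, assumption, blast)
  define E' where "E' = E \<union> (exceptional_radii \<inter> {0<..})"
  define N where "N r = (\<Sum>j\<in>{0..q}. aperiodic_counting n c (hyperplane_form n g (a j)) r)" for r
  \<comment> \<open>The error is defined as the positive part of the defect, so the inequality holds
    for every \<open>r\<close>; the exceptional set matters only for the smallness of
    \<open>S\<close>.\<close>
  define S where "S r = max 0 ((real q - real n) * T r - N r)" for r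
  have "finite_log_measure E'"
    unfolding E'_def by (rule finite_log_measure_Un_countable[OF E(1) countable_exceptional_radii])
  moreover have "S \<in> o[inf at_top (principal (- E'))](T)"
  proof (rule landau_o.smallI)
    fix e :: real assume e: "0 < e"
    have "eventually (\<lambda>r. r \<notin> E \<longrightarrow> r \<notin> exceptional_radii \<longrightarrow>
        (real q - real n) * T r - (\<Sum>j\<in>{0..q}. aperiodic_counting n c (L j) r) \<le> e * T r) at_top"
      by (rule asymptotic_inequality[OF E(2) e])
    then have "eventually (\<lambda>r. r \<in> - E' \<longrightarrow> norm (S r) \<le> e * norm (T r)) at_top"
      using eventually_gt_at_top[of 0]
    proof eventually_elim
      case (elim r)
      show ?case
      proof
        assume "r \<in> - E'"
        then have "(real q - real n) * T r - N r \<le> e * T r"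
          using elim unfolding E'_def N_def L_def by auto
        then show "norm (S r) \<le> e * norm (T r)" using T_nonneg[OF elim(2)] e by (simp add: S_def)
      qed
    qed
    then show "eventually (\<lambda>r. norm (S r) \<le> e * norm (T r)) (inf at_top (principal (- E')))"
      by (simp add: eventually_inf_principal)
  qed
  moreover have "(real q - real n) * T r \<le> N r + S r" for r by (simp add: S_def)
  ultimately show ?thesis unfolding N_def by blast
qed

end
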